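(* (a) There exists a finite set $\mathcal{F}$ of pathographs such that the following problem is undecidable: given a pathograph $\mathfrak{H}$, is there an $\mathcal{F}$-free realization of $\mathfrak{H}$? (b) There exists a pathograph $\mathfrak{H}$ such that the following problem is undecidable: given a finite set $\mathcal{F}$ of pathographs, is there an $\mathcal{F}$-free realization of $\mathfrak{H}$?
   Context: All graphs are finite and simple. A pathograph is a tuple $\mathfrak{G}=(V,U,E,S,R,\pi)$ where $V$ (vertices) and $U$ (urpaths) are finite disjoint sets, $E\subseteq\binom{V}{2}$ (edges), $S\subseteq V\times U$ (spokes), $R\subseteq\binom{U}{2}$ (rungs), and $\pi:U\to\binom{V}{2}$ assigns to each urpath its two distinct endpoints, with $\pi(U)\cap E=\emptyset$. A realization of $\mathfrak{G}$ is a graph obtained as follows: start from the graph $(V,E)$; for each urpath $u$ with endpoints $a,b$ add new vertices $x_u^{(1)},\dots,x_u^{(m_u)}$ ($m_u\ge1$, the internal vertices of $u$) and the edges of the path $a x_u^{(1)}\cdots x_u^{(m_u)} b$; the only further edges added are: for each spoke $(v,u)$, a nonempty set of edges between $v$ and internal vertices of $u$; for each rung $\{u,u'\}$, a nonempty set of edges between internal vertices of $u$ and of $u'$. A graph $G$ contains a pathograph $\mathfrak{F}$ if some induced subgraph of $G$ is isomorphic to a realization of $\mathfrak{F}$; $G$ is $\mathcal{F}$-free if it contains no member of $\mathcal{F}$. *)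

theory Defs
  imports Main "HOL-Library.Nat_Bijection"
begin

text \<open>total_rec n f : f, restricted to argument lists of length n, is a total
  (general) recursive function of n arguments.  This is Kleene's class of
  general recursive functions: the closure of zero, successor and projections
  under composition, primitive recursion and regular minimisation.\<close>

inductive total_rec :: "nat \<Rightarrow> (nat list \<Rightarrow> nat) \<Rightarrow> bool" where
  zero: "total_rec n (\<lambda>_. 0)"
| succ: "total_rec 1 (\<lambda>xs. Suc (hd xs))"
| proj: "i < n \<Longrightarrow> total_rec n (\<lambda>xs. xs ! i)"
| comp: "total_rec m f \<Longrightarrow> length gs = m \<Longrightarrow> (\<forall>g\<in>set gs. total_rec n g)
          \<Longrightarrow> total_rec n (\<lambda>xs. f (map (\<lambda>g. g xs) gs))"
| prim: "total_rec n f \<Longrightarrow> total_rec (Suc (Suc n)) g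
          \<Longrightarrow> total_rec (Suc n)
                (\<lambda>ys. rec_nat (f (tl ys)) (\<lambda>y r. g (y # r # tl ys)) (hd ys))"
| mu: "total_rec (Suc n) g \<Longrightarrow> (\<forall>xs. length xs = n \<longrightarrow> (\<exists>y. g (y # xs) = 0))
          \<Longrightarrow> total_rec n (\<lambda>xs. LEAST y. g (y # xs) = 0)"
| ext: "total_rec n f \<Longrightarrow> (\<forall>xs. length xs = n \<longrightarrow> g xs = f xs) \<Longrightarrow> total_rec n g"

text \<open>Vertices and urpaths are natural numbers (disjoint finite sets);
  pi u is the 2-element set of endpoints of urpath u.\<close>

record pathograph =
  pV :: "nat set"
  pU :: "nat set"
  pE :: "nat set set"
  pS :: "(nat \<times> nat) set"
  pR :: "nat set set"
  ppi :: "nat \<Rightarrow> nat set"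

definition wf_pathograph :: "pathograph \<Rightarrow> bool" where
  "wf_pathograph H \<longleftrightarrow>
     finite (pV H) \<and> finite (pU H) \<and> pV H \<inter> pU H = {} \<and>
     pE H \<subseteq> {e. e \<subseteq> pV H \<and> card e = 2} \<and>
     pS H \<subseteq> pV H \<times> pU H \<and>
     pR H \<subseteq> {r. r \<subseteq> pU H \<and> card r = 2} \<and>
     (\<forall>u\<in>pU H. ppi H u \<subseteq> pV H \<and> card (ppi H u) = 2 \<and> ppi H u \<notin> pE H)"

definition path_edges :: "'a list \<Rightarrow> 'a set set" where
  "path_edges xs = {{xs ! i, xs ! Suc i} | i. Suc i < length xs}"

text \<open>A graph (W, EG) on natural-number vertices is a realization of H if it is
  (isomorphic to) a graph obtained by the construction: phi embeds V, each urpath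
  u becomes the path  phi a, P u, phi b  with ends (a,b) = en u, {a,b} = pi u,
  P u nonempty, and the only other edges are spoke/rung edges, at least one for
  every spoke and every rung.\<close>
definition realization :: "pathograph \<Rightarrow> nat set \<Rightarrow> nat set set \<Rightarrow> bool" where
  "realization H W EG \<longleftrightarrow>
     finite W \<and> EG \<subseteq> {e. e \<subseteq> W \<and> card e = 2} \<and>
     (\<exists>(\<phi>::nat \<Rightarrow> nat) (P::nat \<Rightarrow> nat list) (en::nat \<Rightarrow> nat \<times> nat).
        inj_on \<phi> (pV H) \<and>
        (\<forall>u\<in>pU H. {fst (en u), snd (en u)} = ppi H u) \<and>
        (\<forall>u\<in>pU H. P u \<noteq> [] \<and> distinct (P u) \<and> set (P u) \<inter> \<phi> ` pV H = {}) \<and>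
        (\<forall>u\<in>pU H. \<forall>u'\<in>pU H. u \<noteq> u' \<longrightarrow> set (P u) \<inter> set (P u') = {}) \<and>
        W = \<phi> ` pV H \<union> (\<Union>u\<in>pU H. set (P u)) \<and>
        (\<forall>e\<in>pE H. \<phi> ` e \<in> EG) \<and>
        (\<forall>u\<in>pU H. path_edges (\<phi> (fst (en u)) # P u @ [\<phi> (snd (en u))]) \<subseteq> EG) \<and>
        (\<forall>(v,u)\<in>pS H. \<exists>x\<in>set (P u). {\<phi> v, x} \<in> EG) \<and>
        (\<forall>u u'. {u,u'} \<in> pR H \<longrightarrow> (\<exists>x\<in>set (P u). \<exists>y\<in>set (P u'). {x,y} \<in> EG)) \<and>
        (\<forall>e\<in>EG.
           (\<exists>e'\<in>pE H. e = \<phi> ` e') \<or>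
           (\<exists>u\<in>pU H. e \<in> path_edges (\<phi> (fst (en u)) # P u @ [\<phi> (snd (en u))])) \<or>
           (\<exists>(v,u)\<in>pS H. \<exists>x\<in>set (P u). e = {\<phi> v, x}) \<or>
           (\<exists>u u'. {u,u'} \<in> pR H \<and> (\<exists>x\<in>set (P u). \<exists>y\<in>set (P u'). e = {x,y}))))"

definition contains_pg :: "nat set \<Rightarrow> nat set set \<Rightarrow> pathograph \<Rightarrow> bool" where
  "contains_pg W EG F \<longleftrightarrow> (\<exists>W'\<subseteq>W. realization F W' {e\<in>EG. e \<subseteq> W'})"

definition pg_free :: "pathograph set \<Rightarrow> nat set \<Rightarrow> nat set set \<Rightarrow> bool" where
  "pg_free \<F> W EG \<longleftrightarrow> (\<forall>F\<in>\<F>. \<not> contains_pg W EG F)"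

definition has_free_realization :: "pathograph set \<Rightarrow> pathograph \<Rightarrow> bool" where
  "has_free_realization \<F> H \<longleftrightarrow> (\<exists>W EG. realization H W EG \<and> pg_free \<F> W EG)"

definition pg_code :: "pathograph \<Rightarrow> nat" where
  "pg_code H = list_encode
     [set_encode (pV H), set_encode (pU H), set_encode (set_encode ` pE H),
      set_encode (prod_encode ` pS H), set_encode (set_encode ` pR H),
      set_encode ((\<lambda>u. prod_encode (u, set_encode (ppi H u))) ` pU H)]"

definition family_code :: "pathograph set \<Rightarrow> nat" where
  "family_code \<F> = set_encode (pg_code ` \<F>)"

end

theory Submission
  imports Defs "HOL-Library.Infinite_Set" "HOL-Computational_Algebra.Primes"
begin

text \<open>Every total recursive function is computed by a program over counters, so a universal program,
  which steps through prime-power codes of stores, halts on an undecidable set of inputs.  A run of the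
  corresponding counter machine is drawn as a graph: one long path is the time line, one further path per
  counter is the line of its values, and each time is joined to the current values and to vertices
  labelling its state.  Labels and path ends are adjacent to a rigid threshold graph, so that an induced
  copy of a pattern containing that graph cannot be displaced.  Forbidding all pathographs of bounded size
  that occur in no graph of a run forces every realization to be locally, hence globally, a run.  The
  input is put either into the pathograph to be realized, or into finitely many further forbidden patterns
  fixing the initial value of the first counter.\<close>

subsection \<open>Closure properties of total recursive functions\<close>

lemma total_rec_const: "total_rec n (\<lambda>_. c)"
proof (induction c)
  case 0
  show ?case by (rule total_rec.zero)
next
  case (Suc c)
  have "total_rec n (\<lambda>xs. (\<lambda>xs. Suc (hd xs)) (map (\<lambda>g. g xs) [\<lambda>_. c]))"
    by (rule total_rec.comp[OF total_rec.succ]) (use Suc in auto)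
  then show ?case by simp
qed

lemma total_rec_app:
  assumes "total_rec 1 f" "total_rec n g" shows "total_rec n (\<lambda>xs. f [g xs])"
proof -
  have "total_rec n (\<lambda>xs. f (map (\<lambda>g. g xs) [g]))"
    by (rule total_rec.comp[OF assms(1)]) (use assms in auto)
  then show ?thesis by simp
qed

lemma total_rec_unary: "total_rec 1 (\<lambda>xs. h (xs ! 0)) \<Longrightarrow> total_rec n f \<Longrightarrow> total_rec n (\<lambda>xs. h (f xs))"
  using total_rec_app[of "\<lambda>xs. h (xs ! 0)" n f] by simp

lemma total_rec_Suc: "total_rec n f \<Longrightarrow> total_rec n (\<lambda>xs. Suc (f xs))"
  using total_rec_app[OF total_rec.succ, of n f] by simp

lemma total_rec_reindex:
  assumes "total_rec m f" "length js = m" "set js \<subseteq> {..<n}"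
    and "\<And>xs. length xs = n \<Longrightarrow> r xs = map ((!) xs) js"
  shows "total_rec n (\<lambda>xs. f (r xs))"
proof -
  let ?projs = "map (\<lambda>i xs. xs ! i) js"
  have "total_rec n (\<lambda>xs. f (map (\<lambda>g. g xs) ?projs))"
    by (rule total_rec.comp[OF assms(1)]) (use assms(2,3) in \<open>auto intro: total_rec.proj\<close>)
  then show ?thesis
    by (rule total_rec.ext) (simp add: assms(4) comp_def)
qed

lemma tl_conv_map_nth: "length xs = Suc n \<Longrightarrow> tl xs = map ((!) xs) [1..<Suc n]"
  by (rule nth_equalityI) (auto simp: nth_tl simp del: upt_Suc)

lemma total_rec_tl: "total_rec n f \<Longrightarrow> total_rec (Suc n) (\<lambda>xs. f (tl xs))"
  by (rule total_rec_reindex[where js = "[1..<Suc n]"]) (auto simp: tl_conv_map_nth simp del: upt_Suc)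

lemma total_rec_drop_second:
  assumes "total_rec (Suc n) f" shows "total_rec (Suc (Suc n)) (\<lambda>xs. f (xs ! 0 # tl (tl xs)))"
proof (rule total_rec_reindex[OF assms, of "0 # [2..<Suc (Suc n)]"])
  fix xs :: "nat list" assume "length xs = Suc (Suc n)"
  then show "xs ! 0 # tl (tl xs) = map ((!) xs) (0 # [2..<Suc (Suc n)])"
    by (auto intro!: nth_equalityI simp: nth_tl nth_Cons' simp del: upt_Suc)
qed auto

lemma total_rec_rec_nat:
  assumes "total_rec n b" "total_rec n f"
    and "total_rec (Suc (Suc n)) (\<lambda>ys. g (ys ! 0) (ys ! 1) (tl (tl ys)))"
  shows "total_rec n (\<lambda>xs. rec_nat (f xs) (\<lambda>y r. g y r xs) (b xs))"
proof -
  let ?h = "\<lambda>ys. rec_nat (f (tl ys)) (\<lambda>y r. g y r (tl ys)) (hd ys)"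
  let ?gs = "b # map (\<lambda>i xs. xs ! i) [0..<n]"
  have "total_rec (Suc n) ?h"
    using total_rec.prim[OF assms(2,3)] by simp
  then have "total_rec n (\<lambda>xs. ?h (map (\<lambda>g. g xs) ?gs))"
    by (rule total_rec.comp) (use assms(1) in \<open>auto intro: total_rec.proj\<close>)
  then show ?thesis
  proof (rule total_rec.ext, intro allI impI)
    fix xs :: "nat list" assume "length xs = n"
    then have "xs = map (\<lambda>i. xs ! i) [0..<n]"
      by (metis map_nth)
    then show "rec_nat (f xs) (\<lambda>y r. g y r xs) (b xs) = ?h (map (\<lambda>g. g xs) ?gs)"
      by (simp add: comp_def)
  qed
qed

lemma total_rec_add:
  assumes "total_rec n f" "total_rec n g" shows "total_rec n (\<lambda>xs. f xs + g xs)"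
proof -
  have "total_rec n (\<lambda>xs. rec_nat (f xs) (\<lambda>y r. Suc r) (g xs))"
    by (rule total_rec_rec_nat[OF assms(2,1)]) (auto intro!: total_rec_Suc total_rec.proj)
  moreover have "rec_nat a (\<lambda>y r. Suc r) b = a + b" for a b by (induction b) auto
  ultimately show ?thesis by simp
qed

lemma total_rec_mult:
  assumes "total_rec n f" "total_rec n g" shows "total_rec n (\<lambda>xs. f xs * g xs)"
proof -
  have "total_rec n (\<lambda>xs. rec_nat 0 (\<lambda>y r. r + f xs) (g xs))"
    by (rule total_rec_rec_nat[OF assms(2) total_rec.zero, where g = "\<lambda>y r xs. r + f xs"])
      (intro total_rec_add total_rec.proj total_rec_tl assms, simp)
  moreover have "rec_nat 0 (\<lambda>y r. r + a) b = a * b" for a b :: nat by (induction b) auto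
  ultimately show ?thesis by simp
qed

lemma total_rec_power:
  assumes "total_rec n f" "total_rec n g" shows "total_rec n (\<lambda>xs. f xs ^ g xs)"
proof -
  have "total_rec n (\<lambda>xs. rec_nat 1 (\<lambda>y r. f xs * r) (g xs))"
    by (rule total_rec_rec_nat[OF assms(2) total_rec_const, where g = "\<lambda>y r xs. f xs * r"])
      (intro total_rec_mult total_rec.proj total_rec_tl assms, simp)
  moreover have "rec_nat 1 (\<lambda>y r. a * r) b = a ^ b" for a b :: nat by (induction b) auto
  ultimately show ?thesis by simp
qed

lemma total_rec_pred:
  assumes "total_rec n f" shows "total_rec n (\<lambda>xs. f xs - 1)"
proof -
  have "total_rec n (\<lambda>xs. rec_nat 0 (\<lambda>y r. y) (f xs))"
    by (rule total_rec_rec_nat[OF assms total_rec.zero]) (auto intro!: total_rec.proj)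
  moreover have "rec_nat 0 (\<lambda>y r. y) b = b - 1" for b :: nat by (cases b) auto
  ultimately show ?thesis by simp
qed

lemma total_rec_diff:
  assumes "total_rec n f" "total_rec n g" shows "total_rec n (\<lambda>xs. f xs - g xs)"
proof -
  have "total_rec n (\<lambda>xs. rec_nat (f xs) (\<lambda>y r. r - 1) (g xs))"
    by (rule total_rec_rec_nat[OF assms(2,1)]) (intro total_rec_pred total_rec.proj, simp)
  moreover have "rec_nat a (\<lambda>y r. r - 1) b = a - b" for a b :: nat by (induction b) auto
  ultimately show ?thesis by simp
qed

lemma total_rec_sum:
  assumes "total_rec n b" "total_rec (Suc n) (\<lambda>ys. g (ys ! 0) (tl ys))"
  shows "total_rec n (\<lambda>xs. \<Sum>y<b xs. g y xs)"
proof -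
  have summand: "total_rec (Suc (Suc n)) (\<lambda>ys. g (ys ! 0) (tl (tl ys)))"
    using total_rec_drop_second[OF assms(2)] by simp
  have "total_rec n (\<lambda>xs. rec_nat 0 (\<lambda>y r. r + g y xs) (b xs))"
    by (rule total_rec_rec_nat[OF assms(1) total_rec.zero, where g = "\<lambda>y r xs. r + g y xs"])
      (intro total_rec_add total_rec.proj summand, simp)
  moreover have "rec_nat 0 (\<lambda>y r. r + h y) b = (\<Sum>y<b. h y)" for h :: "nat \<Rightarrow> nat" and b
    by (induction b) auto
  ultimately show ?thesis by simp
qed

definition decidable_pred :: "nat \<Rightarrow> (nat list \<Rightarrow> bool) \<Rightarrow> bool" where
  "decidable_pred n P \<longleftrightarrow> total_rec n (\<lambda>xs. of_bool (P xs))"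

lemma total_rec_of_bool: "decidable_pred n P \<Longrightarrow> total_rec n (\<lambda>xs. of_bool (P xs))"
  by (simp add: decidable_pred_def)

lemma decidable_pred_const: "decidable_pred n (\<lambda>_. P)"
  unfolding decidable_pred_def by (rule total_rec_const)

lemma decidable_pred_not: "decidable_pred n P \<Longrightarrow> decidable_pred n (\<lambda>xs. \<not> P xs)"
  unfolding decidable_pred_def of_bool_not_iff
  using total_rec_diff[OF total_rec_const[of n 1]]
  by (rule total_rec.ext) (auto simp: of_bool_def)

lemma decidable_pred_conj:
  "decidable_pred n P \<Longrightarrow> decidable_pred n Q \<Longrightarrow> decidable_pred n (\<lambda>xs. P xs \<and> Q xs)"
  unfolding decidable_pred_def of_bool_conj by (rule total_rec_mult)

lemma decidable_pred_disj:
  "decidable_pred n P \<Longrightarrow> decidable_pred n Q \<Longrightarrow> decidable_pred n (\<lambda>xs. P xs \<or> Q xs)"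
  using decidable_pred_not[OF decidable_pred_conj[OF decidable_pred_not decidable_pred_not]]
  by simp

lemma decidable_pred_imp:
  "decidable_pred n P \<Longrightarrow> decidable_pred n Q \<Longrightarrow> decidable_pred n (\<lambda>xs. P xs \<longrightarrow> Q xs)"
  unfolding imp_conv_disj by (intro decidable_pred_disj decidable_pred_not)

lemma decidable_pred_le:
  assumes "total_rec n f" "total_rec n g" shows "decidable_pred n (\<lambda>xs. f xs \<le> g xs)"
proof -
  have "total_rec n (\<lambda>xs. 1 - (f xs - g xs))"
    by (intro total_rec_diff total_rec_const assms)
  then show ?thesis
    unfolding decidable_pred_def by (rule total_rec.ext) (auto simp: of_bool_def)
qed

lemma decidable_pred_less:
  assumes "total_rec n f" "total_rec n g" shows "decidable_pred n (\<lambda>xs. f xs < g xs)"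
  using decidable_pred_le[OF total_rec_Suc[OF assms(1)] assms(2)] by (simp add: Suc_le_eq)

lemma decidable_pred_eq:
  assumes "total_rec n f" "total_rec n g" shows "decidable_pred n (\<lambda>xs. f xs = g xs)"
  unfolding eq_iff by (intro decidable_pred_conj decidable_pred_le assms)

lemma decidable_pred_ex:
  assumes "total_rec n b" "decidable_pred (Suc n) (\<lambda>ys. P (ys ! 0) (tl ys))"
  shows "decidable_pred n (\<lambda>xs. \<exists>y<b xs. P y xs)"
proof -
  have "decidable_pred n (\<lambda>xs. 0 < (\<Sum>y<b xs. of_bool (P y xs) :: nat))"
    by (intro decidable_pred_less total_rec_const total_rec_sum total_rec_of_bool assms)
  moreover have "0 < (\<Sum>y<c. of_bool (Q y) :: nat) \<longleftrightarrow> (\<exists>y<c. Q y)" for c :: nat and Q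
    by (auto simp: zero_less_iff_neq_zero)
  ultimately show ?thesis by simp
qed

lemma total_rec_if:
  assumes "decidable_pred n P" "total_rec n f" "total_rec n g"
  shows "total_rec n (\<lambda>xs. if P xs then f xs else g xs)"
proof -
  have "total_rec n (\<lambda>xs. of_bool (P xs) * f xs + of_bool (\<not> P xs) * g xs)"
    by (intro total_rec_add total_rec_mult total_rec_of_bool decidable_pred_not assms)
  then show ?thesis by (rule total_rec.ext) auto
qed

lemma total_rec_Least:
  assumes "decidable_pred (Suc n) (\<lambda>ys. P (ys ! 0) (tl ys))"
    and "\<And>xs. length xs = n \<Longrightarrow> \<exists>y. P y xs"
  shows "total_rec n (\<lambda>xs. LEAST y. P y xs)"
proof -
  let ?g = "\<lambda>ys. of_bool (\<not> P (ys ! 0) (tl ys)) :: nat"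
  have "total_rec (Suc n) ?g"
    by (intro total_rec_of_bool decidable_pred_not assms(1))
  then have "total_rec n (\<lambda>xs. LEAST y. ?g (y # xs) = 0)"
    by (rule total_rec.mu) (use assms(2) in auto)
  then show ?thesis by simp
qed

lemma div_conv_sum: "a div b = (\<Sum>q<a. of_bool (0 < b \<and> Suc q * b \<le> a))" for a b :: nat
proof (cases "b = 0")
  case False
  then have "Suc q * b \<le> a \<longleftrightarrow> q < a div b" for q
    using less_eq_div_iff_mult_less_eq[of b "Suc q" a] by (simp add: Suc_le_eq)
  then have "{q. q < a \<and> Suc q * b \<le> a} = {..<a div b}"
    by (auto intro: less_le_trans[OF _ div_le_dividend] simp del: mult_Suc)
  then show ?thesis
    using False by (simp add: sum_of_bool_eq lessThan_def Int_def del: mult_Suc)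
qed simp

lemma total_rec_div:
  assumes "total_rec n f" "total_rec n g" shows "total_rec n (\<lambda>xs. f xs div g xs)"
  unfolding div_conv_sum
  by (intro total_rec_sum total_rec_of_bool decidable_pred_conj decidable_pred_less
      decidable_pred_le total_rec_const total_rec_mult total_rec_Suc total_rec.proj
      total_rec_tl assms) simp_all

lemma total_rec_mod:
  assumes "total_rec n f" "total_rec n g" shows "total_rec n (\<lambda>xs. f xs mod g xs)"
  unfolding modulo_nat_def by (intro total_rec_diff total_rec_div total_rec_mult assms)

lemma decidable_pred_dvd:
  assumes "total_rec n f" "total_rec n g" shows "decidable_pred n (\<lambda>xs. f xs dvd g xs)"
  unfolding dvd_eq_mod_eq_0 by (intro decidable_pred_eq total_rec_mod total_rec_const assms)

lemma decidable_pred_set_decode: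
  assumes "total_rec n f" "total_rec n g" shows "decidable_pred n (\<lambda>xs. f xs \<in> set_decode (g xs))"
  unfolding set_decode_def mem_Collect_eq odd_iff_mod_2_eq_one
  by (intro decidable_pred_eq total_rec_mod total_rec_div total_rec_power total_rec_const assms)

lemma total_rec_prod_encode:
  assumes "total_rec n f" "total_rec n g" shows "total_rec n (\<lambda>xs. prod_encode (f xs, g xs))"
  unfolding prod_encode_def triangle_def prod.case
  by (intro total_rec_add total_rec_div total_rec_mult total_rec_Suc total_rec_const assms)

lemmas total_rec_intros =
  total_rec_const total_rec.proj total_rec_tl
  total_rec_Suc total_rec_add total_rec_diff total_rec_mult total_rec_power total_rec_div total_rec_mod
  total_rec_prod_encode total_rec_sum total_rec_of_bool total_rec_if
  decidable_pred_const decidable_pred_not decidable_pred_conj decidable_pred_disj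
  decidable_pred_imp decidable_pred_le decidable_pred_less decidable_pred_eq
  decidable_pred_dvd decidable_pred_ex decidable_pred_set_decode

lemma fst_prod_decode_conv_Least: "fst (prod_decode z) = (LEAST x. \<exists>y<Suc z. z = prod_encode (x, y))"
proof (rule Least_equality[symmetric])
  show "\<exists>y<Suc z. z = prod_encode (fst (prod_decode z), y)"
    by (rule exI[of _ "snd (prod_decode z)"])
      (metis le_prod_encode_2 less_Suc_eq_le prod.collapse prod_decode_inverse)
qed auto

lemma snd_prod_decode_conv_Least: "snd (prod_decode z) = (LEAST y. \<exists>x<Suc z. z = prod_encode (x, y))"
proof (rule Least_equality[symmetric])
  show "\<exists>x<Suc z. z = prod_encode (x, snd (prod_decode z))"
    by (rule exI[of _ "fst (prod_decode z)"])
      (metis le_prod_encode_1 less_Suc_eq_le prod.collapse prod_decode_inverse)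
qed auto

lemma total_rec_prod_decode:
  assumes "total_rec n f"
  shows "total_rec n (\<lambda>xs. fst (prod_decode (f xs)))" "total_rec n (\<lambda>xs. snd (prod_decode (f xs)))"
proof -
  have ex: "\<exists>x. \<exists>y<Suc z. z = prod_encode (x, y)" "\<exists>y. \<exists>x<Suc z. z = prod_encode (x, y)" for z
    by (metis le_prod_encode_1 le_prod_encode_2 less_Suc_eq_le prod.collapse prod_decode_inverse)+
  have "total_rec 1 (\<lambda>xs. fst (prod_decode (xs ! 0)))"
    unfolding fst_prod_decode_conv_Least
    by (rule total_rec_Least) (intro total_rec_intros ex; simp)+
  moreover have "total_rec 1 (\<lambda>xs. snd (prod_decode (xs ! 0)))"
    unfolding snd_prod_decode_conv_Least
    by (rule total_rec_Least) (intro total_rec_intros ex; simp)+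
  ultimately show "total_rec n (\<lambda>xs. fst (prod_decode (f xs)))"
    "total_rec n (\<lambda>xs. snd (prod_decode (f xs)))"
    by (auto intro: total_rec_unary assms)
qed

lemma set_encode_filter: "set_encode {x. x < b \<and> P x} = (\<Sum>x<b. of_bool (P x) * 2 ^ x)"
proof -
  have "set_encode {x. x < b \<and> P x} = (\<Sum>x\<in>{x \<in> {..<b}. P x}. 2 ^ x)"
    by (simp add: set_encode_def)
  also have "\<dots> = (\<Sum>x<b. if P x then 2 ^ x else 0)"
    by (rule sum.inter_filter) simp
  also have "\<dots> = (\<Sum>x<b. of_bool (P x) * 2 ^ x)"
    by (rule sum.cong) auto
  finally show ?thesis .
qed

lemma total_rec_set_encode:
  assumes "total_rec n B" "decidable_pred (Suc n) (\<lambda>ys. P (ys ! 0) (tl ys))"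
    and "\<And>xs. length xs = n \<Longrightarrow> S xs = {x. x < B xs \<and> P x xs}"
  shows "total_rec n (\<lambda>xs. set_encode (S xs))"
proof -
  have "total_rec n (\<lambda>xs. \<Sum>x<B xs. of_bool (P x xs) * 2 ^ x)"
    by (intro total_rec_sum[OF assms(1), where g = "\<lambda>x xs. of_bool (P x xs) * 2 ^ x"] total_rec_mult
        total_rec_of_bool total_rec_power total_rec_const total_rec.proj assms(2)) simp
  then show ?thesis
    by (rule total_rec.ext) (simp add: assms(3) set_encode_filter)
qed

lemma set_encode_image_pairs:
  fixes g :: "nat \<times> nat \<Rightarrow> nat"
  assumes "inj_on g {(x, y). x < b \<and> y < c \<and> P x y}"
  shows "set_encode (g ` {(x, y). x < b \<and> y < c \<and> P x y}) = (\<Sum>x<b. \<Sum>y<c. of_bool (P x y) * 2 ^ g (x, y))"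
proof -
  let ?D = "{z \<in> {..<b} \<times> {..<c}. P (fst z) (snd z)}"
  have D: "{(x, y). x < b \<and> y < c \<and> P x y} = ?D" by auto
  have "set_encode (g ` ?D) = (\<Sum>z\<in>?D. 2 ^ g z)"
    using assms unfolding D set_encode_def by (simp add: sum.reindex)
  also have "\<dots> = (\<Sum>z\<in>{..<b} \<times> {..<c}. if P (fst z) (snd z) then 2 ^ g z else 0)"
    by (rule sum.inter_filter) simp
  also have "\<dots> = (\<Sum>(x, y)\<in>{..<b} \<times> {..<c}. of_bool (P x y) * 2 ^ g (x, y))"
    by (rule sum.cong) auto
  also have "\<dots> = (\<Sum>x<b. \<Sum>y<c. of_bool (P x y) * 2 ^ g (x, y))"
    by (rule sum.cartesian_product[symmetric])
  finally show ?thesis unfolding D .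
qed

lemma total_rec_set_encode_image_pairs:
  assumes "total_rec n B" "total_rec n C"
    and "decidable_pred (Suc (Suc n)) (\<lambda>ys. P (tl ys ! 0) (ys ! 0) (tl (tl ys)))"
    and "total_rec (Suc (Suc n)) (\<lambda>ys. g (tl (tl ys)) (tl ys ! 0, ys ! 0))"
    and "\<And>xs. length xs = n \<Longrightarrow> inj_on (g xs) {(x, y). x < B xs \<and> y < C xs \<and> P x y xs}"
    and "\<And>xs. length xs = n \<Longrightarrow> S xs = g xs ` {(x, y). x < B xs \<and> y < C xs \<and> P x y xs}"
  shows "total_rec n (\<lambda>xs. set_encode (S xs))"
proof -
  have "total_rec n (\<lambda>xs. \<Sum>x<B xs. \<Sum>y<C xs. of_bool (P x y xs) * 2 ^ g xs (x, y))"
    by (intro total_rec_sum[OF assms(1), where g = "\<lambda>x xs. \<Sum>y<C xs. of_bool (P x y xs) * 2 ^ g xs (x, y)"]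
        total_rec_sum[where g = "\<lambda>y ys. of_bool (P (ys ! 0) y (tl ys)) * 2 ^ g (tl ys) (ys ! 0, y)"]
        total_rec_tl[OF assms(2)] total_rec_mult total_rec_of_bool total_rec_power total_rec_const assms(3,4))
  then show ?thesis
    by (rule total_rec.ext) (simp add: assms(5,6) set_encode_image_pairs)
qed

subsection \<open>While programs over counters\<close>

datatype com = Skip | Inc nat | Dec nat | Seq com com | While nat com

inductive exec :: "com \<Rightarrow> (nat \<Rightarrow> nat) \<Rightarrow> (nat \<Rightarrow> nat) \<Rightarrow> bool" where
  Skip: "exec Skip s s"
| Inc: "exec (Inc i) s (s(i := Suc (s i)))"
| Dec: "exec (Dec i) s (s(i := s i - 1))"
| Seq: "exec a s t \<Longrightarrow> exec b t u \<Longrightarrow> exec (Seq a b) s u"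
| While_False: "s i = 0 \<Longrightarrow> exec (While i c) s s"
| While_True: "s i \<noteq> 0 \<Longrightarrow> exec c s t \<Longrightarrow> exec (While i c) t u \<Longrightarrow> exec (While i c) s u"

inductive_cases exec_elims:
  "exec Skip s t" "exec (Inc i) s t" "exec (Dec i) s t" "exec (Seq a b) s t" "exec (While i c) s t"

definition input :: "nat \<Rightarrow> nat \<Rightarrow> nat" where
  "input v = (\<lambda>_. 0)(0 := v)"

definition halts :: "com \<Rightarrow> nat \<Rightarrow> bool" where
  "halts c v \<longleftrightarrow> (\<exists>t. exec c (input v) t)"

lemma exec_deterministic: "exec c s t \<Longrightarrow> exec c s t' \<Longrightarrow> t' = t"
proof (induction arbitrary: t' rule: exec.induct)
  case (Seq a s t b u)
  then show ?case by (metis exec_elims(4))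
next
  case (While_True s i c t u)
  then show ?case by (metis exec_elims(5))
qed (auto elim: exec_elims)

lemma exec_IncI: "t = s(i := Suc (s i)) \<Longrightarrow> exec (Inc i) s t"
  by (simp add: exec.Inc)

lemma exec_DecI: "t = s(i := s i - 1) \<Longrightarrow> exec (Dec i) s t"
  using exec.Dec by simp

lemma exec_While_iterate:
  assumes "\<And>j. j < l \<Longrightarrow> \<sigma> j r \<noteq> 0" "\<And>j. j < l \<Longrightarrow> exec c (\<sigma> j) (\<sigma> (Suc j))" "\<sigma> l r = 0"
  shows "exec (While r c) (\<sigma> 0) (\<sigma> l)"
proof -
  have "exec (While r c) (\<sigma> (l - d)) (\<sigma> l)" if "d \<le> l" for d
    using that
  proof (induction d)
    case 0
    then show ?case using assms(3) by (simp add: exec.While_False)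
  next
    case (Suc d)
    then have "exec c (\<sigma> (l - Suc d)) (\<sigma> (l - d))" "\<sigma> (l - Suc d) r \<noteq> 0"
      using assms(1)[of "l - Suc d"] assms(2)[of "l - Suc d"] by (auto simp: Suc_diff_Suc)
    then show ?case using Suc by (auto intro: exec.While_True)
  qed
  from this[of l] show ?thesis by simp
qed

lemma exec_While_imp_zero:
  assumes "exec (While r c) (\<sigma> j) t" and step: "\<And>j. exec c (\<sigma> j) (\<sigma> (Suc j))"
  shows "\<exists>j. \<sigma> j r = 0"
  using assms(1)
proof (induction "While r c" "\<sigma> j" t arbitrary: j rule: exec.induct)
  case While_True
  then show ?case using exec_deterministic[OF step] by blast
qed blast

definition clear :: "nat \<Rightarrow> com" where
  "clear r = While r (Dec r)"

lemma exec_clear: "exec (clear r) s (s(r := 0))"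
proof -
  let ?\<sigma> = "\<lambda>j. s(r := s r - j)"
  have "exec (clear r) (?\<sigma> 0) (?\<sigma> (s r))"
    unfolding clear_def by (rule exec_While_iterate) (auto intro!: exec_DecI)
  then show ?thesis by simp
qed

definition copy :: "nat \<Rightarrow> nat \<Rightarrow> nat \<Rightarrow> com" where
  "copy a b t = Seq (clear b)
     (Seq (While a (Seq (Dec a) (Seq (Inc b) (Inc t)))) (While t (Seq (Dec t) (Inc a))))"

lemma exec_copy:
  assumes "a \<noteq> b" "a \<noteq> t" "b \<noteq> t" "s t = 0"
  shows "exec (copy a b t) s (s(b := s a))"
proof -
  let ?\<sigma> = "\<lambda>j. s(a := s a - j, b := j, t := j)" and ?\<tau> = "\<lambda>j. s(a := j, b := s a, t := s a - j)"
  have "?\<sigma> 0 = s(b := 0)" "?\<sigma> (s a) = ?\<tau> 0" "?\<tau> (s a) = s(b := s a)"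
    using assms by (auto simp: fun_eq_iff)
  moreover have "exec (Seq (Dec a) (Seq (Inc b) (Inc t))) (?\<sigma> j) (?\<sigma> (Suc j))" for j
    by (intro exec.Seq[OF exec.Dec] exec.Seq[OF exec.Inc] exec_IncI)
      (use assms in \<open>auto simp: fun_eq_iff\<close>)
  then have "exec (While a (Seq (Dec a) (Seq (Inc b) (Inc t)))) (?\<sigma> 0) (?\<sigma> (s a))"
    by (rule exec_While_iterate[rotated]) (use assms in auto)
  moreover have "exec (Seq (Dec t) (Inc a)) (?\<tau> j) (?\<tau> (Suc j))" if "j < s a" for j
    by (intro exec.Seq[OF exec.Dec] exec_IncI) (use assms that in \<open>auto simp: fun_eq_iff\<close>)
  then have "exec (While t (Seq (Dec t) (Inc a))) (?\<tau> 0) (?\<tau> (s a))"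
    by (rule exec_While_iterate[rotated]) (use assms in auto)
  ultimately show ?thesis
    unfolding copy_def by (metis exec.Seq exec_clear)
qed

definition search :: "nat \<Rightarrow> nat \<Rightarrow> com \<Rightarrow> com" where
  "search y r c = Seq c (While r (Seq (Inc y) c))"

lemma exec_search_body:
  assumes "\<And>j e. exec c (s(y := j, r := e)) (s(y := j, r := g j))" "y \<noteq> r"
  shows "exec (Seq (Inc y) c) (s(y := j, r := g j)) (s(y := Suc j, r := g (Suc j)))"
  by (rule exec.Seq[OF exec_IncI assms(1)]) (use assms(2) in \<open>auto simp: fun_eq_iff\<close>)

lemma exec_search:
  assumes c: "\<And>j e. exec c (s(y := j, r := e)) (s(y := j, r := g j))" and "y \<noteq> r"
    and "\<And>j. j < l \<Longrightarrow> g j \<noteq> 0" "g l = 0"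
  shows "exec (search y r c) (s(y := 0, r := e)) (s(y := l, r := 0))"
proof -
  have "exec (While r (Seq (Inc y) c)) (s(y := 0, r := g 0)) (s(y := l, r := g l))"
    by (rule exec_While_iterate[where \<sigma> = "\<lambda>j. s(y := j, r := g j)"])
      (use assms exec_search_body[OF c] in auto)
  then show ?thesis
    unfolding search_def using exec.Seq[OF c] assms(4) by simp
qed

lemma search_halts_iff:
  assumes c: "\<And>j e. exec c (s(y := j, r := e)) (s(y := j, r := g j))" and "y \<noteq> r"
  shows "(\<exists>t. exec (search y r c) (s(y := 0, r := e)) t) \<longleftrightarrow> (\<exists>j. g j = 0)"
proof
  assume "\<exists>t. exec (search y r c) (s(y := 0, r := e)) t"
  then obtain t where "exec (While r (Seq (Inc y) c)) (s(y := 0, r := g 0)) t"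
    unfolding search_def using exec_deterministic[OF c] by (metis exec_elims(4))
  then have "\<exists>j. (s(y := j, r := g j)) r = 0"
    by (rule exec_While_imp_zero) (rule exec_search_body[OF assms])
  then show "\<exists>j. g j = 0" by simp
next
  assume "\<exists>j. g j = 0"
  then have "g (LEAST j. g j = 0) = 0" "\<And>j. j < (LEAST j. g j = 0) \<Longrightarrow> g j \<noteq> 0"
    by (auto intro: LeastI dest: not_less_Least)
  then show "\<exists>t. exec (search y r c) (s(y := 0, r := e)) t"
    using exec_search[OF c \<open>y \<noteq> r\<close>] by blast
qed

subsection \<open>Programs for total recursive functions\<close>

definition zero_from :: "nat \<Rightarrow> (nat \<Rightarrow> nat) \<Rightarrow> bool" where
  "zero_from b s \<longleftrightarrow> (\<forall>r\<ge>b. s r = 0)"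

text \<open>Registers from \<open>b\<close> on are scratch space: zero before and after.\<close>

definition computes :: "com \<Rightarrow> (nat list \<Rightarrow> nat) \<Rightarrow> nat list \<Rightarrow> nat \<Rightarrow> nat \<Rightarrow> bool" where
  "computes c f ins out b \<longleftrightarrow> (\<forall>s. zero_from b s \<longrightarrow> exec c s (s(out := f (map s ins))))"

definition computable :: "nat \<Rightarrow> (nat list \<Rightarrow> nat) \<Rightarrow> bool" where
  "computable n f \<longleftrightarrow> (\<forall>ins out b. length ins = n \<longrightarrow> set ins \<subseteq> {..<b} \<longrightarrow> out < b \<longrightarrow>
     out \<notin> set ins \<longrightarrow> (\<exists>c. computes c f ins out b))"

lemma computableI:
  assumes "\<And>ins out b. length ins = n \<Longrightarrow> set ins \<subseteq> {..<b} \<Longrightarrow> out < b \<Longrightarrow> out \<notin> set ins \<Longrightarrow>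
    \<exists>c. \<forall>s. zero_from b s \<longrightarrow> exec c s (s(out := f (map s ins)))"
  shows "computable n f"
  using assms unfolding computable_def computes_def by blast

lemma computable_obtain:
  assumes "computable n f" "length ins = n" "set ins \<subseteq> {..<b}" "out < b" "out \<notin> set ins"
  obtains c where "\<And>s. zero_from b s \<Longrightarrow> exec c s (s(out := f (map s ins)))"
proof -
  have "\<exists>c. computes c f ins out b" using assms unfolding computable_def by simp
  then show thesis using that unfolding computes_def by blast
qed

lemma computable_const_zero: "computable n (\<lambda>_. 0)"
  by (rule computableI) (use exec_clear in blast)

lemma computable_proj:
  assumes "i < n" shows "computable n (\<lambda>xs. xs ! i)"
proof (rule computableI)
  fix ins :: "nat list" and out b
  assume registers: "length ins = n" "set ins \<subseteq> {..<b}" "out < b" "out \<notin> set ins"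
  then have "ins ! i \<in> set ins" using assms by auto
  then have "ins ! i < b" "ins ! i \<noteq> out" using registers by auto
  then have "exec (copy (ins ! i) out b) s (s(out := map s ins ! i))" if "zero_from b s" for s
    using exec_copy[of "ins ! i" out b s] registers that assms by (auto simp: zero_from_def)
  then show "\<exists>c. \<forall>s. zero_from b s \<longrightarrow> exec c s (s(out := map s ins ! i))" by blast
qed

lemma computable_succ: "computable 1 (\<lambda>xs. Suc (hd xs))"
proof (rule computableI)
  fix ins :: "nat list" and out b
  assume registers: "length ins = 1" "set ins \<subseteq> {..<b}" "out < b" "out \<notin> set ins"
  then obtain i where i: "ins = [i]" by (cases ins) auto
  then have "exec (Seq (copy i out b) (Inc out)) s (s(out := Suc (hd (map s ins))))"
    if "zero_from b s" for s
    using exec.Seq[OF exec_copy[of i out b s] exec.Inc[of out]] registers that by (auto simp: zero_from_def)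
  then show "\<exists>c. \<forall>s. zero_from b s \<longrightarrow> exec c s (s(out := Suc (hd (map s ins))))" by blast
qed

definition store_list :: "nat \<Rightarrow> nat list \<Rightarrow> (nat \<Rightarrow> nat) \<Rightarrow> nat \<Rightarrow> nat" where
  "store_list b vs s r = (if b \<le> r \<and> r < b + length vs then vs ! (r - b) else s r)"

lemma store_list_Nil [simp]: "store_list b [] s = s"
  by (auto simp: store_list_def fun_eq_iff)

lemma store_list_snoc: "store_list b (vs @ [v]) s = (store_list b vs s)(b + length vs := v)"
  by (auto simp: store_list_def fun_eq_iff nth_append)

lemma map_store_list_below: "set is \<subseteq> {..<b} \<Longrightarrow> map (store_list b vs s) is = map s is"
  by (auto simp: store_list_def)

lemma map_store_list_upt: "length vs = m \<Longrightarrow> map (store_list b vs s) [b..<b + m] = vs"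
  by (auto simp: store_list_def intro: nth_equalityI)

lemma zero_from_store_list:
  "zero_from b s \<Longrightarrow> b + length vs \<le> b' \<Longrightarrow> zero_from b' (store_list b vs s)"
  by (auto simp: zero_from_def store_list_def)

lemma clear_registers: "\<exists>c. \<forall>s. exec c s (store_list b (replicate m 0) s)"
proof (induction m)
  case 0
  show ?case using exec.Skip by auto
next
  case (Suc m)
  then obtain c where "\<And>s. exec c s (store_list b (replicate m 0) s)" by blast
  then have "exec (Seq c (clear (b + m))) s (store_list b (replicate (Suc m) 0) s)" for s
    using exec.Seq[OF _ exec_clear] store_list_snoc[of b "replicate m 0" 0 s]
    by (metis length_replicate replicate_Suc replicate_append_same)
  then show ?case by blast
qed

lemma computable_list:
  assumes "\<And>g. g \<in> set gs \<Longrightarrow> computable n g" "length ins = n" "set ins \<subseteq> {..<b}"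
  shows "\<exists>c. \<forall>s. zero_from b s \<longrightarrow> exec c s (store_list b (map (\<lambda>g. g (map s ins)) gs) s)"
  using assms(1)
proof (induction gs rule: rev_induct)
  case Nil
  show ?case using exec.Skip by auto
next
  case (snoc g gs)
  let ?vs = "\<lambda>s. map (\<lambda>g. g (map s ins)) gs" and ?b = "b + length gs"
  obtain c where c: "\<And>s. zero_from b s \<Longrightarrow> exec c s (store_list b (?vs s) s)"
    using snoc by auto
  have "computable n g" using snoc.prems by simp
  then obtain d where d: "\<And>s. zero_from (Suc ?b) s \<Longrightarrow> exec d s (s(?b := g (map s ins)))"
    by (rule computable_obtain[of n g ins "Suc ?b" ?b]) (use assms in fastforce)+
  have "exec (Seq c d) s (store_list b (map (\<lambda>g. g (map s ins)) (gs @ [g])) s)" if "zero_from b s" for s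
  proof -
    have "exec d (store_list b (?vs s) s) (store_list b (?vs s @ [g (map s ins)]) s)"
      using d[OF zero_from_store_list[OF that]] by (simp add: store_list_snoc map_store_list_below assms(3))
    then show ?thesis using exec.Seq[OF c[OF that]] by simp
  qed
  then show ?case by blast
qed

lemma computable_comp:
  assumes f: "computable m f" and m: "length gs = m" and g: "\<And>g. g \<in> set gs \<Longrightarrow> computable n g"
  shows "computable n (\<lambda>xs. f (map (\<lambda>g. g xs) gs))"
proof (rule computableI)
  fix ins :: "nat list" and out b
  assume registers: "length ins = n" "set ins \<subseteq> {..<b}" "out < b" "out \<notin> set ins"
  let ?vs = "\<lambda>s. map (\<lambda>g. g (map s ins)) gs"
  obtain c where c: "\<And>s. zero_from b s \<Longrightarrow> exec c s (store_list b (?vs s) s)"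
    using computable_list[OF g registers(1,2)] by blast
  obtain d where d: "\<And>s. zero_from (b + m) s \<Longrightarrow> exec d s (s(out := f (map s [b..<b + m])))"
    by (rule computable_obtain[OF f, of "[b..<b + m]" "b + m" out]) (use registers(3) in auto)
  obtain e where e: "\<And>s. exec e s (store_list b (replicate m 0) s)"
    using clear_registers by blast
  have "exec (Seq c (Seq d e)) s (s(out := f (?vs s)))" if z: "zero_from b s" for s
  proof -
    let ?s = "store_list b (?vs s) s"
    have "exec d ?s (?s(out := f (?vs s)))"
      using d[of ?s] zero_from_store_list[OF z] m by (simp add: map_store_list_upt)
    moreover have "store_list b (replicate m 0) (?s(out := f (?vs s))) = s(out := f (?vs s))"
      using z registers(3) m by (auto simp: fun_eq_iff store_list_def zero_from_def)
    ultimately show ?thesis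
      using exec.Seq[OF c[OF z] exec.Seq[OF _ e]] by metis
  qed
  then show "\<exists>c. \<forall>s. zero_from b s \<longrightarrow> exec c s (s(out := f (?vs s)))" by blast
qed

definition rec_loop :: "nat \<Rightarrow> nat \<Rightarrow> nat \<Rightarrow> nat \<Rightarrow> nat \<Rightarrow> com \<Rightarrow> com" where
  "rec_loop y r r' n t d = While n (Seq (Dec n) (Seq d (Seq (copy r' r t) (Seq (clear r') (Inc y)))))"

lemma exec_rec_loop:
  assumes d: "\<And>j e. exec d (s(y := j, r := h j, n := e)) (s(y := j, r := h j, n := e, r' := h (Suc j)))"
    and dist: "distinct [y, r, r', n, t]" and zero: "s r' = 0" "s t = 0"
  shows "exec (rec_loop y r r' n t d) (s(y := 0, r := h 0, n := x)) (s(y := x, r := h x, n := 0))"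
proof -
  let ?\<sigma> = "\<lambda>j e. s(y := j, r := h j, n := e)"
  let ?body = "Seq (Dec n) (Seq d (Seq (copy r' r t) (Seq (clear r') (Inc y))))"
  have body: "exec ?body (?\<sigma> j (Suc e)) (?\<sigma> (Suc j) e)" for j e
  proof (intro exec.Seq)
    show "exec (Dec n) (?\<sigma> j (Suc e)) (?\<sigma> j e)"
      by (rule exec_DecI) simp
    show "exec d (?\<sigma> j e) ((?\<sigma> j e)(r' := h (Suc j)))" by (rule d)
    let ?s = "s(y := j, r := h (Suc j), n := e, r' := h (Suc j))"
    have "?s = ((?\<sigma> j e)(r' := h (Suc j)))(r := ((?\<sigma> j e)(r' := h (Suc j))) r')"
      using dist by (auto simp: fun_eq_iff)
    moreover have "r' \<noteq> r" "r' \<noteq> t" "r \<noteq> t" "((?\<sigma> j e)(r' := h (Suc j))) t = 0"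
      using dist zero by auto
    ultimately show "exec (copy r' r t) ((?\<sigma> j e)(r' := h (Suc j))) ?s"
      by (metis exec_copy)
    show "exec (clear r') ?s (?s(r' := 0))" by (rule exec_clear)
    show "exec (Inc y) (?s(r' := 0)) (?\<sigma> (Suc j) e)"
      by (rule exec_IncI) (use dist zero in \<open>auto simp: fun_eq_iff\<close>)
  qed
  have "exec (While n ?body) (?\<sigma> 0 (x - 0)) (?\<sigma> x (x - x))"
  proof (rule exec_While_iterate[where \<sigma> = "\<lambda>j. ?\<sigma> j (x - j)"])
    fix j assume "j < x"
    then show "exec ?body (?\<sigma> j (x - j)) (?\<sigma> (Suc j) (x - Suc j))"
      using body[of j "x - Suc j"] by (simp add: Suc_diff_Suc)
  qed auto
  then show ?thesis by (simp add: rec_loop_def)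
qed

definition rec_program :: "nat \<Rightarrow> nat \<Rightarrow> nat \<Rightarrow> com \<Rightarrow> com \<Rightarrow> com" where
  "rec_program i out b c d =
     Seq (copy i (b + 3) (b + 4)) (Seq c (Seq (rec_loop b (b + 1) (b + 2) (b + 3) (b + 4) d)
       (Seq (copy (b + 1) out (b + 4)) (Seq (clear (b + 1)) (clear b)))))"

lemma exec_rec_program:
  assumes zero: "zero_from b s" and less: "i < b" "out < b"
    and c: "exec c (s(b + 3 := s i)) (s(b + 3 := s i, b + 1 := h 0))"
    and d: "\<And>j e. exec d (s(b := j, b + 1 := h j, b + 3 := e))
      (s(b := j, b + 1 := h j, b + 3 := e, b + 2 := h (Suc j)))"
  shows "exec (rec_program i out b c d) s (s(out := h (s i)))"
  unfolding rec_program_def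
proof (intro exec.Seq)
  show "exec (copy i (b + 3) (b + 4)) s (s(b + 3 := s i))"
    by (rule exec_copy) (use zero less in \<open>auto simp: zero_from_def\<close>)
  show "exec c (s(b + 3 := s i)) (s(b + 3 := s i, b + 1 := h 0))" by (rule c)
  have "exec (rec_loop b (b + 1) (b + 2) (b + 3) (b + 4) d) (s(b := 0, b + 1 := h 0, b + 3 := s i))
      (s(b := s i, b + 1 := h (s i), b + 3 := 0))"
    by (rule exec_rec_loop[OF d]) (use zero in \<open>auto simp: zero_from_def\<close>)
  moreover have "s(b := 0, b + 1 := h 0, b + 3 := s i) = s(b + 3 := s i, b + 1 := h 0)"
    using zero by (auto simp: zero_from_def fun_eq_iff)
  ultimately show "exec (rec_loop b (b + 1) (b + 2) (b + 3) (b + 4) d) (s(b + 3 := s i, b + 1 := h 0))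
      (s(b := s i, b + 1 := h (s i), b + 3 := 0))" by simp
  let ?s = "s(b := s i, b + 1 := h (s i), b + 3 := 0, out := h (s i))"
  show "exec (copy (b + 1) out (b + 4)) (s(b := s i, b + 1 := h (s i), b + 3 := 0)) ?s"
    using exec_copy[of "b + 1" out "b + 4" "s(b := s i, b + 1 := h (s i), b + 3 := 0)"] zero less
    by (simp add: zero_from_def)
  show "exec (clear (b + 1)) ?s (?s(b + 1 := 0))" by (rule exec_clear)
  have "s(out := h (s i)) = ?s(b + 1 := 0, b := 0)"
    using zero less by (auto simp: zero_from_def fun_eq_iff)
  then show "exec (clear b) (?s(b + 1 := 0)) (s(out := h (s i)))"
    by (simp only: exec_clear)
qed

lemma computable_prim:
  assumes f: "computable n f" and g: "computable (Suc (Suc n)) g"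
  shows "computable (Suc n) (\<lambda>ys. rec_nat (f (tl ys)) (\<lambda>y r. g (y # r # tl ys)) (hd ys))"
proof (rule computableI)
  fix ins :: "nat list" and out b
  assume registers: "length ins = Suc n" "set ins \<subseteq> {..<b}" "out < b" "out \<notin> set ins"
  then obtain i js where ins: "ins = i # js" by (cases ins) auto
  have js: "length js = n" "i < b" and js_less: "\<And>j. j \<in> set js \<Longrightarrow> j < b" using registers ins by auto
  obtain c where c: "\<And>s. zero_from (b + 4) s \<Longrightarrow> exec c s (s(b + 1 := f (map s js)))"
    by (rule computable_obtain[OF f, of js "b + 4" "b + 1"]) (use js js_less in fastforce)+
  obtain d where d: "\<And>s. zero_from (b + 4) s \<Longrightarrow> exec d s (s(b + 2 := g (map s (b # (b + 1) # js))))"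
    by (rule computable_obtain[OF g, of "b # (b + 1) # js" "b + 4" "b + 2"]) (use js js_less in fastforce)+
  have notin: "r \<notin> set js" if "b \<le> r" for r using js_less[of r] that by auto
  have "exec (rec_program i out b c d) s
      (s(out := rec_nat (f (map s js)) (\<lambda>y r. g (y # r # map s js)) (s i)))"
    if zero: "zero_from b s" for s
  proof (rule exec_rec_program[OF zero js(2) registers(3)])
    let ?h = "rec_nat (f (map s js)) (\<lambda>y r. g (y # r # map s js))"
    show "exec c (s(b + 3 := s i)) (s(b + 3 := s i, b + 1 := ?h 0))"
      using c[of "s(b + 3 := s i)"] zero by (simp add: notin zero_from_def)
    show "exec d (s(b := j, b + 1 := ?h j, b + 3 := e))
        (s(b := j, b + 1 := ?h j, b + 3 := e, b + 2 := ?h (Suc j)))" for j e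
      using d[of "s(b := j, b + 1 := ?h j, b + 3 := e)"] zero by (simp add: notin zero_from_def)
  qed
  then show "\<exists>c. \<forall>s. zero_from b s \<longrightarrow>
      exec c s (s(out := rec_nat (f (tl (map s ins))) (\<lambda>y r. g (y # r # tl (map s ins))) (hd (map s ins))))"
    unfolding ins by auto
qed

lemma computable_mu:
  assumes g: "computable (Suc n) g" and ex: "\<And>xs. length xs = n \<Longrightarrow> \<exists>y. g (y # xs) = 0"
  shows "computable n (\<lambda>xs. LEAST y. g (y # xs) = 0)"
proof (rule computableI)
  fix ins :: "nat list" and out b
  assume registers: "length ins = n" "set ins \<subseteq> {..<b}" "out < b" "out \<notin> set ins"
  then have ins_less: "\<And>j. j \<in> set ins \<Longrightarrow> j < b" by auto
  let ?y = b and ?v = "b + 1" and ?t = "b + 2"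
  obtain d where d: "\<And>s. zero_from ?t s \<Longrightarrow> exec d s (s(?v := g (map s (?y # ins))))"
    by (rule computable_obtain[OF g, of "?y # ins" ?t ?v]) (use registers(1) ins_less in fastforce)+
  let ?prog = "Seq (search ?y ?v d) (Seq (copy ?y out ?t) (clear ?y))"
  have "exec ?prog s (s(out := LEAST y. g (y # map s ins) = 0))" if z: "zero_from b s" for s
  proof -
    let ?g = "\<lambda>y. g (y # map s ins)"
    define l where "l = (LEAST y. ?g y = 0)"
    have "?g l = 0"
      unfolding l_def using ex[of "map s ins"] registers(1) by (auto intro: LeastI_ex)
    have notin: "r \<notin> set ins" if "b \<le> r" for r using ins_less[of r] that by auto
    show ?thesis unfolding l_def[symmetric]
    proof (intro exec.Seq)
      have "exec (search ?y ?v d) (s(?y := 0, ?v := 0)) (s(?y := l, ?v := 0))"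
      proof (rule exec_search)
        fix j e
        show "exec d (s(?y := j, ?v := e)) (s(?y := j, ?v := ?g j))"
          using d[of "s(?y := j, ?v := e)"] z by (simp add: notin zero_from_def)
      qed (use \<open>?g l = 0\<close> not_less_Least in \<open>auto simp: l_def\<close>)
      moreover have "s(?y := 0, ?v := 0) = s" "s(?y := l, ?v := 0) = s(?y := l)"
        using z by (auto simp: zero_from_def fun_eq_iff)
      ultimately show "exec (search ?y ?v d) s (s(?y := l))" by simp
      show "exec (copy ?y out ?t) (s(?y := l)) (s(?y := l, out := l))"
        using exec_copy[of ?y out ?t "s(?y := l)"] z registers(3) by (simp add: zero_from_def)
      have "s(out := l) = s(?y := l, out := l, ?y := 0)"
        using z registers(3) by (auto simp: zero_from_def fun_eq_iff)
      then show "exec (clear ?y) (s(?y := l, out := l)) (s(out := l))"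
        by (simp only: exec_clear)
    qed
  qed
  then show "\<exists>c. \<forall>s. zero_from b s \<longrightarrow> exec c s (s(out := LEAST y. g (y # map s ins) = 0))" by blast
qed

lemma total_rec_computable: "total_rec n f \<Longrightarrow> computable n f"
proof (induction rule: total_rec.induct)
  case (comp m f gs n)
  then show ?case by (intro computable_comp) auto
next
  case (mu n g)
  then show ?case by (intro computable_mu) auto
next
  case (ext n f g)
  then show ?case unfolding computable_def computes_def by (metis length_map)
qed (rule computable_const_zero computable_succ computable_proj computable_prim; assumption)+

theorem total_rec_search_program:
  assumes "total_rec 2 V"
  obtains c where "\<And>v. halts c v \<longleftrightarrow> (\<exists>y. V [v, y] = 0)"
proof -
  obtain d where d: "\<And>s. zero_from 3 s \<Longrightarrow> exec d s (s(2 := V (map s [0, 1])))"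
    by (rule computable_obtain[OF total_rec_computable[OF assms], of "[0, 1]" 3 2]) auto
  have "halts (search 1 2 d) v \<longleftrightarrow> (\<exists>y. V [v, y] = 0)" for v
  proof -
    have "exec d ((input v)(1 := j, 2 := e)) ((input v)(1 := j, 2 := V [v, j]))" for j e
      using d[of "(input v)(1 := j, 2 := e)"] by (simp add: zero_from_def input_def)
    moreover have "(input v)(1 := 0, 2 := 0) = input v" by (simp add: input_def fun_eq_iff)
    ultimately show ?thesis
      using search_halts_iff[of d "input v" 1 2 "\<lambda>j. V [v, j]" 0] by (simp add: halts_def)
  qed
  then show thesis by (rule that)
qed

subsection \<open>Small steps\<close>

fun next_cont :: "com list \<Rightarrow> (nat \<Rightarrow> bool) \<Rightarrow> com list" where
  "next_cont [] z = []"
| "next_cont (Skip # \<kappa>) z = \<kappa>"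
| "next_cont (Inc r # \<kappa>) z = \<kappa>"
| "next_cont (Dec r # \<kappa>) z = \<kappa>"
| "next_cont (Seq a b # \<kappa>) z = a # b # \<kappa>"
| "next_cont (While r c # \<kappa>) z = (if z r then \<kappa> else c # While r c # \<kappa>)"

fun counter_change :: "com list \<Rightarrow> (nat \<Rightarrow> bool) \<Rightarrow> nat \<Rightarrow> int" where
  "counter_change (Inc r # \<kappa>) z = (\<lambda>i. if i = r then 1 else 0)"
| "counter_change (Dec r # \<kappa>) z = (\<lambda>i. if i = r \<and> \<not> z r then -1 else 0)"
| "counter_change _ z = (\<lambda>i. 0)"

definition step :: "com list \<times> (nat \<Rightarrow> nat) \<Rightarrow> com list \<times> (nat \<Rightarrow> nat)" where
  "step = (\<lambda>(\<kappa>, s). (next_cont \<kappa> (\<lambda>i. s i = 0),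
     \<lambda>i. nat (int (s i) + counter_change \<kappa> (\<lambda>i. s i = 0) i)))"

definition config :: "com \<Rightarrow> nat \<Rightarrow> nat \<Rightarrow> com list \<times> (nat \<Rightarrow> nat)" where
  "config c v t = (step ^^ t) ([c], input v)"

lemma config_0: "config c v 0 = ([c], input v)"
  and config_Suc: "config c v (Suc t) = step (config c v t)"
  by (simp_all add: config_def)

lemma counter_change_ge: "0 \<le> int (s i) + counter_change \<kappa> (\<lambda>i. s i = 0) i"
  by (cases "(\<kappa>, \<lambda>i. s i = 0)" rule: counter_change.cases) auto

lemma counter_change_range: "counter_change \<kappa> z i \<in> {-1, 0, 1}"
  by (cases "(\<kappa>, z)" rule: counter_change.cases) auto

lemma step_simps [simp]:
  "step ([], s) = ([], s)"
  "step (Skip # \<kappa>, s) = (\<kappa>, s)"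
  "step (Inc r # \<kappa>, s) = (\<kappa>, s(r := Suc (s r)))"
  "step (Dec r # \<kappa>, s) = (\<kappa>, s(r := s r - 1))"
  "step (Seq a b # \<kappa>, s) = (a # b # \<kappa>, s)"
  "step (While r c # \<kappa>, s) = (if s r = 0 then (\<kappa>, s) else (c # While r c # \<kappa>, s))"
  by (auto simp: step_def fun_eq_iff)

lemma exec_imp_steps: "exec c s t \<Longrightarrow> \<exists>n. (step ^^ n) (c # \<kappa>, s) = (\<kappa>, t)"
proof (induction arbitrary: \<kappa> rule: exec.induct)
  case (Seq a s t b u)
  obtain n n' where "(step ^^ n) (a # b # \<kappa>, s) = (b # \<kappa>, t)" "(step ^^ n') (b # \<kappa>, t) = (\<kappa>, u)"
    using Seq.IH by blast
  then have "(step ^^ Suc (n' + n)) (Seq a b # \<kappa>, s) = (\<kappa>, u)"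
    by (simp add: funpow_add funpow_Suc_right del: funpow.simps)
  then show ?case ..
next
  case (While_True s i c t u)
  obtain n n' where "(step ^^ n) (c # While i c # \<kappa>, s) = (While i c # \<kappa>, t)"
    "(step ^^ n') (While i c # \<kappa>, t) = (\<kappa>, u)"
    using While_True.IH by blast
  then have "(step ^^ Suc (n' + n)) (While i c # \<kappa>, s) = (\<kappa>, u)"
    using While_True.hyps by (simp add: funpow_add funpow_Suc_right del: funpow.simps)
  then show ?case ..
qed (rule exI[of _ 1]; simp add: fun_eq_iff)+

lemma steps_imp_exec:
  "fst ((step ^^ n) (c # \<kappa>, s)) = [] \<Longrightarrow> \<exists>t n'. exec c s t \<and> n' < n \<and> fst ((step ^^ n') (\<kappa>, t)) = []"
proof (induction n arbitrary: c \<kappa> s rule: less_induct)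
  case (less n)
  then obtain n0 where n: "n = Suc n0" by (cases n) auto
  have steps: "fst ((step ^^ n0) (step (c # \<kappa>, s))) = []"
    using less.prems unfolding n funpow_Suc_right comp_apply .
  have sequence: "\<exists>t u n'. exec a s t \<and> exec b t u \<and> n' < n \<and> fst ((step ^^ n') (\<kappa>, u)) = []"
    if ab: "fst ((step ^^ n0) (a # b # \<kappa>, s)) = []" for a b
  proof -
    obtain t n1 where a: "exec a s t" "n1 < n0" "fst ((step ^^ n1) (b # \<kappa>, t)) = []"
      using less.IH[OF _ ab] n by auto
    obtain u n2 where "exec b t u" "n2 < n1" "fst ((step ^^ n2) (\<kappa>, u)) = []"
      using less.IH[OF _ a(3)] a(2) n by auto
    with a n show ?thesis by (metis less_SucI less_trans)
  qed
  show ?case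
  proof (cases c)
    case (Seq a b)
    then show ?thesis using sequence[of a b] steps by (auto intro: exec.Seq)
  next
    case (While r b)
    show ?thesis
    proof (cases "s r = 0")
      case True
      then show ?thesis using steps n While exec.While_False by auto
    next
      case False
      then show ?thesis using sequence[of b c] steps While by (auto intro: exec.While_True)
    qed
  qed (use steps n exec.intros in \<open>auto, blast+\<close>)
qed

lemma halts_iff_config: "halts c v \<longleftrightarrow> (\<exists>t. fst (config c v t) = [])"
  using steps_imp_exec[of _ c "[]"] exec_imp_steps[of c _ _ "[]"]
  unfolding halts_def config_def by (metis fst_conv)

fun regs :: "com \<Rightarrow> nat set" where
  "regs Skip = {}"
| "regs (Inc r) = {r}"
| "regs (Dec r) = {r}"
| "regs (Seq a b) = regs a \<union> regs b"
| "regs (While r c) = insert r (regs c)"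

lemma finite_regs: "finite (regs c)"
  by (induction c) auto

lemma regs_bounded: obtains k where "0 < k" "regs c \<subseteq> {..<k}"
proof
  show "regs c \<subseteq> {..<Suc (Max (insert 0 (regs c)))}"
    using finite_regs by (auto simp: less_Suc_eq_le)
qed simp

definition cont_regs :: "com list \<Rightarrow> nat set" where
  "cont_regs \<kappa> = (\<Union>c\<in>set \<kappa>. regs c)"

lemma cont_regs_simps [simp]: "cont_regs [] = {}" "cont_regs (c # \<kappa>) = regs c \<union> cont_regs \<kappa>"
  by (simp_all add: cont_regs_def)

lemma cont_regs_next_cont: "cont_regs (next_cont \<kappa> z) \<subseteq> cont_regs \<kappa>"
  by (cases "(\<kappa>, z)" rule: next_cont.cases) auto

lemma cont_regs_step: "cont_regs (fst (step x)) \<subseteq> cont_regs (fst x)"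
  using cont_regs_next_cont by (cases x) (simp add: step_def)

lemma cont_regs_config: "cont_regs (fst (config c v t)) \<subseteq> regs c"
proof (induction t)
  case (Suc t)
  then show ?case using cont_regs_step by (metis config_Suc order_trans)
qed (simp add: config_0)

subsection \<open>A universal program\<close>

text \<open>Register \<open>r\<close> is named by the \<open>r\<close>-th prime, and a store by a product of prime powers, so that
  testing, incrementing and decrementing a register are arithmetic on codes.\<close>

definition nth_prime :: "nat \<Rightarrow> nat" where
  "nth_prime = Infinite_Set.enumerate {p. prime p}"

lemma prime_nth_prime: "prime (nth_prime r)"
  using enumerate_in_set[OF primes_infinite] by (simp add: nth_prime_def)

lemma nth_prime_eq_iff [simp]: "nth_prime r = nth_prime r' \<longleftrightarrow> r = r'"
  using inj_enumerate[OF primes_infinite] by (auto simp: nth_prime_def dest: injD)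

primrec com_code :: "com \<Rightarrow> nat" where
  "com_code Skip = prod_encode (0, 0)"
| "com_code (Inc r) = prod_encode (1, nth_prime r)"
| "com_code (Dec r) = prod_encode (2, nth_prime r)"
| "com_code (Seq a b) = prod_encode (3, prod_encode (com_code a, com_code b))"
| "com_code (While r c) = prod_encode (4, prod_encode (nth_prime r, com_code c))"

definition store_code :: "nat \<Rightarrow> (nat \<Rightarrow> nat) \<Rightarrow> nat" where
  "store_code b s = (\<Prod>r<b. nth_prime r ^ s r)"

definition config_code :: "nat \<Rightarrow> com list \<times> (nat \<Rightarrow> nat) \<Rightarrow> nat" where
  "config_code b = (\<lambda>(\<kappa>, s). prod_encode (list_encode (map com_code \<kappa>), store_code b s))"

lemma store_code_update:
  assumes "r < b" shows "store_code b (s(r := Suc x)) = nth_prime r * store_code b (s(r := x))"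
proof -
  have "store_code b (s(r := y)) = nth_prime r ^ y * (\<Prod>i\<in>{..<b} - {r}. nth_prime i ^ s i)" for y
    using assms by (simp add: store_code_def prod.remove[of _ r])
  then show ?thesis by (simp add: mult.assoc)
qed

lemma nth_prime_dvd_store_code:
  assumes "r < b" shows "nth_prime r dvd store_code b s \<longleftrightarrow> s r \<noteq> 0"
proof -
  have "nth_prime r dvd nth_prime i ^ s i \<longleftrightarrow> s i \<noteq> 0 \<and> nth_prime r dvd nth_prime i" for i
    using prime_nth_prime[of r] by (cases "s i") (auto simp: prime_dvd_power_iff simp del: power_Suc)
  then have "nth_prime r dvd store_code b s \<longleftrightarrow> (\<exists>i<b. s i \<noteq> 0 \<and> nth_prime r dvd nth_prime i)"
    unfolding store_code_def by (auto simp: prime_dvd_prod_iff prime_nth_prime)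
  also have "\<dots> \<longleftrightarrow> s r \<noteq> 0"
    using assms primes_dvd_imp_eq[OF prime_nth_prime prime_nth_prime] by auto
  finally show ?thesis .
qed

lemma store_code_Inc: "r < b \<Longrightarrow> store_code b (s(r := Suc (s r))) = nth_prime r * store_code b s"
  using store_code_update[of r b s "s r"] by simp

lemma store_code_Dec:
  assumes "r < b"
  shows "store_code b (s(r := s r - 1)) =
    (if nth_prime r dvd store_code b s then store_code b s div nth_prime r else store_code b s)"
proof (cases "s r = 0")
  case True
  then have "s(r := s r - 1) = s" by (simp add: fun_eq_iff)
  then show ?thesis using nth_prime_dvd_store_code[OF assms, of s] True by simp
next
  case False
  then have "store_code b s = nth_prime r * store_code b (s(r := s r - 1))"
    using store_code_update[OF assms, of s "s r - 1"] by simp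
  then show ?thesis
    using nth_prime_dvd_store_code[OF assms, of s] False prime_gt_0_nat[OF prime_nth_prime[of r]] by simp
qed

definition step_code :: "nat \<Rightarrow> nat" where
  "step_code z = (
     let \<kappa> = fst (prod_decode z); s = snd (prod_decode z);
       c = fst (prod_decode (\<kappa> - 1)); \<kappa>' = snd (prod_decode (\<kappa> - 1));
       tag = fst (prod_decode c); arg = snd (prod_decode c);
       arg1 = fst (prod_decode arg); arg2 = snd (prod_decode arg)
     in
       if \<kappa> = 0 then z
       else if tag = 0 then prod_encode (\<kappa>', s)
       else if tag = 1 then prod_encode (\<kappa>', arg * s)
       else if tag = 2 then prod_encode (\<kappa>', if arg dvd s then s div arg else s)
       else if tag = 3 then prod_encode (Suc (prod_encode (arg1, Suc (prod_encode (arg2, \<kappa>')))), s)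
       else if arg1 dvd s then prod_encode (Suc (prod_encode (arg2, \<kappa>)), s)
       else prod_encode (\<kappa>', s))"

lemma step_code_config_code:
  assumes "cont_regs \<kappa> \<subseteq> {..<b}"
  shows "step_code (config_code b (\<kappa>, s)) = config_code b (step (\<kappa>, s))"
proof (cases \<kappa>)
  case (Cons c \<kappa>')
  have "r < b" if "c = Inc r \<or> c = Dec r \<or> (\<exists>a. c = While r a)" for r
    using assms Cons that by auto
  then show ?thesis
    unfolding Cons by (cases c) (simp_all add: step_code_def config_code_def Let_def
        nth_prime_dvd_store_code store_code_Inc store_code_Dec del: One_nat_def)
qed (simp add: step_code_def config_code_def)

lemma total_rec_step_code: "total_rec n f \<Longrightarrow> total_rec n (\<lambda>xs. step_code (f xs))"
  unfolding step_code_def Let_def by (intro total_rec_intros total_rec_prod_decode)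

definition code_trace :: "nat \<Rightarrow> nat \<Rightarrow> nat" where
  "code_trace e t = rec_nat (prod_encode (Suc (prod_encode (e, 0)), nth_prime 0 ^ e)) (\<lambda>_. step_code) t"

lemma code_trace_com_code:
  assumes "0 < b" "regs c \<subseteq> {..<b}"
  shows "code_trace (com_code c) t = config_code b (config c (com_code c) t)"
proof (induction t)
  case 0
  have "store_code b (input v) = nth_prime 0 ^ v" for v
  proof -
    have "store_code b (input v) = (\<Prod>r<b. if r = 0 then nth_prime 0 ^ v else 1)"
      unfolding store_code_def input_def by (rule prod.cong) auto
    then show ?thesis using assms(1) by simp
  qed
  then show ?case by (simp add: code_trace_def config_0 config_code_def)
next
  case (Suc t)
  have "cont_regs (fst (config c (com_code c) t)) \<subseteq> {..<b}"
    using cont_regs_config assms(2) by blast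
  then have "step_code (config_code b (config c (com_code c) t)) =
      config_code b (config c (com_code c) (Suc t))"
    using step_code_config_code by (metis config_Suc prod.collapse)
  then show ?case using Suc by (simp add: code_trace_def)
qed

lemma halts_own_code_iff: "halts c (com_code c) \<longleftrightarrow> (\<exists>t. fst (prod_decode (code_trace (com_code c) t)) = 0)"
proof -
  obtain b where "0 < b" "regs c \<subseteq> {..<b}" by (rule regs_bounded)
  then have "fst (prod_decode (code_trace (com_code c) t)) = 0 \<longleftrightarrow> fst (config c (com_code c) t) = []" for t
    by (cases "fst (config c (com_code c) t)")
      (auto simp: code_trace_com_code config_code_def split: prod.splits)
  then show ?thesis by (simp add: halts_iff_config)
qed

lemma total_rec_code_trace: "total_rec 2 (\<lambda>xs. fst (prod_decode (code_trace (xs ! 0) (xs ! 1))))"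
  unfolding code_trace_def
  by (intro total_rec_prod_decode total_rec_rec_nat[where g = "\<lambda>y r xs. step_code r"] total_rec_intros
      total_rec_step_code) simp_all

theorem undecidable_halting:
  obtains u where "\<And>f. total_rec 1 f \<Longrightarrow> \<not> (\<forall>n. f [n] \<noteq> 0 \<longleftrightarrow> halts u n)"
proof -
  obtain u where u: "\<And>e. halts u e \<longleftrightarrow> (\<exists>t. fst (prod_decode (code_trace e t)) = 0)"
    by (rule total_rec_search_program[OF total_rec_code_trace]) auto
  have "\<not> (\<forall>n. f [n] \<noteq> 0 \<longleftrightarrow> halts u n)" if f: "total_rec 1 f" for f
  proof -
    have "total_rec 2 (\<lambda>xs. f [xs ! 0])"
      by (intro total_rec_app[OF f] total_rec.proj) simp
    then obtain d where d: "\<And>n. halts d n \<longleftrightarrow> f [n] = 0"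
      by (rule total_rec_search_program) auto
    have "halts u (com_code d) \<longleftrightarrow> f [com_code d] = 0"
      using u halts_own_code_iff d by metis
    then show ?thesis by blast
  qed
  then show thesis by (rule that)
qed

subsection \<open>Counter machines\<close>

text \<open>A transition may depend on the two control states, on which counters vanish, and on the
  differences of the counter values; all of these are visible locally in the graphs below.\<close>

locale machine =
  fixes k m s0 h :: nat and R :: "nat \<Rightarrow> nat \<Rightarrow> (nat \<Rightarrow> bool) \<Rightarrow> (nat \<Rightarrow> int) \<Rightarrow> bool"
  assumes k_pos: "0 < k" and s0_less: "s0 < m" and h_less: "h < m"
    and R_states: "R s s' z \<delta> \<Longrightarrow> s < m \<and> s' < m"
    and R_delta: "R s s' z \<delta> \<Longrightarrow> i < k \<Longrightarrow> \<delta> i \<in> {-1, 0, 1}"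
    and R_cong: "R s s' z \<delta> \<Longrightarrow> (\<And>i. i < k \<Longrightarrow> z' i = z i) \<Longrightarrow> (\<And>i. i < k \<Longrightarrow> \<delta>' i = \<delta> i)
      \<Longrightarrow> R s s' z' \<delta>'"
begin

definition is_run :: "nat \<Rightarrow> (nat \<Rightarrow> nat) \<Rightarrow> (nat \<Rightarrow> nat \<Rightarrow> nat) \<Rightarrow> bool" where
  "is_run T st val \<longleftrightarrow> st 0 = s0 \<and> st T = h \<and> (\<forall>i<k. 0 < i \<longrightarrow> val 0 i = 0) \<and>
     (\<forall>t<T. R (st t) (st (Suc t)) (\<lambda>i. val t i = 0) (\<lambda>i. int (val (Suc t) i) - int (val t i)))"

definition accepts :: "nat \<Rightarrow> bool" where
  "accepts v \<longleftrightarrow> (\<exists>T st val. is_run T st val \<and> val 0 0 = v)"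

lemma is_run_final: "is_run T st val \<Longrightarrow> st T = h"
  and is_run_initial: "is_run T st val \<Longrightarrow> st 0 = s0"
    "is_run T st val \<Longrightarrow> 0 < i \<Longrightarrow> i < k \<Longrightarrow> val 0 i = 0"
  and is_run_step: "is_run T st val \<Longrightarrow> t < T \<Longrightarrow>
    R (st t) (st (Suc t)) (\<lambda>i. val t i = 0) (\<lambda>i. int (val (Suc t) i) - int (val t i))"
  by (auto simp: is_run_def)

lemma is_run_state_less:
  assumes "is_run T st val" "t \<le> T" shows "st t < m"
proof (cases "t = T")
  case True
  then show ?thesis using is_run_final[OF assms(1)] h_less by simp
next
  case False
  then show ?thesis using R_states[OF is_run_step[OF assms(1)]] assms(2) by simp
qed

end

fun conts :: "com \<Rightarrow> com list \<Rightarrow> com list set" where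
  "conts (Seq a b) \<kappa> = insert (Seq a b # \<kappa>) (conts a (b # \<kappa>) \<union> conts b \<kappa>)"
| "conts (While r c) \<kappa> = insert (While r c # \<kappa>) (conts c (While r c # \<kappa>))"
| "conts c \<kappa> = {c # \<kappa>}"

lemma finite_conts: "finite (conts c \<kappa>)"
  by (induction c \<kappa> rule: conts.induct) auto

lemma conts_start: "c # \<kappa> \<in> conts c \<kappa>"
  by (cases c) auto

lemma next_cont_conts: "\<kappa>' \<in> conts c \<kappa> \<Longrightarrow> next_cont \<kappa>' z \<in> insert \<kappa> (conts c \<kappa>)"
proof (induction c \<kappa> rule: conts.induct)
  case (1 a b \<kappa>)
  then show ?case using conts_start by force
next
  case (2 r c \<kappa>)
  then show ?case using conts_start[of c "While r c # \<kappa>"] by (cases "z r") auto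
qed auto

lemma cont_regs_conts: "\<kappa>' \<in> conts c \<kappa> \<Longrightarrow> cont_regs \<kappa>' \<subseteq> regs c \<union> cont_regs \<kappa>"
  by (induction c \<kappa> rule: conts.induct) (auto; blast)+

lemma next_cont_cong:
  "cont_regs \<kappa> \<subseteq> {..<k} \<Longrightarrow> (\<And>i. i < k \<Longrightarrow> z i = z' i) \<Longrightarrow> next_cont \<kappa> z = next_cont \<kappa> z'"
  by (cases "(\<kappa>, z)" rule: next_cont.cases) auto

lemma counter_change_cong:
  "cont_regs \<kappa> \<subseteq> {..<k} \<Longrightarrow> (\<And>i. i < k \<Longrightarrow> z i = z' i) \<Longrightarrow> counter_change \<kappa> z = counter_change \<kappa> z'"
  by (cases "(\<kappa>, z)" rule: counter_change.cases) auto

locale program =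
  fixes c :: com and k :: nat and \<kappa> :: "nat \<Rightarrow> com list"
  assumes k: "0 < k" "regs c \<subseteq> {..<k}"
    and \<kappa>: "bij_betw \<kappa> {..<card (insert [] (conts c []))} (insert [] (conts c []))"
begin

definition state_count :: nat where
  "state_count = card (insert [] (conts c []))"

definition state_of_cont :: "com list \<Rightarrow> nat" where
  "state_of_cont = the_inv_into {..<state_count} \<kappa>"

definition transition :: "nat \<Rightarrow> nat \<Rightarrow> (nat \<Rightarrow> bool) \<Rightarrow> (nat \<Rightarrow> int) \<Rightarrow> bool" where
  "transition s s' z \<delta> \<longleftrightarrow> s < state_count \<and> s' < state_count \<and> \<kappa> s' = next_cont (\<kappa> s) z \<and>
     (\<forall>i<k. \<delta> i = counter_change (\<kappa> s) z i)"

lemma state_of_cont: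
  assumes "\<kappa>' \<in> insert [] (conts c [])"
  shows "state_of_cont \<kappa>' < state_count" "\<kappa> (state_of_cont \<kappa>') = \<kappa>'"
proof -
  have "inj_on \<kappa> {..<state_count}" "\<kappa>' \<in> \<kappa> ` {..<state_count}"
    using \<kappa> assms by (simp_all add: bij_betw_def state_count_def)
  then show "state_of_cont \<kappa>' < state_count" "\<kappa> (state_of_cont \<kappa>') = \<kappa>'"
    unfolding state_of_cont_def using the_inv_into_into[of \<kappa> "{..<state_count}" \<kappa>' "{..<state_count}"]
    by (auto simp: f_the_inv_into_f)
qed

lemma cont_regs_bounded: "\<kappa>' \<in> insert [] (conts c []) \<Longrightarrow> cont_regs \<kappa>' \<subseteq> {..<k}"
  using cont_regs_conts[of \<kappa>' c "[]"] k by auto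

lemma cont_regs_state:
  assumes "s < state_count" shows "cont_regs (\<kappa> s) \<subseteq> {..<k}"
proof -
  have "\<kappa> s \<in> insert [] (conts c [])"
    using \<kappa> assms unfolding bij_betw_def state_count_def by blast
  then show ?thesis by (rule cont_regs_bounded)
qed

lemma transition_cong:
  assumes "transition s s' z \<delta>" "\<And>i. i < k \<Longrightarrow> z' i = z i" "\<And>i. i < k \<Longrightarrow> \<delta>' i = \<delta> i"
  shows "transition s s' z' \<delta>'"
proof -
  have "cont_regs (\<kappa> s) \<subseteq> {..<k}" using assms(1) cont_regs_state by (simp add: transition_def)
  then have "next_cont (\<kappa> s) z' = next_cont (\<kappa> s) z" "counter_change (\<kappa> s) z' = counter_change (\<kappa> s) z"
    using next_cont_cong counter_change_cong assms(2) by blast+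
  then show ?thesis using assms by (simp add: transition_def)
qed

sublocale machine k state_count "state_of_cont [c]" "state_of_cont []" transition
proof
  show "state_of_cont [c] < state_count" "state_of_cont [] < state_count"
    using state_of_cont conts_start by auto
  show "transition s s' z' \<delta>'"
    if "transition s s' z \<delta>" "\<And>i. i < k \<Longrightarrow> z' i = z i" "\<And>i. i < k \<Longrightarrow> \<delta>' i = \<delta> i" for s s' z \<delta> z' \<delta>'
    using that by (rule transition_cong)
  show "\<delta> i \<in> {-1, 0, 1}" if "transition s s' z \<delta>" "i < k" for s s' z \<delta> i
    using that counter_change_range[of "\<kappa> s" z i] by (simp add: transition_def)
qed (simp_all add: k transition_def)

lemma cont_config_in_conts: "fst (config c v t) \<in> insert [] (conts c [])"
proof (induction t)
  case 0
  then show ?case using conts_start[of c "[]"] by (simp add: config_0)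
next
  case (Suc t)
  then show ?case
    using next_cont_conts[of "fst (config c v t)" c "[]" "\<lambda>i. snd (config c v t) i = 0"]
    by (auto simp: config_Suc step_def split: prod.splits)
qed

lemma run_config:
  assumes run: "is_run T st val" and "val 0 0 = v" and "t \<le> T"
  shows "\<kappa> (st t) = fst (config c v t) \<and> (\<forall>i<k. val t i = snd (config c v t) i)"
  using \<open>t \<le> T\<close>
proof (induction t)
  case 0
  have "val 0 i = input v i" if "i < k" for i
    using is_run_initial(2)[OF run _ that] assms(2) by (auto simp: input_def)
  then show ?case
    using is_run_initial(1)[OF run] state_of_cont(2)[of "[c]"] conts_start[of c "[]"] by (simp add: config_0)
next
  case (Suc t)
  obtain \<kappa>' s where conf: "config c v t = (\<kappa>', s)" by fastforce
  then have IH: "\<kappa> (st t) = \<kappa>'" "\<And>i. i < k \<Longrightarrow> val t i = s i" using Suc by auto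
  have tr: "transition (st t) (st (Suc t)) (\<lambda>i. s i = 0) (\<lambda>i. int (val (Suc t) i) - int (s i))"
    by (rule transition_cong[OF is_run_step[OF run]]) (use Suc.prems IH(2) in auto)
  then have "val (Suc t) i = nat (int (s i) + counter_change \<kappa>' (\<lambda>i. s i = 0) i)" if "i < k" for i
    using that IH(1) by (simp add: transition_def) (metis add.commute diff_add_cancel nat_int)
  then show ?case
    using tr by (simp add: transition_def config_Suc conf step_def IH(1))
qed

lemma is_run_config:
  assumes "fst (config c v T) = []"
  shows "is_run T (\<lambda>t. state_of_cont (fst (config c v t))) (\<lambda>t. snd (config c v t))"
  unfolding is_run_def
proof (intro conjI allI impI)
  fix t i :: nat
  show "state_of_cont (fst (config c v 0)) = state_of_cont [c]" by (simp add: config_0)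
  show "state_of_cont (fst (config c v T)) = state_of_cont []" by (simp add: assms)
  show "snd (config c v 0) i = 0" if "0 < i" using that by (simp add: config_0 input_def)
  have "next_cont (fst (config c v t)) (\<lambda>i. snd (config c v t) i = 0) = fst (config c v (Suc t))"
    "int (snd (config c v (Suc t)) i) - int (snd (config c v t) i)
      = counter_change (fst (config c v t)) (\<lambda>i. snd (config c v t) i = 0) i" for i
    using counter_change_ge[of "snd (config c v t)" i "fst (config c v t)"]
    by (auto simp: config_Suc step_def split: prod.splits)
  then show "transition (state_of_cont (fst (config c v t))) (state_of_cont (fst (config c v (Suc t))))
      (\<lambda>i. snd (config c v t) i = 0) (\<lambda>i. int (snd (config c v (Suc t)) i) - int (snd (config c v t) i))"
    unfolding transition_def using state_of_cont[OF cont_config_in_conts] by simp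
qed

theorem accepts_iff_halts: "accepts v \<longleftrightarrow> halts c v"
  unfolding halts_iff_config
proof
  assume "accepts v"
  then obtain T st val where run: "is_run T st val" "val 0 0 = v" by (auto simp: accepts_def)
  then have "fst (config c v T) = []"
    using run_config[OF run, of T] is_run_final[OF run(1)] state_of_cont(2)[of "[]"] by simp
  then show "\<exists>t. fst (config c v t) = []" ..
next
  assume "\<exists>t. fst (config c v t) = []"
  then obtain T where "fst (config c v T) = []" ..
  from is_run_config[OF this] show "accepts v"
    unfolding accepts_def
    by (intro exI[of _ T] exI[of _ "\<lambda>t. state_of_cont (fst (config c v t))"]
        exI[of _ "\<lambda>t. snd (config c v t)"])
      (simp add: config_0 input_def)
qed

end

theorem undecidable_machine:
  obtains k m s0 h R where "machine k m s0 h R"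
    "\<And>f. total_rec 1 f \<Longrightarrow> \<not> (\<forall>n. f [n] \<noteq> 0 \<longleftrightarrow> machine.accepts k s0 h R (Suc n))"
proof -
  obtain u where undec: "\<And>f. total_rec 1 f \<Longrightarrow> \<not> (\<forall>n. f [n] \<noteq> 0 \<longleftrightarrow> halts u n)"
    by (rule undecidable_halting) blast
  define c where "c = Seq (Dec 0) u"
  have halts: "halts c (Suc n) \<longleftrightarrow> halts u n" for n
  proof -
    have "exec (Dec 0) (input (Suc n)) (input n)"
      by (rule exec_DecI) (simp add: input_def)
    then show ?thesis
      unfolding halts_def c_def using exec_deterministic by (metis exec.Seq exec_elims(4))
  qed
  obtain k where k: "0 < k" "regs c \<subseteq> {..<k}" by (rule regs_bounded)
  have "finite (insert [] (conts c []))" by (simp add: finite_conts)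
  then obtain \<kappa> where "bij_betw \<kappa> {..<card (insert [] (conts c []))} (insert [] (conts c []))"
    using ex_bij_betw_nat_finite unfolding lessThan_atLeast0 by blast
  then interpret program c k \<kappa> by unfold_locales (use k in auto)
  show thesis
    by (rule that[OF machine_axioms]) (use undec accepts_iff_halts halts in auto)
qed

subsection \<open>Realizations as adjacency relations\<close>

definition consecutive :: "'a list \<Rightarrow> 'a \<Rightarrow> 'a \<Rightarrow> bool" where
  "consecutive xs x y \<longleftrightarrow> (\<exists>i. Suc i < length xs \<and> x = xs ! i \<and> y = xs ! Suc i)"

lemma consecutive_Nil [simp]: "\<not> consecutive [] x y"
  and consecutive_single [simp]: "\<not> consecutive [z] x y"
  by (simp_all add: consecutive_def)

lemma consecutive_Cons_Cons [simp]:
  "consecutive (a # b # xs) x y \<longleftrightarrow> x = a \<and> y = b \<or> consecutive (b # xs) x y"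
proof
  assume "consecutive (a # b # xs) x y"
  then obtain i where "Suc i < length (a # b # xs)" "x = (a # b # xs) ! i" "y = (a # b # xs) ! Suc i"
    unfolding consecutive_def by blast
  then show "x = a \<and> y = b \<or> consecutive (b # xs) x y"
    by (cases i) (auto simp: consecutive_def)
next
  assume "x = a \<and> y = b \<or> consecutive (b # xs) x y"
  then consider "x = a" "y = b" | i where "Suc i < length (b # xs)" "x = (b # xs) ! i" "y = (b # xs) ! Suc i"
    unfolding consecutive_def by blast
  then show "consecutive (a # b # xs) x y"
  proof cases
    case 1
    then show ?thesis unfolding consecutive_def by (intro exI[of _ 0]) simp
  next
    case (2 i)
    then show ?thesis unfolding consecutive_def by (intro exI[of _ "Suc i"]) simp
  qed
qed

lemma consecutive_append_Cons [simp]: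
  "consecutive (xs @ [a, b]) x y \<longleftrightarrow> consecutive (xs @ [a]) x y \<or> x = a \<and> y = b"
proof (induction xs)
  case (Cons c xs)
  then show ?case by (cases xs) auto
qed simp

lemma consecutive_rev: "consecutive (rev xs) x y \<longleftrightarrow> consecutive xs y x"
proof (induction xs)
  case (Cons a xs)
  then show ?case by (cases xs) auto
qed simp

lemma consecutive_map: "consecutive (map f xs) x y \<longleftrightarrow> (\<exists>u w. consecutive xs u w \<and> x = f u \<and> y = f w)"
proof (induction xs rule: induct_list012)
  case (3 a b xs)
  then show ?case by auto
qed simp_all

lemma consecutive_in_set: "consecutive xs x y \<Longrightarrow> x \<in> set xs \<and> y \<in> set xs"
  by (auto simp: consecutive_def)

lemma successively_iff_consecutive: "successively Q xs \<longleftrightarrow> (\<forall>x y. consecutive xs x y \<longrightarrow> Q x y)"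
  by (induction xs rule: induct_list012) auto

lemma consecutive_upt: "consecutive [a..<b] x y \<longleftrightarrow> a \<le> x \<and> y = Suc x \<and> y < b"
proof
  assume "a \<le> x \<and> y = Suc x \<and> y < b"
  then show "consecutive [a..<b] x y"
    unfolding consecutive_def by (intro exI[of _ "x - a"]) auto
qed (auto simp: consecutive_def)

lemma consecutive_ends:
  assumes "xs \<noteq> []"
  shows "consecutive (x # xs @ [y]) u w \<longleftrightarrow> u = x \<and> w = hd xs \<or> consecutive xs u w \<or> u = last xs \<and> w = y"
proof -
  obtain ys z where xs: "xs = ys @ [z]" using assms by (cases xs rule: rev_cases) auto
  show ?thesis
    using consecutive_append_Cons[of "x # ys" z y u w] unfolding xs by (cases ys) auto
qed

lemma consecutive_ends_map_upt:
  assumes "o' < n"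
  shows "consecutive (x # map g [o'..<n] @ [y]) u w \<longleftrightarrow>
    u = x \<and> w = g o' \<or> u = g (n - 1) \<and> w = y \<or> (\<exists>j. o' \<le> j \<and> Suc j < n \<and> u = g j \<and> w = g (Suc j))"
proof -
  have "map g [o'..<n] \<noteq> []" "hd (map g [o'..<n]) = g o'" "last (map g [o'..<n]) = g (n - 1)"
    using assms by (simp_all add: hd_map last_map)
  then show ?thesis by (auto simp: consecutive_ends consecutive_map consecutive_upt)
qed

lemma path_edges_conv_consecutive: "path_edges xs = {{x, y} | x y. consecutive xs x y}"
  unfolding path_edges_def consecutive_def by blast

lemma path_edges_subset_iff: "path_edges xs \<subseteq> E \<longleftrightarrow> successively (\<lambda>x y. {x, y} \<in> E) xs"
  by (auto simp: path_edges_conv_consecutive successively_iff_consecutive)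

lemma path_edges_rev: "path_edges (rev xs) = path_edges xs"
  unfolding path_edges_conv_consecutive consecutive_rev by (auto simp: insert_commute)

text \<open>\<open>en\<close> orients the urpaths; \<open>\<phi>\<close> and \<open>P\<close> place the vertices and the interiors of the urpaths in a
  graph with vertex set \<open>X\<close> and adjacency relation \<open>A\<close>.\<close>

definition orients :: "(nat \<Rightarrow> nat \<times> nat) \<Rightarrow> pathograph \<Rightarrow> bool" where
  "orients en H \<longleftrightarrow> (\<forall>u\<in>pU H. {fst (en u), snd (en u)} = ppi H u)"

definition urpath :: "(nat \<Rightarrow> nat \<times> nat) \<Rightarrow> (nat \<Rightarrow> 'a) \<Rightarrow> (nat \<Rightarrow> 'a list) \<Rightarrow> nat \<Rightarrow> 'a list" where
  "urpath en \<phi> P u = \<phi> (fst (en u)) # P u @ [\<phi> (snd (en u))]"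

inductive linked :: "pathograph \<Rightarrow> (nat \<Rightarrow> nat \<times> nat) \<Rightarrow> (nat \<Rightarrow> 'a) \<Rightarrow> (nat \<Rightarrow> 'a list) \<Rightarrow> 'a \<Rightarrow> 'a \<Rightarrow> bool"
  for H en \<phi> P where
  edge: "{x, y} \<in> pE H \<Longrightarrow> linked H en \<phi> P (\<phi> x) (\<phi> y)"
| path: "u \<in> pU H \<Longrightarrow> consecutive (urpath en \<phi> P u) x y \<Longrightarrow> linked H en \<phi> P x y"
| spoke: "(v, u) \<in> pS H \<Longrightarrow> y \<in> set (P u) \<Longrightarrow> linked H en \<phi> P (\<phi> v) y"
| rung: "{u, u'} \<in> pR H \<Longrightarrow> x \<in> set (P u) \<Longrightarrow> y \<in> set (P u') \<Longrightarrow> linked H en \<phi> P x y"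

locale placement =
  fixes H :: pathograph and X :: "'a set" and \<phi> :: "nat \<Rightarrow> 'a" and P :: "nat \<Rightarrow> 'a list"
  assumes inj: "inj_on \<phi> (pV H)"
    and path_nonempty: "u \<in> pU H \<Longrightarrow> P u \<noteq> []"
    and path_distinct: "u \<in> pU H \<Longrightarrow> distinct (P u)"
    and path_internal: "u \<in> pU H \<Longrightarrow> v \<in> pV H \<Longrightarrow> \<phi> v \<notin> set (P u)"
    and paths_disjoint: "u \<in> pU H \<Longrightarrow> u' \<in> pU H \<Longrightarrow> u \<noteq> u' \<Longrightarrow> set (P u) \<inter> set (P u') = {}"
    and carrier: "X = \<phi> ` pV H \<union> (\<Union>u\<in>pU H. set (P u))"

locale realizes = placement H X \<phi> P
  for H :: pathograph and en :: "nat \<Rightarrow> nat \<times> nat" and X :: "'a set" and A :: "'a \<Rightarrow> 'a \<Rightarrow> bool"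
    and \<phi> :: "nat \<Rightarrow> 'a" and P :: "nat \<Rightarrow> 'a list" +
  assumes edges: "{v, w} \<in> pE H \<Longrightarrow> A (\<phi> v) (\<phi> w)"
    and paths: "u \<in> pU H \<Longrightarrow> successively A (urpath en \<phi> P u)"
    and spokes: "(v, u) \<in> pS H \<Longrightarrow> \<exists>y\<in>set (P u). A (\<phi> v) y"
    and rungs: "{u, u'} \<in> pR H \<Longrightarrow> \<exists>x\<in>set (P u). \<exists>y\<in>set (P u'). A x y"
    and adj_linked: "x \<in> X \<Longrightarrow> y \<in> X \<Longrightarrow> A x y \<Longrightarrow> linked H en \<phi> P x y \<or> linked H en \<phi> P y x"

definition counterpart :: "pathograph \<Rightarrow> (nat \<Rightarrow> 'a) \<Rightarrow> (nat \<Rightarrow> 'a list) \<Rightarrow> (nat \<Rightarrow> 'b) \<Rightarrow> (nat \<Rightarrow> 'b list) \<Rightarrow>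
    'a \<Rightarrow> 'b \<Rightarrow> bool"
  where "counterpart H \<phi> P \<psi> Q x y \<longleftrightarrow> (\<exists>v\<in>pV H. x = \<phi> v \<and> y = \<psi> v) \<or>
    (\<exists>u\<in>pU H. \<exists>i<length (P u). x = P u ! i \<and> y = Q u ! i)"

lemma (in placement) ex1_counterpart:
  assumes "x \<in> X" shows "\<exists>!y. counterpart H \<phi> P \<psi> Q x y"
proof (rule ex_ex1I)
  show "\<exists>y. counterpart H \<phi> P \<psi> Q x y"
    using assms unfolding carrier counterpart_def by (auto simp: in_set_conv_nth)
  fix y y' assume y: "counterpart H \<phi> P \<psi> Q x y" "counterpart H \<phi> P \<psi> Q x y'"
  show "y = y'"
  proof (cases "x \<in> \<phi> ` pV H")
    case True
    then have "x \<noteq> P u ! i" if "u \<in> pU H" "i < length (P u)" for u i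
      using path_internal[OF that(1)] nth_mem[OF that(2)] True by (metis imageE)
    then show ?thesis using y inj unfolding counterpart_def by (auto dest: inj_onD)
  next
    case False
    then obtain u i u' i' where u: "u \<in> pU H" "i < length (P u)" "x = P u ! i" "y = Q u ! i"
      and u': "u' \<in> pU H" "i' < length (P u')" "x = P u' ! i'" "y' = Q u' ! i'"
      using y unfolding counterpart_def by blast
    then have "x \<in> set (P u)" "x \<in> set (P u')" by (metis nth_mem)+
    then have "u = u'" using paths_disjoint[OF u(1) u'(1)] by blast
    then show ?thesis using u u' path_distinct nth_eq_iff_index_eq by metis
  qed
qed

lemma placement_bij_betw:
  assumes "placement H X \<phi> P" "placement H Y \<psi> Q" and len: "\<And>u. u \<in> pU H \<Longrightarrow> length (P u) = length (Q u)"
  obtains f where "bij_betw f X Y" "\<And>v. v \<in> pV H \<Longrightarrow> f (\<phi> v) = \<psi> v" "\<And>u. u \<in> pU H \<Longrightarrow> map f (P u) = Q u"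
proof -
  interpret P: placement H X \<phi> P by (rule assms)
  interpret Q: placement H Y \<psi> Q by (rule assms)
  let ?r = "counterpart H \<phi> P \<psi> Q"
  define f where "f = (\<lambda>x. THE y. ?r x y)"
  have swap: "counterpart H \<psi> Q \<phi> P y x \<longleftrightarrow> ?r x y" for x y
    using len by (auto simp: counterpart_def)
  have f: "?r x (f x)" if "x \<in> X" for x
    unfolding f_def using P.ex1_counterpart[OF that] by (rule theI')
  have f_eq: "f x = y" if "?r x y" for x y
  proof -
    have "x \<in> X" using that nth_mem unfolding counterpart_def P.carrier by fastforce
    from P.ex1_counterpart[OF this] that show ?thesis unfolding f_def by (rule the1_equality)
  qed
  have mem: "x \<in> X \<and> y \<in> Y" if "?r x y" for x y
    using that len nth_mem unfolding counterpart_def P.carrier Q.carrier by fastforce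
  have ex1: "\<exists>!x. ?r x y" if "y \<in> Y" for y
    using Q.ex1_counterpart[OF that, of \<phi> P] unfolding swap .
  have "bij_betw f X Y"
    unfolding bij_betw_def
  proof
    show "inj_on f X" using f mem ex1 by (intro inj_onI) metis
    show "f ` X = Y" using f mem f_eq ex1 by (auto simp: image_iff) metis+
  qed
  moreover have "f (\<phi> v) = \<psi> v" if "v \<in> pV H" for v
    by (rule f_eq) (use that in \<open>auto simp: counterpart_def\<close>)
  moreover have "map f (P u) = Q u" if "u \<in> pU H" for u
  proof (rule nth_equalityI)
    fix i assume i: "i < length (map f (P u))"
    then have "?r (P u ! i) (Q u ! i)" using that unfolding counterpart_def by auto
    then show "map f (P u) ! i = Q u ! i" using f_eq i by simp
  qed (simp add: len that)
  ultimately show thesis by (rule that)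
qed

lemma
  assumes "wf_pathograph H"
  shows wf_pathograph_edge: "e \<in> pE H \<Longrightarrow> e \<subseteq> pV H" "e \<in> pE H \<Longrightarrow> card e = 2"
    and wf_pathograph_spoke: "(v, u) \<in> pS H \<Longrightarrow> v \<in> pV H" "(v, u) \<in> pS H \<Longrightarrow> u \<in> pU H"
    and wf_pathograph_rung: "{u, u'} \<in> pR H \<Longrightarrow> u \<in> pU H" "{u, u'} \<in> pR H \<Longrightarrow> u' \<in> pU H"
    and wf_pathograph_ends: "u \<in> pU H \<Longrightarrow> ppi H u \<subseteq> pV H"
  using assms unfolding wf_pathograph_def by auto

lemma orientsD:
  assumes "wf_pathograph H" "orients en H" "u \<in> pU H"
  shows "fst (en u) \<in> pV H" "snd (en u) \<in> pV H"
  using assms wf_pathograph_ends[OF assms(1,3)] unfolding orients_def by auto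

lemma consecutive_internal:
  "consecutive (x # xs @ [y]) u w \<Longrightarrow> xs \<noteq> [] \<Longrightarrow> u \<in> set xs \<or> w \<in> set xs"
  by (auto simp: consecutive_ends dest: consecutive_in_set)

context realizes
begin

lemma explicit_adj_iff:
  assumes wf: "wf_pathograph H" "orients en H" and vw: "v \<in> pV H" "w \<in> pV H"
  shows "A (\<phi> v) (\<phi> w) \<longleftrightarrow> {v, w} \<in> pE H"
proof
  have "{v, w} \<in> pE H" if "linked H en \<phi> P x y" and xy: "{x, y} = {\<phi> v, \<phi> w}" for x y
    using that(1)
  proof cases
    case (edge v' w')
    then have "\<phi> ` {v', w'} = \<phi> ` {v, w}" "{v', w'} \<subseteq> pV H"
      using xy wf_pathograph_edge(1)[OF wf(1) edge(3)] by auto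
    then show ?thesis
      using inj_on_image_eq_iff[OF inj, of "{v', w'}" "{v, w}"] vw edge(3) by simp
  next
    case (path u)
    then have "x \<in> set (P u) \<or> y \<in> set (P u)"
      unfolding urpath_def using consecutive_internal path_nonempty by metis
    then show ?thesis using xy path_internal[OF path(1)] vw by (auto simp: doubleton_eq_iff)
  next
    case (spoke v' u)
    then show ?thesis
      using xy path_internal[OF wf_pathograph_spoke(2)[OF wf(1) spoke(2)]] vw by (auto simp: doubleton_eq_iff)
  next
    case (rung u u')
    then show ?thesis
      using xy path_internal[OF wf_pathograph_rung(1)[OF wf(1) rung(1)]] vw by (auto simp: doubleton_eq_iff)
  qed
  moreover assume "A (\<phi> v) (\<phi> w)"
  ultimately show "{v, w} \<in> pE H"
    using adj_linked[of "\<phi> v" "\<phi> w"] carrier vw by (metis UnCI imageI insert_commute)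
qed (rule edges)

lemma explicit_internal_adj:
  assumes wf: "wf_pathograph H" "orients en H" and v: "v \<in> pV H" and u: "u \<in> pU H" and z: "z \<in> set (P u)"
    and adj: "A (\<phi> v) z"
  shows "v = fst (en u) \<and> z = hd (P u) \<or> v = snd (en u) \<and> z = last (P u) \<or> (v, u) \<in> pS H" (is ?thesis)
proof -
  have z_neq: "z \<noteq> \<phi> w" if "w \<in> pV H" for w using path_internal[OF u that] z by auto
  have u_eq: "u' = u" if "u' \<in> pU H" "z \<in> set (P u')" for u'
    using paths_disjoint[OF u that(1)] z that(2) by auto
  have ?thesis if "linked H en \<phi> P x y" and xy: "{x, y} = {\<phi> v, z}" for x y
    using that(1)
  proof cases
    case (edge v' w')
    then show ?thesis using xy z_neq wf_pathograph_edge(1)[OF wf(1) edge(3)] by (auto simp: doubleton_eq_iff)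
  next
    case (path u')
    have ends: "fst (en u') \<in> pV H" "snd (en u') \<in> pV H" using orientsD[OF wf path(1)] .
    have v_out: "\<phi> v \<notin> set (P u')" using path_internal[OF path(1) v] .
    have "x = \<phi> (fst (en u')) \<and> y = hd (P u') \<or> consecutive (P u') x y \<or>
        x = last (P u') \<and> y = \<phi> (snd (en u'))"
      using path consecutive_ends[OF path_nonempty[OF path(1)]] by (simp add: urpath_def)
    then have "\<phi> v = \<phi> (fst (en u')) \<and> z = hd (P u') \<or> \<phi> v = \<phi> (snd (en u')) \<and> z = last (P u')"
      using xy v_out z_neq ends consecutive_in_set[of "P u'" x y] by (auto simp: doubleton_eq_iff)
    moreover from this have "u' = u" using u_eq[OF path(1)] path_nonempty[OF path(1)] by auto
    ultimately show ?thesis using inj_onD[OF inj] ends v by blast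
  next
    case (spoke w u')
    have w: "w \<in> pV H" "u' \<in> pU H" using wf_pathograph_spoke[OF wf(1) spoke(2)] .
    then have "\<phi> w = \<phi> v" "y = z" using xy z_neq spoke(1) by (auto simp: doubleton_eq_iff)
    then show ?thesis using u_eq[OF w(2)] inj_onD[OF inj _ w(1) v] spoke by simp
  next
    case (rung u1 u2)
    have "u1 \<in> pU H" "u2 \<in> pU H" using wf_pathograph_rung[OF wf(1) rung(1)] .
    then show ?thesis using path_internal v rung xy by (auto simp: doubleton_eq_iff)
  qed
  then show ?thesis
    using adj_linked[of "\<phi> v" z] carrier v u z adj by (metis UN_I UnCI imageI insert_commute)
qed

lemma internal_adj:
  assumes wf: "wf_pathograph H" "orients en H" and u: "u \<in> pU H" "u' \<in> pU H"
    and z: "z \<in> set (P u)" "z' \<in> set (P u')" and adj: "A z z'"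
  shows "u = u' \<and> (consecutive (P u) z z' \<or> consecutive (P u) z' z) \<or> {u, u'} \<in> pR H" (is ?thesis)
proof -
  have z_neq: "z \<noteq> \<phi> w" "z' \<noteq> \<phi> w" if "w \<in> pV H" for w using path_internal[OF _ that] u z by auto
  have u_eq: "w = u" if "w \<in> pU H" "z \<in> set (P w)" for w
    using paths_disjoint[OF u(1) that(1)] z(1) that(2) by auto
  have u'_eq: "w = u'" if "w \<in> pU H" "z' \<in> set (P w)" for w
    using paths_disjoint[OF u(2) that(1)] z(2) that(2) by auto
  have ?thesis if "linked H en \<phi> P x y" and xy: "{x, y} = {z, z'}" for x y
    using that(1)
  proof cases
    case (edge v w)
    then show ?thesis using xy z_neq wf_pathograph_edge(1)[OF wf(1) edge(3)] by (auto simp: doubleton_eq_iff)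
  next
    case (path w)
    have "x \<noteq> \<phi> (fst (en w))" "y \<noteq> \<phi> (snd (en w))"
      using xy z_neq orientsD[OF wf path(1)] by (auto simp: doubleton_eq_iff)
    then have "consecutive (P w) x y"
      using path(2) consecutive_ends[OF path_nonempty[OF path(1)]] by (simp add: urpath_def)
    moreover from consecutive_in_set[OF this] have "w = u" "w = u'"
      using xy u_eq[OF path(1)] u'_eq[OF path(1)] by (auto simp: doubleton_eq_iff)
    ultimately show ?thesis using xy by (auto simp: doubleton_eq_iff)
  next
    case (spoke v w)
    then show ?thesis using xy z_neq wf_pathograph_spoke(1)[OF wf(1) spoke(2)]
      by (auto simp: doubleton_eq_iff)
  next
    case (rung u1 u2)
    have "u1 \<in> pU H" "u2 \<in> pU H" using wf_pathograph_rung[OF wf(1) rung(1)] .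
    then have "{u1, u2} = {u, u'}" using rung xy u_eq u'_eq by (auto simp: doubleton_eq_iff)
    then show ?thesis using rung(1) by simp
  qed
  then show ?thesis
    using adj_linked[of z z'] carrier u z adj by (metis UN_I UnCI insert_commute)
qed

end

lemma urpath_map: "urpath en (f \<circ> \<phi>) (map f \<circ> P) u = map f (urpath en \<phi> P u)"
  by (simp add: urpath_def)

lemma linked_map: "linked H en \<phi> P x y \<Longrightarrow> linked H en (f \<circ> \<phi>) (map f \<circ> P) (f x) (f y)"
proof (induction rule: linked.cases)
  case (edge v w)
  then show ?case using linked.edge[of v w H en "f \<circ> \<phi>"] by simp
next
  case (path u x' y')
  then have "consecutive (urpath en (f \<circ> \<phi>) (map f \<circ> P) u) (f x) (f y)"
    unfolding urpath_map consecutive_map by blast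
  then show ?case using path by (blast intro: linked.path)
next
  case (spoke v u y')
  then show ?case using linked.spoke[of v u H "f y" "map f \<circ> P" en "f \<circ> \<phi>"] by simp
next
  case (rung u u')
  then show ?case by (auto intro!: linked.rung)
qed

lemma placement_image:
  assumes "placement H X \<phi> P" and f: "inj_on f X"
  shows "placement H (f ` X) (f \<circ> \<phi>) (map f \<circ> P)"
proof -
  interpret placement H X \<phi> P by (rule assms)
  have vertex_mem: "\<phi> v \<in> X" if "v \<in> pV H" for v using that carrier by auto
  have path_subset: "set (P u) \<subseteq> X" if "u \<in> pU H" for u using that carrier by auto
  show ?thesis
  proof
    show "inj_on (f \<circ> \<phi>) (pV H)"
      using vertex_mem by (intro comp_inj_on inj inj_on_subset[OF f]) auto
    show "(map f \<circ> P) u \<noteq> []" if "u \<in> pU H" for u using path_nonempty that by simp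
    show "distinct ((map f \<circ> P) u)" if "u \<in> pU H" for u
      using path_distinct[OF that] inj_on_subset[OF f path_subset[OF that]] by (simp add: distinct_map)
    show "(f \<circ> \<phi>) v \<notin> set ((map f \<circ> P) u)" if "u \<in> pU H" "v \<in> pV H" for u v
      using path_internal[OF that] inj_onD[OF f] vertex_mem path_subset that by fastforce
    show "set ((map f \<circ> P) u) \<inter> set ((map f \<circ> P) u') = {}" if "u \<in> pU H" "u' \<in> pU H" "u \<noteq> u'" for u u'
    proof -
      have "f ` set (P u) \<inter> f ` set (P u') = f ` (set (P u) \<inter> set (P u'))"
        by (rule inj_on_image_Int[OF f, symmetric]) (use path_subset that in auto)
      then show ?thesis using paths_disjoint[OF that] by simp
    qed
    show "f ` X = (f \<circ> \<phi>) ` pV H \<union> (\<Union>u\<in>pU H. set ((map f \<circ> P) u))"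
      by (subst carrier) (simp add: image_Un image_comp image_UN)
  qed
qed

lemma realizes_image:
  assumes "realizes H en X A \<phi> P" and wf: "wf_pathograph H" "orients en H" and f: "inj_on f X"
    and adj: "\<And>x y. x \<in> X \<Longrightarrow> y \<in> X \<Longrightarrow> B (f x) (f y) \<longleftrightarrow> A x y"
  shows "realizes H en (f ` X) B (f \<circ> \<phi>) (map f \<circ> P)"
proof -
  interpret realizes H en X A \<phi> P by (rule assms)
  have vertex_mem: "\<phi> v \<in> X" if "v \<in> pV H" for v using that carrier by auto
  have path_mem: "y \<in> X" if "u \<in> pU H" "y \<in> set (P u)" for u y using that carrier by auto
  have urpath_mem: "x \<in> X" if "u \<in> pU H" "x \<in> set (urpath en \<phi> P u)" for u x
    using that vertex_mem path_mem orientsD[OF wf that(1)] by (auto simp: urpath_def)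
  interpret image: placement H "f ` X" "f \<circ> \<phi>" "map f \<circ> P" using placement_axioms f by (rule placement_image)
  show ?thesis
  proof
    show "B ((f \<circ> \<phi>) v) ((f \<circ> \<phi>) w)" if "{v, w} \<in> pE H" for v w
      using edges[OF that] adj vertex_mem wf_pathograph_edge(1)[OF wf(1) that] by simp
    show "successively B (urpath en (f \<circ> \<phi>) (map f \<circ> P) u)" if "u \<in> pU H" for u
      unfolding urpath_map successively_map
      using paths[OF that] by (rule successively_mono) (use adj urpath_mem[OF that] in auto)
    show "\<exists>y\<in>set ((map f \<circ> P) u). B ((f \<circ> \<phi>) v) y" if "(v, u) \<in> pS H" for v u
      using spokes[OF that] adj vertex_mem path_mem wf_pathograph_spoke[OF wf(1) that] by auto
    show "\<exists>x\<in>set ((map f \<circ> P) u). \<exists>y\<in>set ((map f \<circ> P) u'). B x y" if "{u, u'} \<in> pR H" for u u'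
      using rungs[OF that] adj path_mem wf_pathograph_rung[OF wf(1) that] by auto
    show "linked H en (f \<circ> \<phi>) (map f \<circ> P) x y \<or> linked H en (f \<circ> \<phi>) (map f \<circ> P) y x"
      if xy: "x \<in> f ` X" "y \<in> f ` X" and "B x y" for x y
    proof -
      obtain a b where ab: "a \<in> X" "b \<in> X" "x = f a" "y = f b" using xy by blast
      then have "linked H en \<phi> P a b \<or> linked H en \<phi> P b a" using \<open>B x y\<close> adj adj_linked by simp
      then show ?thesis using linked_map[where f = f] unfolding ab(3,4) by auto
    qed
  qed
qed

lemma realizes_cong:
  assumes "realizes H en X A \<phi> P" and wf: "wf_pathograph H" "orients en H"
    and \<phi>: "\<And>v. v \<in> pV H \<Longrightarrow> \<phi> v = \<phi>' v" and P: "\<And>u. u \<in> pU H \<Longrightarrow> P u = P' u"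
  shows "realizes H en X A \<phi>' P'"
proof -
  interpret realizes H en X A \<phi> P by (rule assms)
  have urpath: "urpath en \<phi>' P' u = urpath en \<phi> P u" if "u \<in> pU H" for u
    using \<phi> P[OF that] orientsD[OF wf that] by (simp add: urpath_def)
  have linked: "linked H en \<phi>' P' x y" if "linked H en \<phi> P x y" for x y
    using that
  proof cases
    case (edge v w)
    then show ?thesis using \<phi> wf_pathograph_edge(1)[OF wf(1) edge(3)] linked.edge[OF edge(3)] by simp
  next
    case (path u)
    then show ?thesis using urpath by (metis linked.path)
  next
    case (spoke v u)
    then show ?thesis
      using \<phi> P wf_pathograph_spoke[OF wf(1) spoke(2)] linked.spoke[OF spoke(2), of y P'] by simp
  next
    case (rung u u')
    then show ?thesis
      using P wf_pathograph_rung[OF wf(1) rung(1)] linked.rung[OF rung(1), of x P' y] by simp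
  qed
  show ?thesis
  proof
    show "inj_on \<phi>' (pV H)" using inj \<phi> by (simp cong: inj_on_cong)
    show "X = \<phi>' ` pV H \<union> (\<Union>u\<in>pU H. set (P' u))" using carrier \<phi> P by simp
    show "A (\<phi>' v) (\<phi>' w)" if "{v, w} \<in> pE H" for v w
      using edges[OF that] \<phi> wf_pathograph_edge(1)[OF wf(1) that] by simp
    show "\<exists>y\<in>set (P' u). A (\<phi>' v) y" if "(v, u) \<in> pS H" for v u
      using spokes[OF that] \<phi> P wf_pathograph_spoke[OF wf(1) that] by simp
    show "\<exists>x\<in>set (P' u). \<exists>y\<in>set (P' u'). A x y" if "{u, u'} \<in> pR H" for u u'
      using rungs[OF that] P wf_pathograph_rung[OF wf(1) that] by simp
    show "successively A (urpath en \<phi>' P' u)" if "u \<in> pU H" for u using paths[OF that] urpath[OF that] by simp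
    show "linked H en \<phi>' P' x y \<or> linked H en \<phi>' P' y x" if "x \<in> X" "y \<in> X" "A x y" for x y
      using adj_linked[OF that] linked by blast
  qed (use \<phi> P path_nonempty path_distinct path_internal paths_disjoint in auto)
qed

lemma linked_doubleton_iff:
  assumes wf: "wf_pathograph H"
  shows "linked H en \<phi> P x y \<or> linked H en \<phi> P y x \<longleftrightarrow>
    (\<exists>e\<in>pE H. {x, y} = \<phi> ` e) \<or> (\<exists>u\<in>pU H. {x, y} \<in> path_edges (urpath en \<phi> P u)) \<or>
    (\<exists>(v, u)\<in>pS H. \<exists>z\<in>set (P u). {x, y} = {\<phi> v, z}) \<or>
    (\<exists>u u'. {u, u'} \<in> pR H \<and> (\<exists>a\<in>set (P u). \<exists>b\<in>set (P u'). {x, y} = {a, b}))" (is "_ \<longleftrightarrow> ?edge x y")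
proof
  have linked_edge: "?edge x y" if "linked H en \<phi> P x y" for x y
    using that
  proof cases
    case (edge v w)
    then have "{x, y} = \<phi> ` {v, w}" by simp
    then show ?thesis using edge(3) by blast
  next
    case (path u)
    then show ?thesis unfolding path_edges_conv_consecutive by blast
  qed blast+
  assume "linked H en \<phi> P x y \<or> linked H en \<phi> P y x"
  then show "?edge x y" using linked_edge[of x y] linked_edge[of y x] unfolding insert_commute[of y x "{}"]
    by (rule disjE)
next
  assume "?edge x y"
  then show "linked H en \<phi> P x y \<or> linked H en \<phi> P y x"
  proof (elim disjE)
    assume "\<exists>e\<in>pE H. {x, y} = \<phi> ` e"
    then obtain v w where "{v, w} \<in> pE H" "{x, y} = {\<phi> v, \<phi> w}"
      using wf_pathograph_edge(2)[OF wf] by (metis card_2_iff image_empty image_insert)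
    then show ?thesis using linked.edge by (metis doubleton_eq_iff)
  next
    assume "\<exists>u\<in>pU H. {x, y} \<in> path_edges (urpath en \<phi> P u)"
    then obtain u x' y' where u: "u \<in> pU H" "{x, y} = {x', y'}" "consecutive (urpath en \<phi> P u) x' y'"
      unfolding path_edges_conv_consecutive by blast
    then show ?thesis using linked.path[OF u(1)] by (metis doubleton_eq_iff)
  next
    assume "\<exists>(v, u)\<in>pS H. \<exists>z\<in>set (P u). {x, y} = {\<phi> v, z}"
    then show ?thesis by (fastforce simp: doubleton_eq_iff intro: linked.spoke)
  next
    assume "\<exists>u u'. {u, u'} \<in> pR H \<and> (\<exists>a\<in>set (P u). \<exists>b\<in>set (P u'). {x, y} = {a, b})"
    then show ?thesis by (fastforce simp: doubleton_eq_iff intro: linked.rung)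
  qed
qed

lemma realizes_transport:
  assumes "realizes H en W B \<phi> P" and wf: "wf_pathograph H" "orients en H"
    and "placement H X \<psi> Q" "\<And>u. u \<in> pU H \<Longrightarrow> length (P u) = length (Q u)"
  obtains f where "bij_betw f X W" "realizes H en X (\<lambda>x y. x \<in> X \<and> y \<in> X \<and> B (f x) (f y)) \<psi> Q"
proof -
  interpret realizes H en W B \<phi> P by (rule assms)
  obtain g where g: "bij_betw g W X" and vertex: "\<And>v. v \<in> pV H \<Longrightarrow> g (\<phi> v) = \<psi> v"
    and path: "\<And>u. u \<in> pU H \<Longrightarrow> map g (P u) = Q u"
    using placement_bij_betw[OF placement_axioms assms(4,5)] by blast
  define f where "f = the_inv_into W g"
  have f: "bij_betw f X W" unfolding f_def using g by (rule bij_betw_the_inv_into)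
  have f_g: "f (g x) = x" and g_mem: "g x \<in> X" if "x \<in> W" for x
    using g that by (auto simp: f_def bij_betw_def the_inv_into_f_f)
  have "realizes H en (g ` W) (\<lambda>x y. x \<in> X \<and> y \<in> X \<and> B (f x) (f y)) (g \<circ> \<phi>) (map g \<circ> P)"
    by (rule realizes_image[OF assms(1) wf]) (use g f_g g_mem in \<open>auto simp: bij_betw_def\<close>)
  then have "realizes H en X (\<lambda>x y. x \<in> X \<and> y \<in> X \<and> B (f x) (f y)) \<psi> Q"
    unfolding bij_betw_imp_surj_on[OF g] using wf by (rule realizes_cong) (simp_all add: vertex path)
  with f show thesis by (rule that)
qed

lemma realizes_imp_realization:
  assumes "realizes H en W (\<lambda>x y. {x, y} \<in> EG) \<phi> P" and wf: "wf_pathograph H" "orients en H"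
    and "finite W" and EG: "EG \<subseteq> {e. e \<subseteq> W \<and> card e = 2}"
  shows "realization H W EG"
proof -
  interpret realizes H en W "\<lambda>x y. {x, y} \<in> EG" \<phi> P by (rule assms)
  have edge_doubleton: "\<exists>v w. e = {v, w}" if "e \<in> pE H" for e
    using wf_pathograph_edge(2)[OF wf(1) that] by (auto simp: card_2_iff)
  show ?thesis
    unfolding realization_def urpath_def[symmetric]
  proof (intro conjI exI[of _ \<phi>] exI[of _ P] exI[of _ en])
    show "\<forall>u\<in>pU H. {fst (en u), snd (en u)} = ppi H u" using wf(2) by (simp add: orients_def)
    show "\<forall>u\<in>pU H. P u \<noteq> [] \<and> distinct (P u) \<and> set (P u) \<inter> \<phi> ` pV H = {}"
      using path_nonempty path_distinct path_internal by blast
    show "\<forall>u\<in>pU H. \<forall>u'\<in>pU H. u \<noteq> u' \<longrightarrow> set (P u) \<inter> set (P u') = {}" using paths_disjoint by blast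
    show "\<forall>e\<in>pE H. \<phi> ` e \<in> EG" using edges edge_doubleton by fastforce
    show "\<forall>u\<in>pU H. path_edges (urpath en \<phi> P u) \<subseteq> EG"
      using paths by (simp add: path_edges_subset_iff)
    show "\<forall>(v, u)\<in>pS H. \<exists>x\<in>set (P u). {\<phi> v, x} \<in> EG" using spokes by blast
    show "\<forall>u u'. {u, u'} \<in> pR H \<longrightarrow> (\<exists>x\<in>set (P u). \<exists>y\<in>set (P u'). {x, y} \<in> EG)" using rungs by blast
    show "\<forall>e\<in>EG. (\<exists>e'\<in>pE H. e = \<phi> ` e') \<or> (\<exists>u\<in>pU H. e \<in> path_edges (urpath en \<phi> P u)) \<or>
           (\<exists>(v, u)\<in>pS H. \<exists>x\<in>set (P u). e = {\<phi> v, x}) \<or>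
           (\<exists>u u'. {u, u'} \<in> pR H \<and> (\<exists>x\<in>set (P u). \<exists>y\<in>set (P u'). e = {x, y}))" (is "\<forall>e\<in>EG. ?edge e")
    proof
      fix e assume "e \<in> EG"
      then obtain x y where e: "e = {x, y}" "x \<in> W" "y \<in> W" "{x, y} \<in> EG"
        using EG by (auto simp: card_2_iff)
      from adj_linked[OF e(2-4)] show "?edge e" unfolding linked_doubleton_iff[OF wf(1)] e(1) .
    qed
  qed (use assms inj carrier in auto)
qed

lemma path_edges_urpath_reorient:
  assumes "{fst (en u), snd (en u)} = {fst (en' u), snd (en' u)}"
    and "P u = (if en u = en' u then P' u else rev (P' u))"
  shows "path_edges (urpath en \<phi> P u) = path_edges (urpath en' \<phi> P' u)"
proof (cases "en u = en' u")
  case False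
  then have "fst (en u) = snd (en' u)" "snd (en u) = fst (en' u)"
    using assms(1) by (auto simp: doubleton_eq_iff prod_eq_iff)
  then have "urpath en \<phi> P u = rev (urpath en' \<phi> P' u)"
    using False assms(2) by (simp add: urpath_def)
  then show ?thesis by (simp add: path_edges_rev)
qed (use assms in \<open>simp add: urpath_def\<close>)

lemma realization_imp_realizes:
  assumes "realization H W EG" and wf: "wf_pathograph H" "orients en H"
  obtains \<phi> P where "realizes H en W (\<lambda>x y. {x, y} \<in> EG) \<phi> P"
proof -
  obtain \<phi> P' en' where inj: "inj_on \<phi> (pV H)"
    and en': "\<forall>u\<in>pU H. {fst (en' u), snd (en' u)} = ppi H u"
    and P': "\<forall>u\<in>pU H. P' u \<noteq> [] \<and> distinct (P' u) \<and> set (P' u) \<inter> \<phi> ` pV H = {}"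
    and disjoint: "\<forall>u\<in>pU H. \<forall>u'\<in>pU H. u \<noteq> u' \<longrightarrow> set (P' u) \<inter> set (P' u') = {}"
    and carrier: "W = \<phi> ` pV H \<union> (\<Union>u\<in>pU H. set (P' u))"
    and edges: "\<forall>e\<in>pE H. \<phi> ` e \<in> EG"
    and paths: "\<forall>u\<in>pU H. path_edges (urpath en' \<phi> P' u) \<subseteq> EG"
    and spokes: "\<forall>(v, u)\<in>pS H. \<exists>x\<in>set (P' u). {\<phi> v, x} \<in> EG"
    and rungs: "\<forall>u u'. {u, u'} \<in> pR H \<longrightarrow> (\<exists>x\<in>set (P' u). \<exists>y\<in>set (P' u'). {x, y} \<in> EG)"
    and only: "\<forall>e\<in>EG. (\<exists>e'\<in>pE H. e = \<phi> ` e') \<or> (\<exists>u\<in>pU H. e \<in> path_edges (urpath en' \<phi> P' u)) \<or>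
      (\<exists>(v, u)\<in>pS H. \<exists>x\<in>set (P' u). e = {\<phi> v, x}) \<or>
      (\<exists>u u'. {u, u'} \<in> pR H \<and> (\<exists>x\<in>set (P' u). \<exists>y\<in>set (P' u'). e = {x, y}))"
    using assms(1) unfolding realization_def urpath_def[symmetric] by (elim conjE exE) (rule that)
  define P where "P = (\<lambda>u. if en u = en' u then P' u else rev (P' u))"
  have set_P: "set (P u) = set (P' u)" for u by (simp add: P_def)
  have path_edges: "path_edges (urpath en \<phi> P u) = path_edges (urpath en' \<phi> P' u)" if "u \<in> pU H" for u
    by (rule path_edges_urpath_reorient) (use that en' wf(2) in \<open>simp_all add: P_def orients_def\<close>)
  have "realizes H en W (\<lambda>x y. {x, y} \<in> EG) \<phi> P"
  proof
    show "P u \<noteq> []" "distinct (P u)" if "u \<in> pU H" for u using P' that by (auto simp: P_def)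
    show "{\<phi> v, \<phi> w} \<in> EG" if "{v, w} \<in> pE H" for v w using edges that by fastforce
    show "successively (\<lambda>x y. {x, y} \<in> EG) (urpath en \<phi> P u)" if "u \<in> pU H" for u
      using paths path_edges that by (simp add: path_edges_subset_iff[symmetric])
    show "linked H en \<phi> P x y \<or> linked H en \<phi> P y x" if "{x, y} \<in> EG" for x y
      using only[rule_format, OF that] path_edges unfolding linked_doubleton_iff[OF wf(1)] set_P
      by (simp cong: bex_cong)
  qed (use inj P' disjoint carrier spokes rungs in \<open>auto simp: set_P\<close>)
  then show thesis by (rule that)
qed

text \<open>Realizations have natural numbers as vertices; drawings transfer them to adjacency relations on any
  type.\<close>

locale drawing =
  fixes X :: "'a set" and A :: "'a \<Rightarrow> 'a \<Rightarrow> bool" and f :: "'a \<Rightarrow> nat" and W :: "nat set" and EG :: "nat set set"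
  assumes finite: "finite X" and sym: "A x y \<Longrightarrow> A y x" and irrefl: "\<not> A x x"
    and inj_f: "inj_on f X" and image_f: "W = f ` X"
    and edges_f: "EG = {{f x, f y} | x y. x \<in> X \<and> y \<in> X \<and> A x y}"
begin

lemma edge_iff:
  assumes "x \<in> X" "y \<in> X" shows "{f x, f y} \<in> EG \<longleftrightarrow> A x y"
proof
  assume "{f x, f y} \<in> EG"
  then obtain x' y' where "{f x, f y} = {f x', f y'}" "x' \<in> X" "y' \<in> X" "A x' y'"
    unfolding edges_f by blast
  then show "A x y" using inj_onD[OF inj_f] assms sym by (metis doubleton_eq_iff)
qed (use assms edges_f in blast)

lemma edges_subset: "EG \<subseteq> {e. e \<subseteq> W \<and> card e = 2}"
proof
  fix e assume "e \<in> EG"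
  then obtain x y where e: "e = {f x, f y}" "x \<in> X" "y \<in> X" "A x y" unfolding edges_f by blast
  then have "f x \<noteq> f y" using irrefl inj_onD[OF inj_f] by blast
  then show "e \<in> {e. e \<subseteq> W \<and> card e = 2}" using e image_f by auto
qed

lemma drawing_induced: "Y \<subseteq> X \<Longrightarrow> drawing Y A f (f ` Y) {e \<in> EG. e \<subseteq> f ` Y}"
proof
  assume Y: "Y \<subseteq> X"
  show "finite Y" using Y finite by (rule finite_subset)
  show "inj_on f Y" using inj_f Y by (rule inj_on_subset)
  show "{e \<in> EG. e \<subseteq> f ` Y} = {{f x, f y} | x y. x \<in> Y \<and> y \<in> Y \<and> A x y}"
  proof (intro set_eqI iffI)
    fix e assume "e \<in> {e \<in> EG. e \<subseteq> f ` Y}"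
    then obtain x y where xy: "e = {f x, f y}" "x \<in> X" "y \<in> X" "A x y" "f x \<in> f ` Y" "f y \<in> f ` Y"
      unfolding edges_f by auto
    then have "x \<in> Y" "y \<in> Y" using inj_on_image_mem_iff[OF inj_f _ Y] by blast+
    with xy show "e \<in> {{f x, f y} | x y. x \<in> Y \<and> y \<in> Y \<and> A x y}" by blast
  qed (use Y edges_f in auto)
qed (use sym irrefl in auto)

theorem realization_iff_realizes:
  assumes wf: "wf_pathograph H" "orients en H"
  shows "realization H W EG \<longleftrightarrow> (\<exists>\<phi> P. realizes H en X A \<phi> P)"
proof
  assume "realization H W EG"
  then obtain \<phi> P where "realizes H en W (\<lambda>x y. {x, y} \<in> EG) \<phi> P"
    using wf by (rule realization_imp_realizes)
  moreover have "inj_on (the_inv_into X f) W" unfolding image_f by (rule inj_on_the_inv_into[OF inj_f])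
  moreover have "A (the_inv_into X f x) (the_inv_into X f y) \<longleftrightarrow> {x, y} \<in> EG" if "x \<in> W" "y \<in> W" for x y
    using that edge_iff unfolding image_f by (auto simp: the_inv_into_f_f[OF inj_f])
  ultimately have "realizes H en (the_inv_into X f ` W) A (the_inv_into X f \<circ> \<phi>) (map (the_inv_into X f) \<circ> P)"
    using wf by (intro realizes_image)
  moreover have "the_inv_into X f ` W = X"
    unfolding image_f by (force simp: the_inv_into_f_f[OF inj_f] image_iff)
  ultimately show "\<exists>\<phi> P. realizes H en X A \<phi> P" by auto
next
  assume "\<exists>\<phi> P. realizes H en X A \<phi> P"
  then obtain \<phi> P where "realizes H en X A \<phi> P" by blast
  then have "realizes H en W (\<lambda>x y. {x, y} \<in> EG) (f \<circ> \<phi>) (map f \<circ> P)"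
    unfolding image_f using wf inj_f edge_iff by (rule realizes_image)
  then show "realization H W EG"
    by (rule realizes_imp_realization) (use wf finite image_f edges_subset in auto)
qed

theorem contains_pg_iff_realizes:
  assumes wf: "wf_pathograph H" "orients en H"
  shows "contains_pg W EG H \<longleftrightarrow> (\<exists>Y\<subseteq>X. \<exists>\<phi> P. realizes H en Y A \<phi> P)"
proof -
  have "W' \<subseteq> f ` X \<longleftrightarrow> (\<exists>Y\<subseteq>X. W' = f ` Y)" for W' by (rule subset_image_iff)
  then have "contains_pg W EG H \<longleftrightarrow> (\<exists>Y\<subseteq>X. realization H (f ` Y) {e \<in> EG. e \<subseteq> f ` Y})"
    unfolding contains_pg_def image_f by (simp only:) blast
  moreover have "realization H (f ` Y) {e \<in> EG. e \<subseteq> f ` Y} \<longleftrightarrow> (\<exists>\<phi> P. realizes H en Y A \<phi> P)"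
    if "Y \<subseteq> X" for Y
    using drawing.realization_iff_realizes[OF drawing_induced[OF that] wf] .
  ultimately show ?thesis by auto
qed

end

lemma ex_drawing:
  fixes X :: "'a set"
  assumes "finite X" "\<And>x y. A x y \<Longrightarrow> A y x" "\<And>x. \<not> A x x"
  obtains f W EG where "drawing X A f W EG"
proof -
  obtain f :: "'a \<Rightarrow> nat" where "inj_on f X" using finite_imp_inj_to_nat_seg[OF assms(1)] by blast
  then have "drawing X A f (f ` X) {{f x, f y} | x y. x \<in> X \<and> y \<in> X \<and> A x y}"
    by unfold_locales (use assms in auto)
  then show thesis by (rule that)
qed

lemma drawing_pullback:
  assumes "finite W" and EG: "EG \<subseteq> {e. e \<subseteq> W \<and> card e = 2}" and f: "bij_betw f X W"
  shows "drawing X (\<lambda>x y. x \<in> X \<and> y \<in> X \<and> {f x, f y} \<in> EG) f W EG"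
proof
  have W: "W = f ` X" using f by (simp add: bij_betw_def)
  show "EG = {{f x, f y} | x y. x \<in> X \<and> y \<in> X \<and> x \<in> X \<and> y \<in> X \<and> {f x, f y} \<in> EG}"
  proof (intro set_eqI iffI)
    fix e assume "e \<in> EG"
    then obtain x y where "e = {x, y}" "x \<in> W" "y \<in> W" using EG by (force simp: card_2_iff)
    then show "e \<in> {{f x, f y} | x y. x \<in> X \<and> y \<in> X \<and> x \<in> X \<and> y \<in> X \<and> {f x, f y} \<in> EG}"
      using \<open>e \<in> EG\<close> unfolding W by blast
  qed auto
qed (use assms bij_betw_finite[OF f] in \<open>auto simp: bij_betw_def insert_commute\<close>)

lemma realizes_plain_iff:
  assumes wf: "wf_pathograph H" and U: "pU H = {}" and sym: "\<And>x y. A x y \<Longrightarrow> A y x"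
  shows "realizes H en X A \<phi> P \<longleftrightarrow> inj_on \<phi> (pV H) \<and> X = \<phi> ` pV H \<and>
    (\<forall>v\<in>pV H. \<forall>w\<in>pV H. {v, w} \<in> pE H \<longleftrightarrow> A (\<phi> v) (\<phi> w))" (is "_ \<longleftrightarrow> ?R")
proof
  assume "realizes H en X A \<phi> P"
  then interpret realizes H en X A \<phi> P .
  show ?R using inj carrier explicit_adj_iff[OF wf] U by (simp add: orients_def)
next
  have "(v, u) \<notin> pS H" "{u, u'} \<notin> pR H" for v u u'
    using wf_pathograph_spoke(2)[OF wf] wf_pathograph_rung(1)[OF wf] U by blast+
  moreover assume ?R
  moreover from this have "A (\<phi> v) (\<phi> w)" if "{v, w} \<in> pE H" for v w
    using wf_pathograph_edge(1)[OF wf that] that by blast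
  ultimately show "realizes H en X A \<phi> P"
    by unfold_locales (use U in \<open>auto intro: linked.edge\<close>)
qed

lemma (in drawing) contains_plain_pg_iff:
  assumes wf: "wf_pathograph H" and U: "pU H = {}"
  shows "contains_pg W EG H \<longleftrightarrow> (\<exists>\<phi>. inj_on \<phi> (pV H) \<and> \<phi> ` pV H \<subseteq> X \<and>
    (\<forall>v\<in>pV H. \<forall>w\<in>pV H. {v, w} \<in> pE H \<longleftrightarrow> A (\<phi> v) (\<phi> w)))"
proof -
  have orients: "orients (\<lambda>_. (0, 0)) H" using U by (simp add: orients_def)
  have plain: "realizes H (\<lambda>_. (0, 0)) Y A \<phi> P \<longleftrightarrow> inj_on \<phi> (pV H) \<and> Y = \<phi> ` pV H \<and>
      (\<forall>v\<in>pV H. \<forall>w\<in>pV H. {v, w} \<in> pE H \<longleftrightarrow> A (\<phi> v) (\<phi> w))" for Y \<phi> P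
    using wf U by (rule realizes_plain_iff) (rule sym)
  show ?thesis
    unfolding contains_pg_iff_realizes[OF wf orients]
  proof
    assume "\<exists>Y\<subseteq>X. \<exists>\<phi> P. realizes H (\<lambda>_. (0, 0)) Y A \<phi> P"
    then obtain Y \<phi> P where "Y \<subseteq> X" "realizes H (\<lambda>_. (0, 0)) Y A \<phi> P" by blast
    then show "\<exists>\<phi>. inj_on \<phi> (pV H) \<and> \<phi> ` pV H \<subseteq> X \<and>
        (\<forall>v\<in>pV H. \<forall>w\<in>pV H. {v, w} \<in> pE H \<longleftrightarrow> A (\<phi> v) (\<phi> w))"
      unfolding plain by auto
  next
    assume "\<exists>\<phi>. inj_on \<phi> (pV H) \<and> \<phi> ` pV H \<subseteq> X \<and>
        (\<forall>v\<in>pV H. \<forall>w\<in>pV H. {v, w} \<in> pE H \<longleftrightarrow> A (\<phi> v) (\<phi> w))"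
    then obtain \<phi> where "realizes H (\<lambda>_. (0, 0)) (\<phi> ` pV H) A \<phi> (\<lambda>_. [])" "\<phi> ` pV H \<subseteq> X"
      unfolding plain by blast
    then show "\<exists>Y\<subseteq>X. \<exists>\<phi> P. realizes H (\<lambda>_. (0, 0)) Y A \<phi> P" by blast
  qed
qed

definition bounded_pathographs :: "nat \<Rightarrow> pathograph set" where
  "bounded_pathographs N = {F. wf_pathograph F \<and> pV F \<subseteq> {..<N} \<and> pU F \<subseteq> {..<N} \<and> (\<forall>u. u \<notin> pU F \<longrightarrow>
      ppi F u = {})}"

lemma finite_bounded_pathographs: "finite (bounded_pathographs N)"
proof -
  let ?t = "\<lambda>F :: pathograph. (pV F, pU F, pE F, pS F, pR F, ppi F)" and ?P = "Pow {..<N}"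
  let ?endpoints = "{e. \<forall>u. (u \<in> {..<N} \<longrightarrow> e u \<in> ?P) \<and> (u \<notin> {..<N} \<longrightarrow> e u = {})}"
  have "inj_on ?t (bounded_pathographs N)"
    by (rule inj_onI) (auto intro: pathograph.equality)
  moreover have "?t ` bounded_pathographs N \<subseteq>
      ?P \<times> ?P \<times> Pow ?P \<times> Pow ({..<N} \<times> {..<N}) \<times> Pow ?P \<times> ?endpoints"
  proof (rule image_subsetI)
    fix F assume "F \<in> bounded_pathographs N"
    then have wf: "wf_pathograph F" and V: "pV F \<subseteq> {..<N}" and U: "pU F \<subseteq> {..<N}"
      and ends: "\<And>u. u \<notin> pU F \<Longrightarrow> ppi F u = {}" by (auto simp: bounded_pathographs_def)
    have "pE F \<subseteq> Pow (pV F)" "pS F \<subseteq> pV F \<times> pU F" "pR F \<subseteq> Pow (pU F)"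
      using wf by (auto simp: wf_pathograph_def)
    moreover have "ppi F u \<subseteq> {..<N}" "u \<notin> {..<N} \<Longrightarrow> ppi F u = {}" for u
      using ends[of u] wf_pathograph_ends[OF wf, of u] V U by blast+
    ultimately show "?t F \<in> ?P \<times> ?P \<times> Pow ?P \<times> Pow ({..<N} \<times> {..<N}) \<times> Pow ?P \<times> ?endpoints"
      using V U by auto blast+
  qed
  moreover have "finite (?P \<times> ?P \<times> Pow ?P \<times> Pow ({..<N} \<times> {..<N}) \<times> Pow ?P \<times> ?endpoints)"
    by (intro finite_cartesian_product finite_Pow_iff[THEN iffD2] finite_set_of_finite_funs finite_lessThan)
  ultimately show ?thesis using finite_imageD finite_subset by blast
qed

subsection \<open>Graphs carrying computations\<close>

datatype vert = Root nat | Point nat nat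

context machine
begin

text \<open>The roots below \<open>clique_size\<close> form a clique whose vertices serve as labels; the remaining roots are
  independent, the \<open>j\<close>-th one being joined to the clique vertices \<open>0, \<dots>, j + 3\<close>.  Line \<open>0\<close> is the
  time line, line \<open>Suc i\<close> the line of values of counter \<open>i\<close>.\<close>

definition clique_size :: nat where "clique_size = 3 * k + m + 10"
definition root_count :: nat where "root_count = 2 * clique_size - 5"
definition index_root :: "nat \<Rightarrow> nat \<Rightarrow> nat" where "index_root i r = 4 + 3 * i + r"
definition state_root :: "nat \<Rightarrow> nat" where "state_root s = 3 * k + 7 + s"
definition halted_root :: nat where "halted_root = 3 * k + 7 + m"
definition start_root :: "nat \<Rightarrow> nat" where "start_root i = clique_size + 2 * i"
definition end_root :: "nat \<Rightarrow> nat" where "end_root i = clique_size + 2 * i + 1"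

definition root_adj :: "nat \<Rightarrow> nat \<Rightarrow> bool" where
  "root_adj x y \<longleftrightarrow> x \<noteq> y \<and> (x < clique_size \<and> y < clique_size \<or>
     x < clique_size \<and> clique_size \<le> y \<and> x + clique_size \<le> y + 3 \<or>
     y < clique_size \<and> clique_size \<le> x \<and> y + clique_size \<le> x + 3)"

definition label_of :: "nat \<Rightarrow> nat \<Rightarrow> bool" where
  "label_of i x \<longleftrightarrow> (\<exists>r<3. x = index_root i r) \<or> i = 0 \<and> ((\<exists>s<m. x = state_root s) \<or> x = halted_root)"

definition rigid_root :: "nat \<Rightarrow> bool" where
  "rigid_root x \<longleftrightarrow> 4 \<le> x \<and> x + 3 \<le> clique_size \<or> clique_size \<le> x \<and> x < root_count"

definition verts :: "(nat \<Rightarrow> nat) \<Rightarrow> vert set" where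
  "verts len = Root ` {..<root_count} \<union> {Point i j | i j. i \<le> k \<and> j < len i}"

lemma Root_verts [simp]: "Root x \<in> verts len \<longleftrightarrow> x < root_count"
  and Point_verts [simp]: "Point i j \<in> verts len \<longleftrightarrow> i \<le> k \<and> j < len i"
  by (auto simp: verts_def)

lemma finite_verts: "finite (verts len)"
proof -
  have "{Point i j | i j. i \<le> k \<and> j < len i} = (\<lambda>(i, j). Point i j) ` (SIGMA i:{..k}. {..<len i})"
    by auto
  then show ?thesis by (simp add: verts_def)
qed

lemma clique_size_root_count:
  "clique_size < root_count" "root_count = clique_size + (clique_size - 5)" "13 \<le> clique_size"
  using k_pos s0_less by (auto simp: clique_size_def root_count_def)

lemma root_adj_sym: "root_adj x y \<longleftrightarrow> root_adj y x"
  by (auto simp: root_adj_def)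

lemma root_adj_irrefl: "\<not> root_adj x x"
  by (simp add: root_adj_def)

lemma label_of_range: "label_of i x \<Longrightarrow> i \<le> k \<Longrightarrow> 4 \<le> x \<and> x + 3 \<le> clique_size"
  by (auto simp: label_of_def index_root_def state_root_def halted_root_def clique_size_def)

lemma label_of_less: "label_of i x \<Longrightarrow> i \<le> k \<Longrightarrow> x < clique_size"
  using label_of_range[of i x] by auto

lemma label_of_unique: "label_of i x \<Longrightarrow> label_of i' x \<Longrightarrow> i \<le> k \<Longrightarrow> i' \<le> k \<Longrightarrow> i = i'"
  by (auto simp: label_of_def index_root_def state_root_def halted_root_def)

lemma label_of_index_root: "r < 3 \<Longrightarrow> label_of i (index_root i r)"
  and label_of_state_root: "s < m \<Longrightarrow> label_of 0 (state_root s)"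
  and label_of_halted_root: "label_of 0 halted_root"
  by (auto simp: label_of_def)

lemma index_root_less: "i \<le> k \<Longrightarrow> r < 3 \<Longrightarrow> index_root i r < clique_size"
  using label_of_less label_of_index_root by blast

lemma index_root_less_root_count: "i \<le> k \<Longrightarrow> r < 3 \<Longrightarrow> index_root i r < root_count"
  using index_root_less clique_size_root_count(1) by (meson less_trans)

lemma index_root_eq_iff: "r < 3 \<Longrightarrow> r' < 3 \<Longrightarrow> index_root i r = index_root i' r' \<longleftrightarrow> i = i' \<and> r = r'"
  unfolding index_root_def by presburger

lemma start_root_less: "i \<le> k \<Longrightarrow> start_root i < root_count"
  and end_root_less: "i \<le> k \<Longrightarrow> end_root i < root_count"
  by (auto simp: start_root_def end_root_def root_count_def clique_size_def)

lemma start_root_ge: "clique_size \<le> start_root i" and end_root_ge: "clique_size \<le> end_root i"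
  by (auto simp: start_root_def end_root_def)

lemma start_root_eq_iff [simp]: "start_root i = start_root i' \<longleftrightarrow> i = i'"
  and end_root_eq_iff [simp]: "end_root i = end_root i' \<longleftrightarrow> i = i'"
  by (auto simp: start_root_def end_root_def)

lemma start_root_neq_end_root: "start_root i \<noteq> end_root i'"
  unfolding start_root_def end_root_def by presburger

lemma label_of_neq:
  assumes "label_of i x" "i \<le> k" shows "x \<noteq> start_root i'" "x \<noteq> end_root i'"
  using label_of_less[OF assms] start_root_ge[of i'] end_root_ge[of i'] by auto

lemma rigid_root_start_root: "i \<le> k \<Longrightarrow> rigid_root (start_root i)"
  and rigid_root_end_root: "i \<le> k \<Longrightarrow> rigid_root (end_root i)"
  and rigid_root_label: "label_of i x \<Longrightarrow> i \<le> k \<Longrightarrow> rigid_root x"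
  and rigid_root_less: "rigid_root x \<Longrightarrow> x < root_count"
  using start_root_less[of i] end_root_less[of i] start_root_ge end_root_ge label_of_range
    clique_size_root_count
  by (auto simp: rigid_root_def)

lemma independent_neighbours:
  assumes "clique_size \<le> y" "y < root_count"
  shows "{x. x < clique_size \<and> root_adj x y} = {..<y - clique_size + 4}"
  using assms clique_size_root_count by (auto simp: root_adj_def)

lemma root_eqI:
  assumes x: "4 \<le> x" "x + 3 \<le> clique_size" and x': "x' < clique_size"
    and eq: "\<And>y. clique_size \<le> y \<Longrightarrow> y < root_count \<Longrightarrow> root_adj x y \<longleftrightarrow> root_adj x' y"
  shows "x = x'"
proof (rule ccontr)
  assume "x \<noteq> x'"
  then consider "x < x'" | "x' < x" "3 \<le> x'" | "x' < 3" by linarith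
  then obtain y where "clique_size \<le> y" "y < root_count" "root_adj x y \<noteq> root_adj x' y"
  proof cases
    case 1
    then show ?thesis
      using that[of "x + clique_size - 3"] x x' clique_size_root_count(2,3) by (auto simp: root_adj_def)
  next
    case 2
    then show ?thesis
      using that[of "x' + clique_size - 3"] x x' clique_size_root_count(2,3) by (auto simp: root_adj_def)
  next
    case 3
    then show ?thesis
      using that[of clique_size] x x' clique_size_root_count by (auto simp: root_adj_def)
  qed
  then show False using eq by blast
qed

end

locale layout = machine +
  fixes len :: "nat \<Rightarrow> nat" and A :: "vert \<Rightarrow> vert \<Rightarrow> bool"
  assumes adj_sym: "A u w \<Longrightarrow> A w u" and adj_irrefl: "\<not> A u u"
    and adj_root: "x < root_count \<Longrightarrow> y < root_count \<Longrightarrow> A (Root x) (Root y) \<longleftrightarrow> root_adj x y"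
    and adj_line: "i \<le> k \<Longrightarrow> j < len i \<Longrightarrow> j' < len i
      \<Longrightarrow> A (Point i j) (Point i j') \<longleftrightarrow> j' = Suc j \<or> j = Suc j'"
    and adj_value_lines: "0 < i \<Longrightarrow> 0 < i' \<Longrightarrow> i \<noteq> i' \<Longrightarrow> i \<le> k \<Longrightarrow> i' \<le> k \<Longrightarrow> j < len i \<Longrightarrow> j' < len i'
      \<Longrightarrow> \<not> A (Point i j) (Point i' j')"
    and adj_start: "i \<le> k \<Longrightarrow> A (Root (start_root i)) (Point i 0)"
    and adj_end: "i \<le> k \<Longrightarrow> A (Root (end_root i)) (Point i (len i - 1))"
    and adj_root_point: "x < root_count \<Longrightarrow> i \<le> k \<Longrightarrow> j < len i \<Longrightarrow> A (Root x) (Point i j)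
      \<Longrightarrow> x = start_root i \<and> j = 0 \<or> x = end_root i \<and> Suc j = len i \<or> label_of i x"
    and len_pos: "i \<le> k \<Longrightarrow> 0 < len i"
    and index_root_used: "i \<le> k \<Longrightarrow> r < 3 \<Longrightarrow> \<exists>j<len i. A (Root (index_root i r)) (Point i j)"
begin

lemma adj_start_iff:
  assumes "i' \<le> k" "i \<le> k" "j < len i"
  shows "A (Root (start_root i')) (Point i j) \<longleftrightarrow> i = i' \<and> j = 0"
  using adj_root_point[OF start_root_less[OF assms(1)] assms(2,3)] adj_start[OF assms(2)]
    start_root_neq_end_root[of i' i] label_of_neq[OF _ assms(2)] by auto

lemma adj_end_iff:
  assumes "i' \<le> k" "i \<le> k" "j < len i"
  shows "A (Root (end_root i')) (Point i j) \<longleftrightarrow> i = i' \<and> Suc j = len i"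
proof
  assume "A (Root (end_root i')) (Point i j)"
  then show "i = i' \<and> Suc j = len i"
    using adj_root_point[OF end_root_less[OF assms(1)] assms(2,3)]
      start_root_neq_end_root[of i i'] label_of_neq[OF _ assms(2)] by auto
next
  assume "i = i' \<and> Suc j = len i"
  then show "A (Root (end_root i')) (Point i j)" using adj_end[OF assms(1)] by (metis diff_Suc_1)
qed

lemma adj_label:
  assumes "label_of i' x" "i' \<le> k" "i \<le> k" "j < len i" "A (Root x) (Point i j)" shows "i = i'"
proof -
  have "x < root_count" using label_of_less[OF assms(1,2)] clique_size_root_count(1) by simp
  then have "label_of i x"
    using adj_root_point[OF _ assms(3-5)] label_of_neq[OF assms(1,2)] by blast
  then show ?thesis using label_of_unique assms(1-3) by blast
qed

lemma line_clique:
  assumes clique: "\<And>u w. u \<in> C \<Longrightarrow> w \<in> C \<Longrightarrow> u \<noteq> w \<Longrightarrow> A u w" and C: "C \<subseteq> verts len"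
  obtains n where "\<And>j. Point i j \<in> C \<Longrightarrow> j = n \<or> j = Suc n"
proof (cases "\<exists>j. Point i j \<in> C")
  case True
  define n where "n = (LEAST j. Point i j \<in> C)"
  have n: "Point i n \<in> C" unfolding n_def using True by (rule LeastI_ex)
  have "j = n \<or> j = Suc n" if j: "Point i j \<in> C" for j
  proof (cases "j = n")
    case False
    then have "A (Point i n) (Point i j)" using clique n j by blast
    moreover have "n \<le> j" unfolding n_def using j by (rule Least_le)
    moreover have "Point i n \<in> verts len" "Point i j \<in> verts len" using C n j by auto
    ultimately show ?thesis using adj_line[of i n j] by auto
  qed simp
  then show thesis by (rule that)
qed (use that in blast)

lemma clique_points:
  assumes clique: "\<And>u w. u \<in> C \<Longrightarrow> w \<in> C \<Longrightarrow> u \<noteq> w \<Longrightarrow> A u w" and C: "C \<subseteq> verts len"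
  obtains n0 i1 n1 where
    "\<And>i j. Point i j \<in> C \<Longrightarrow> Point i j \<in> {Point 0 n0, Point 0 (Suc n0), Point i1 n1, Point i1 (Suc n1)}"
proof -
  have same_line: "i = i'" if "Point i j \<in> C" "Point i' j' \<in> C" "0 < i" "0 < i'" for i i' j j'
  proof (rule ccontr)
    assume "i \<noteq> i'"
    moreover have "Point i j \<in> verts len" "Point i' j' \<in> verts len" using that C by auto
    ultimately show False using clique[OF that(1,2)] adj_value_lines[of i i' j j'] that(3,4) by auto
  qed
  then obtain i1 where i1: "\<And>i j. Point i j \<in> C \<Longrightarrow> i = 0 \<or> i = i1" by (metis gr0I)
  obtain n0 where n0: "\<And>j. Point 0 j \<in> C \<Longrightarrow> j = n0 \<or> j = Suc n0"
    using line_clique[OF clique C] by blast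
  obtain n1 where n1: "\<And>j. Point i1 j \<in> C \<Longrightarrow> j = n1 \<or> j = Suc n1"
    using line_clique[OF clique C] by blast
  show thesis by (rule that[of n0 i1 n1]) (use i1 n0 n1 in blast)
qed

end

locale labelled_layout = layout +
  fixes st :: "nat \<Rightarrow> nat" and val :: "nat \<Rightarrow> nat \<Rightarrow> nat"
  assumes st_less: "t < len 0 \<Longrightarrow> st t < m"
    and val_less: "t < len 0 \<Longrightarrow> i < k \<Longrightarrow> Suc (val t i) < len (Suc i)"
    and adj_index: "i \<le> k \<Longrightarrow> j < len i \<Longrightarrow> r < 3 \<Longrightarrow> A (Root (index_root i r)) (Point i j) \<longleftrightarrow> r = j mod 3"
    and adj_state: "t < len 0 \<Longrightarrow> s < m \<Longrightarrow> A (Root (state_root s)) (Point 0 t) \<longleftrightarrow> s = st t"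
    and adj_value: "t < len 0 \<Longrightarrow> i < k \<Longrightarrow> j < len (Suc i) \<Longrightarrow> A (Point 0 t) (Point (Suc i) j) \<longleftrightarrow> j = val t i"

text \<open>After the halting time \<open>T\<close> states and values are arbitrary.\<close>

locale run_layout = labelled_layout +
  fixes T :: nat
  assumes run: "is_run T st val"
    and T_less: "Suc T < len 0"
    and adj_halted: "t < len 0 \<Longrightarrow> A (Root halted_root) (Point 0 t) \<longleftrightarrow> T < t"

context labelled_layout
begin

lemma label_neighbours:
  assumes "i \<le> k" "j < len i" "label_of i x" "A (Root x) (Point i j)"
  shows "x \<in> {index_root i (j mod 3), state_root (st j), halted_root}"
  using assms adj_index[OF assms(1,2)] adj_state[of j] unfolding label_of_def by auto

lemma card_clique_root_neighbours:
  assumes "i \<le> k" "j < len i" shows "card {x. x < clique_size \<and> A (Root x) (Point i j)} \<le> 3"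
proof -
  have "label_of i x" if "x < clique_size" "A (Root x) (Point i j)" for x
    using adj_root_point[OF _ assms that(2)] that(1) clique_size_root_count(1) start_root_ge[of i]
      end_root_ge[of i]
    by linarith
  then have "{x. x < clique_size \<and> A (Root x) (Point i j)} \<subseteq>
      {index_root i (j mod 3), state_root (st j), halted_root}"
    using label_neighbours[OF assms] by blast
  then have "card {x. x < clique_size \<and> A (Root x) (Point i j)} \<le>
      card {index_root i (j mod 3), state_root (st j), halted_root}"
    by (intro card_mono) auto
  also have "\<dots> \<le> 3" by (simp add: card_insert_if)
  finally show ?thesis .
qed

lemma big_clique_avoids_points:
  assumes C: "C \<subseteq> verts len" "card C = clique_size"
    and clique: "\<And>u w. u \<in> C \<Longrightarrow> w \<in> C \<Longrightarrow> u \<noteq> w \<Longrightarrow> A u w"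
  shows "Point i j \<notin> C"
proof
  assume ij: "Point i j \<in> C"
  then have bound: "i \<le> k" "j < len i" using C(1) by auto
  obtain n0 i1 n1 where points: "\<And>i j. Point i j \<in> C \<Longrightarrow>
      Point i j \<in> {Point 0 n0, Point 0 (Suc n0), Point i1 n1, Point i1 (Suc n1)}"
    using clique_points[OF clique C(1)] by blast
  let ?points = "{Point 0 n0, Point 0 (Suc n0), Point i1 n1, Point i1 (Suc n1)}"
  let ?roots = "{start_root i, end_root i, index_root i (j mod 3), state_root (st j), halted_root}"
  have "u \<in> Root ` ?roots \<union> ?points" if "u \<in> C" for u
  proof (cases u)
    case (Root x)
    then have "x < root_count" "A (Root x) (Point i j)" using C(1) clique[of u "Point i j"] that ij by auto
    then have "x \<in> ?roots" using adj_root_point[OF _ bound] label_neighbours[OF bound] by blast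
    then show ?thesis using Root by blast
  qed (use points that in blast)
  then have "card C \<le> card (Root ` ?roots \<union> ?points)" by (intro card_mono) auto
  also have "\<dots> \<le> card (Root ` ?roots) + card ?points" by (rule card_Un_le)
  also have "\<dots> \<le> 5 + 4"
    by (intro add_mono order_trans[OF card_image_le]) (auto simp: card_insert_if)
  finally show False using C(2) clique_size_root_count(3) by simp
qed

lemma big_clique_unique:
  assumes C: "C \<subseteq> verts len" "card C = clique_size"
    and clique: "\<And>u w. u \<in> C \<Longrightarrow> w \<in> C \<Longrightarrow> u \<noteq> w \<Longrightarrow> A u w"
  shows "C = Root ` {..<clique_size}"
proof -
  have root: "\<exists>x<root_count. u = Root x" if "u \<in> C" for u
    using that C(1) big_clique_avoids_points[OF C clique] by (cases u) auto
  have "Root y \<notin> C" if y: "clique_size \<le> y" for y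
  proof
    assume "Root y \<in> C"
    have "u \<in> insert (Root y) (Root ` {..clique_size - 3})" if u: "u \<in> C" for u
    proof (cases "u = Root y")
      case False
      obtain x where x: "x < root_count" "u = Root x" using root[OF u] by blast
      then have "root_adj x y"
        using clique[OF u \<open>Root y \<in> C\<close> False] adj_root root[OF \<open>Root y \<in> C\<close>] by auto
      then show ?thesis using x y root[OF \<open>Root y \<in> C\<close>] clique_size_root_count by (auto simp: root_adj_def)
    qed simp
    then have "card C \<le> card (insert (Root y) (Root ` {..clique_size - 3}))" by (intro card_mono) auto
    also have "\<dots> \<le> Suc (Suc (clique_size - 3))"
      using card_image_le[of "{..clique_size - 3}" Root] by (simp add: card_insert_if)
    finally show False using C(2) clique_size_root_count(3) by simp
  qed
  then have "C \<subseteq> Root ` {..<clique_size}" using root by (metis image_eqI lessThan_iff not_less subsetI)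
  then show ?thesis using C(2) by (intro card_subset_eq) (auto simp: card_image inj_on_def)
qed

end

locale root_embedding = labelled_layout +
  fixes V :: "nat set" and \<psi> :: "nat \<Rightarrow> vert"
  assumes V_roots: "x < root_count \<Longrightarrow> x \<in> V"
    and inj: "inj_on \<psi> V"
    and verts: "x \<in> V \<Longrightarrow> \<psi> x \<in> verts len"
    and adj_roots: "x < root_count \<Longrightarrow> y < root_count \<Longrightarrow> A (\<psi> x) (\<psi> y) \<longleftrightarrow> root_adj x y"
begin

lemma clique_image: "\<psi> ` {..<clique_size} = Root ` {..<clique_size}"
proof (rule big_clique_unique)
  have sub: "{..<clique_size} \<subseteq> V" using V_roots clique_size_root_count(1) by auto
  then show "\<psi> ` {..<clique_size} \<subseteq> verts len" using verts by auto
  show "card (\<psi> ` {..<clique_size}) = clique_size"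
    using card_image[OF inj_on_subset[OF inj sub]] by simp
  fix u w assume "u \<in> \<psi> ` {..<clique_size}" "w \<in> \<psi> ` {..<clique_size}" "u \<noteq> w"
  then show "A u w" using adj_roots clique_size_root_count(1) by (auto simp: root_adj_def)
qed

lemma card_clique_neighbours:
  assumes y: "clique_size \<le> y" "y < root_count"
  shows "card {x. x < clique_size \<and> A (Root x) (\<psi> y)} = y - clique_size + 4"
proof -
  have "Root ` {x. x < clique_size \<and> A (Root x) (\<psi> y)} = {u \<in> \<psi> ` {..<clique_size}. A u (\<psi> y)}"
    unfolding clique_image by auto
  also have "\<dots> = \<psi> ` {x. x < clique_size \<and> root_adj x y}"
    using adj_roots y clique_size_root_count(1) by (auto simp: image_iff)
  also have "\<dots> = \<psi> ` {..<y - clique_size + 4}" by (simp only: independent_neighbours[OF y])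
  finally have "card (Root ` {x. x < clique_size \<and> A (Root x) (\<psi> y)}) = card (\<psi> ` {..<y - clique_size + 4})"
    by simp
  moreover have "{..<y - clique_size + 4} \<subseteq> V" using V_roots y clique_size_root_count by auto
  ultimately show ?thesis
    using inj_on_subset[OF inj] by (simp add: card_image inj_on_def)
qed

lemma independent_fixed:
  assumes y: "clique_size \<le> y" "y < root_count" shows "\<psi> y = Root y"
proof (cases "\<psi> y")
  case (Point i j)
  then show ?thesis
    using card_clique_neighbours[OF y] card_clique_root_neighbours[of i j] verts[OF V_roots[OF y(2)]] by simp
next
  case (Root z)
  have "\<psi> y \<notin> Root ` {..<clique_size}"
  proof
    assume "\<psi> y \<in> Root ` {..<clique_size}"
    then obtain x where "x < clique_size" "\<psi> x = \<psi> y" unfolding clique_image[symmetric] by force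
    then show False using inj_onD[OF inj] V_roots y clique_size_root_count(1) by force
  qed
  then have z: "clique_size \<le> z" "z < root_count"
    using Root verts[OF V_roots[OF y(2)]] by (auto simp: image_iff)
  then have "{x. x < clique_size \<and> A (Root x) (\<psi> y)} = {x. x < clique_size \<and> root_adj x z}"
    using Root adj_root clique_size_root_count(1) by auto
  also have "\<dots> = {..<z - clique_size + 4}" by (rule independent_neighbours[OF z])
  finally have "{x. x < clique_size \<and> A (Root x) (\<psi> y)} = {..<z - clique_size + 4}" .
  then show ?thesis using card_clique_neighbours[OF y] y z Root by simp
qed

lemma rigid: "rigid_root x \<Longrightarrow> \<psi> x = Root x"
proof (cases "clique_size \<le> x")
  case False
  assume "rigid_root x"
  then have x: "4 \<le> x" "x + 3 \<le> clique_size" using False by (auto simp: rigid_root_def)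
  then have "\<psi> x \<in> Root ` {..<clique_size}" unfolding clique_image[symmetric] by auto
  then obtain x' where x': "x' < clique_size" "\<psi> x = Root x'" by auto
  have "root_adj x y \<longleftrightarrow> root_adj x' y" if "clique_size \<le> y" "y < root_count" for y
    using adj_roots[of x y] adj_root[of x' y] independent_fixed[OF that] that x x' clique_size_root_count(1)
    by simp
  then have "x = x'" by (rule root_eqI[OF x x'(1)])
  then show ?thesis using x' by simp
qed (use independent_fixed rigid_root_less in auto)

lemma roots_image: "\<psi> ` {..<root_count} = Root ` {..<root_count}"
proof -
  have "{..<root_count} = {..<clique_size} \<union> {clique_size..<root_count}"
    using clique_size_root_count(1) by auto
  then show ?thesis using clique_image independent_fixed by (simp add: image_Un)
qed

lemma not_Root:
  assumes "u \<in> verts len" "u \<notin> \<psi> ` {..<root_count}" obtains i j where "u = Point i j" "i \<le> k" "j < len i"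
  using assms unfolding roots_image by (cases u) auto

lemma nonroot_Point:
  assumes "x \<in> V" "\<not> x < root_count" obtains i j where "\<psi> x = Point i j" "i \<le> k" "j < len i"
proof (rule not_Root)
  show "\<psi> x \<notin> \<psi> ` {..<root_count}"
    using inj_onD[OF inj] V_roots assms by blast
qed (use verts assms in auto)

end

subsection \<open>Forbidden pathographs and local copies of runs\<close>

context machine
begin

definition run_graph :: "nat set \<Rightarrow> nat set set \<Rightarrow> bool" where
  "run_graph W EG \<longleftrightarrow> (\<exists>f len A st val T. drawing (verts len) A f W EG \<and> run_layout k m s0 h R len A st val T)"

definition forbidden :: "pathograph set" where
  "forbidden = {F \<in> bounded_pathographs (root_count + 2 * k + 10). \<forall>W EG. run_graph W EG \<longrightarrow>
      \<not> contains_pg W EG F}"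

lemma finite_forbidden: "finite forbidden"
  unfolding forbidden_def by (rule finite_subset[OF _ finite_bounded_pathographs]) blast

lemma wf_forbidden: "F \<in> forbidden \<Longrightarrow> wf_pathograph F"
  by (simp add: forbidden_def bounded_pathographs_def)

lemma run_graph_free: "run_graph W EG \<Longrightarrow> pg_free forbidden W EG"
  by (auto simp: pg_free_def forbidden_def)

definition with_roots :: "vert list \<Rightarrow> nat \<Rightarrow> vert" where
  "with_roots xs y = (if y < root_count then Root y else xs ! (y - root_count))"

lemma with_roots_Root [simp]: "y < root_count \<Longrightarrow> with_roots xs y = Root y"
  by (simp add: with_roots_def)

lemma with_roots_mem: "\<not> y < root_count \<Longrightarrow> y < root_count + length xs \<Longrightarrow> with_roots xs y \<in> set xs"
  by (simp add: with_roots_def)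

lemma with_roots_surj: "u \<in> set xs \<Longrightarrow> \<exists>y. \<not> y < root_count \<and> y < root_count + length xs \<and> with_roots xs y = u"
proof -
  assume "u \<in> set xs"
  then obtain n where "n < length xs" "xs ! n = u" by (auto simp: in_set_conv_nth)
  then show ?thesis by (intro exI[of _ "root_count + n"]) (simp add: with_roots_def)
qed

lemma inj_on_with_roots:
  assumes "distinct xs" "set xs \<inter> range Root = {}"
  shows "inj_on (with_roots xs) {..<root_count + length xs}"
proof (rule inj_onI)
  fix y z assume yz: "y \<in> {..<root_count + length xs}" "z \<in> {..<root_count + length xs}"
    and eq: "with_roots xs y = with_roots xs z"
  then have "y < root_count \<longleftrightarrow> z < root_count"
    using with_roots_mem[of y xs] with_roots_mem[of z xs] assms(2)
    by (metis disjoint_iff lessThan_iff rangeI with_roots_Root)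
  then show "y = z"
    using yz eq assms(1) by (auto simp: with_roots_def nth_eq_iff_index_eq split: if_splits)
qed

end

context layout
begin

definition pattern :: "vert list \<Rightarrow> pathograph" where
  "pattern xs = \<lparr>pV = {..<root_count + length xs}, pU = {},
     pE = {{y, z} | y z. y < root_count + length xs \<and> z < root_count + length xs \<and>
         A (with_roots xs y) (with_roots xs z)},
     pS = {}, pR = {}, ppi = (\<lambda>_. {})\<rparr>"

lemma pattern_simps [simp]:
  "pV (pattern xs) = {..<root_count + length xs}" "pU (pattern xs) = {}" "pS (pattern xs) = {}"
  "pR (pattern xs) = {}" "ppi (pattern xs) u = {}"
  by (simp_all add: pattern_def)

lemma pattern_edge_iff:
  "y < root_count + length xs \<Longrightarrow> z < root_count + length xs
    \<Longrightarrow> {y, z} \<in> pE (pattern xs) \<longleftrightarrow> A (with_roots xs y) (with_roots xs z)"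
  using adj_sym by (auto simp: pattern_def doubleton_eq_iff)

lemma pattern_edges_subset: "pE (pattern xs) \<subseteq> {e. e \<subseteq> pV (pattern xs) \<and> card e = 2}"
proof
  fix e assume "e \<in> pE (pattern xs)"
  then obtain y z where e: "e = {y, z}" "y < root_count + length xs" "z < root_count + length xs"
    "A (with_roots xs y) (with_roots xs z)" by (auto simp: pattern_def)
  then have "y \<noteq> z" using adj_irrefl by auto
  then show "e \<in> {e. e \<subseteq> pV (pattern xs) \<and> card e = 2}" using e by auto
qed

lemma wf_pattern: "wf_pathograph (pattern xs)"
  using pattern_edges_subset by (simp add: wf_pathograph_def)

lemma with_roots_verts: "set xs \<subseteq> verts len \<Longrightarrow> y < root_count + length xs \<Longrightarrow> with_roots xs y \<in> verts len"
  using with_roots_mem[of y xs] by (cases "y < root_count") auto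

definition line_pattern :: "vert list \<Rightarrow> nat \<Rightarrow> pathograph" where
  "line_pattern xs i = (pattern xs)\<lparr>
     pU := {root_count + length xs},
     pS := {(index_root i r, root_count + length xs) | r. r < 3},
     ppi := (\<lambda>u. if u = root_count + length xs then {start_root i, end_root i} else {})\<rparr>"

lemma line_pattern_simps [simp]:
  "pV (line_pattern xs i) = {..<root_count + length xs}" "pU (line_pattern xs i) = {root_count + length xs}"
  "pE (line_pattern xs i) = pE (pattern xs)"
  "pS (line_pattern xs i) = {(index_root i r, root_count + length xs) | r. r < 3}"
  "pR (line_pattern xs i) = {}"
  "ppi (line_pattern xs i) u = (if u = root_count + length xs then {start_root i, end_root i} else {})"
  by (simp_all add: line_pattern_def)

lemma wf_line_pattern:
  assumes "i \<le> k" shows "wf_pathograph (line_pattern xs i)"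
proof -
  have "\<not> root_adj (start_root i) (end_root i)"
    using start_root_ge[of i] end_root_ge[of i] by (auto simp: root_adj_def)
  then have "{start_root i, end_root i} \<notin> pE (pattern xs)"
    using pattern_edge_iff[of "start_root i" xs "end_root i"] adj_root start_root_less[OF assms]
      end_root_less[OF assms]
    by simp
  moreover have "index_root i r < root_count + length xs" if "r < 3" for r
    using index_root_less_root_count[OF assms that] by simp
  ultimately show ?thesis
    using pattern_edges_subset[of xs] start_root_less[OF assms] end_root_less[OF assms]
      start_root_neq_end_root
    by (auto simp: wf_pathograph_def)
qed

context
  fixes xs :: "vert list" and i :: nat
  assumes line: "i \<le> k" "i \<noteq> 0" and xs: "set xs \<subseteq> verts len" "set xs \<inter> range Root = {}" "distinct xs"
    and detached: "\<And>u j. u \<in> set xs \<Longrightarrow> j < len i \<Longrightarrow> u \<noteq> Point i j \<and> \<not> A u (Point i j)"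
begin

lemma placement_line_pattern:
  "placement (line_pattern xs i) (with_roots xs ` {..<root_count + length xs} \<union> Point i ` {..<len i})
    (with_roots xs)
    (\<lambda>_. map (Point i) [0..<len i])"
proof
  show "inj_on (with_roots xs) (pV (line_pattern xs i))" using inj_on_with_roots[OF xs(3,2)] by simp
  show "with_roots xs v \<notin> set (map (Point i) [0..<len i])" if "v \<in> pV (line_pattern xs i)" for v
    using that with_roots_mem[of v xs] detached by (cases "v < root_count") fastforce+
qed (use len_pos[OF line(1)] in \<open>auto simp: distinct_map inj_on_def lessThan_atLeast0\<close>)

lemma line_attachment:
  assumes y: "y < root_count + length xs" and j: "j < len i" and adj: "A (with_roots xs y) (Point i j)"
  shows "y = start_root i \<and> j = 0 \<or> y = end_root i \<and> Suc j = len i \<or>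
    (y, root_count + length xs) \<in> pS (line_pattern xs i)"
proof -
  have "y < root_count" using with_roots_mem[OF _ y] detached[OF _ j] adj by blast
  then show ?thesis
    using adj_root_point[OF _ line(1) j, of y] adj line(2) by (auto simp: label_of_def)
qed

theorem realizes_line_pattern:
  "realizes (line_pattern xs i) (\<lambda>_. (start_root i, end_root i))
    (with_roots xs ` {..<root_count + length xs} \<union> Point i ` {..<len i}) A (with_roots xs)
    (\<lambda>_. map (Point i) [0..<len i])" (is "realizes ?F ?en ?Y A ?\<phi> ?P")
proof (intro realizes.intro realizes_axioms.intro placement_line_pattern)
  let ?n = "root_count + length xs"
  have urpath: "urpath ?en ?\<phi> ?P u = Root (start_root i) # map (Point i) [0..<len i] @ [Root (end_root i)]"
    for u
    using start_root_less[OF line(1)] end_root_less[OF line(1)] by (simp add: urpath_def)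
  note consecutive = consecutive_ends_map_upt[OF len_pos[OF line(1)], of "Root (start_root i)" "Point i"
    "Root (end_root i)"]
  have linked_line: "linked ?F ?en ?\<phi> ?P u w" if "consecutive (urpath ?en ?\<phi> ?P ?n) u w" for u w
    by (rule linked.path[of ?n]) (use that in simp_all)
  have linked_attachment: "linked ?F ?en ?\<phi> ?P (?\<phi> y) (Point i j) \<or> linked ?F ?en ?\<phi> ?P (Point i j) (?\<phi> y)"
    if "y < ?n" "j < len i" "A (?\<phi> y) (Point i j)" for y j
    using line_attachment[OF that]
  proof (elim disjE)
    assume "(y, ?n) \<in> pS ?F"
    then show ?thesis by (intro disjI1 linked.spoke) (use that(2) in auto)
  qed (use start_root_less[OF line(1)] end_root_less[OF line(1)] in
      \<open>auto intro!: linked_line simp: urpath consecutive\<close>)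
  show "successively A (urpath ?en ?\<phi> ?P u)" for u
    unfolding successively_iff_consecutive urpath consecutive
    using adj_start[OF line(1)] adj_sym[OF adj_end[OF line(1)]] adj_line[OF line(1)] by auto
  show "\<exists>y\<in>set (?P u). A (?\<phi> v) y" if "(v, u) \<in> pS ?F" for v u
    using that index_root_used[OF line(1)] index_root_less_root_count[OF line(1)] by fastforce
  show "linked ?F ?en ?\<phi> ?P u w \<or> linked ?F ?en ?\<phi> ?P w u" if uw: "u \<in> ?Y" "w \<in> ?Y" and adj: "A u w" for u w
  proof -
    from uw consider y z where "y < ?n" "z < ?n" "u = ?\<phi> y" "w = ?\<phi> z"
      | y j where "y < ?n" "j < len i" "u = ?\<phi> y" "w = Point i j"
      | y j where "y < ?n" "j < len i" "w = ?\<phi> y" "u = Point i j"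
      | j j' where "j < len i" "j' < len i" "u = Point i j" "w = Point i j'" by blast
    then show ?thesis
    proof cases
      case (1 y z)
      then show ?thesis using adj pattern_edge_iff[of y xs z] by (intro disjI1) (auto intro: linked.edge)
    next
      case (4 j j')
      then have "j' = Suc j \<or> j = Suc j'" using adj_line[OF line(1)] adj by simp
      then show ?thesis using 4 by (auto intro!: linked_line simp: urpath consecutive)
    qed (use linked_attachment adj adj_sym[OF adj] in blast)+
  qed
  show "A (?\<phi> v) (?\<phi> w)" if "{v, w} \<in> pE ?F" for v w
    using that pattern_edges_subset[of xs] pattern_edge_iff[of v xs w] by auto
qed auto

end

end

lemma unit_steps_cover:
  assumes "js \<noteq> []" "successively (\<lambda>a b. b = Suc a \<or> a = Suc b) js" "hd js \<le> v" "v \<le> last js"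
  shows "v \<in> set js"
  using assms
proof (induction js rule: induct_list012)
  case (3 a b js)
  then show ?case by (cases "v = a") auto
qed auto

context root_embedding
begin

lemma urpath_covers_line:
  assumes "realizes H en Y A \<psi> P" and wf: "wf_pathograph H" "orients en H"
    and V: "pV H = V" and Y: "Y \<subseteq> verts len" and u: "u \<in> pU H" and i: "i \<le> k"
    and en: "en u = (start_root i, end_root i)" and spokes: "\<And>v. (v, u) \<in> pS H \<Longrightarrow> \<exists>r<3. v = index_root i r"
  shows "set (P u) = Point i ` {..<len i}"
proof -
  interpret H: realizes H en Y A \<psi> P by (rule assms)
  have on_line: "\<exists>j<len i. z = Point i j" if z: "z \<in> set (P u)" for z
  proof -
    have "z \<in> verts len" using H.carrier Y u z by blast
    moreover have "z \<notin> \<psi> ` {..<root_count}" using H.path_internal[OF u] V V_roots z by auto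
    ultimately obtain i' j where z_eq: "z = Point i' j" "i' \<le> k" "j < len i'" by (rule not_Root)
    let ?x = "index_root i' (j mod 3)"
    have x: "label_of i' ?x" by (simp add: label_of_index_root)
    then have "A (\<psi> ?x) z" using rigid[OF rigid_root_label] adj_index z_eq by simp
    moreover have "?x \<in> pV H" unfolding V using index_root_less_root_count z_eq(2) by (intro V_roots) simp
    ultimately have "?x = start_root i \<or> ?x = end_root i \<or> (?x, u) \<in> pS H"
      using H.explicit_internal_adj[OF wf _ u z] en by auto
    then obtain r where "r < 3" "?x = index_root i r" using spokes label_of_neq[OF x z_eq(2)] by blast
    then show ?thesis using index_root_eq_iff z_eq by auto
  qed
  then obtain js where js: "P u = map (Point i) js" by (metis ex_map_conv)
  then have js_less: "j < len i" if "j \<in> set js" for j using that on_line by auto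
  have "js \<noteq> []" using H.path_nonempty[OF u] js by simp
  have "\<psi> (start_root i) = Root (start_root i)" "\<psi> (end_root i) = Root (end_root i)"
    using rigid rigid_root_start_root rigid_root_end_root i by auto
  then have "successively A (Root (start_root i) # map (Point i) js @ [Root (end_root i)])"
    using H.paths[OF u] by (simp add: urpath_def en js)
  then have ends: "A (Root (start_root i)) (Point i (hd js))" "A (Point i (last js)) (Root (end_root i))"
    and steps: "successively (\<lambda>a b. A (Point i a) (Point i b)) js"
    using \<open>js \<noteq> []\<close>
    by (auto simp: successively_Cons successively_append_iff successively_map hd_map last_map hd_append)
  have "hd js = 0" "Suc (last js) = len i"
    using ends(1) adj_sym[OF ends(2)] \<open>js \<noteq> []\<close> js_less adj_start_iff[OF i i] adj_end_iff[OF i i] by auto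
  moreover have "successively (\<lambda>a b. b = Suc a \<or> a = Suc b) js"
    using steps by (rule successively_mono) (use adj_line[OF i] js_less in blast)
  ultimately have "v \<in> set js" if "v < len i" for v
    using unit_steps_cover[OF \<open>js \<noteq> []\<close>] that by auto
  then show ?thesis using js js_less by auto
qed

end

text \<open>An occurrence, in the graph of a run, of a pattern formed by the roots and the points \<open>xs\<close> of a layout.\<close>

locale pattern_copy = layout k m s0 h R len A + copy: run_layout k m s0 h R len' A' st val T
  for k m s0 h R len A len' A' st val T +
  fixes xs :: "vert list" and \<psi> :: "nat \<Rightarrow> vert"
  assumes points: "set xs \<subseteq> verts len" "set xs \<inter> range Root = {}"
    and \<psi>_inj: "inj_on \<psi> {..<root_count + length xs}"
    and \<psi>_verts: "y < root_count + length xs \<Longrightarrow> \<psi> y \<in> verts len'"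
    and \<psi>_adj: "y < root_count + length xs \<Longrightarrow> z < root_count + length xs
      \<Longrightarrow> A' (\<psi> y) (\<psi> z) \<longleftrightarrow> A (with_roots xs y) (with_roots xs z)"
begin

sublocale embedded: root_embedding k m s0 h R len' A' st val "{..<root_count + length xs}" \<psi>
  by unfold_locales (use \<psi>_inj \<psi>_verts \<psi>_adj adj_root in auto)

lemma line_preserved:
  assumes y: "y < root_count + length xs" and ij: "with_roots xs y = Point i j"
  obtains j' where "\<psi> y = Point i j'" "j' < len' i"
proof -
  have "\<not> y < root_count" using ij by auto
  then obtain i' j' where copy: "\<psi> y = Point i' j'" "i' \<le> k" "j' < len' i'"
    using embedded.nonroot_Point[of y] y by auto
  have bound: "i \<le> k" "j < len i" using with_roots_mem[OF \<open>\<not> y < root_count\<close> y] ij points(1) by auto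
  let ?x = "index_root i' (j' mod 3)"
  have x: "label_of i' ?x" by (simp add: label_of_index_root)
  have "?x < root_count" using index_root_less_root_count copy(2) by simp
  moreover have "A' (\<psi> ?x) (\<psi> y)"
    using embedded.rigid[OF rigid_root_label[OF x copy(2)]] copy.adj_index copy by simp
  ultimately have "A (Root ?x) (Point i j)" using \<psi>_adj[of ?x y] y ij by simp
  then have "i = i'" using adj_label[OF x copy(2) bound] by simp
  then show thesis using that copy by simp
qed

end

locale local_copy = layout k m s0 h R len A + copy: run_layout k m s0 h R len' A' st val T
  for k m s0 h R len A len' A' st val T +
  fixes X :: "vert set" and p :: "nat \<Rightarrow> nat \<Rightarrow> nat"
  assumes X: "Point i j \<in> X \<Longrightarrow> i \<le> k \<and> j < len i"
    and p_less: "Point i j \<in> X \<Longrightarrow> p i j < len' i"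
    and p_inj: "Point i j \<in> X \<Longrightarrow> Point i j' \<in> X \<Longrightarrow> p i j' = p i j \<longleftrightarrow> j' = j"
    and p_adj: "Point i j \<in> X \<Longrightarrow> Point i' j' \<in> X
      \<Longrightarrow> A' (Point i (p i j)) (Point i' (p i' j')) \<longleftrightarrow> A (Point i j) (Point i' j')"
    and p_root: "Point i j \<in> X \<Longrightarrow> rigid_root x \<Longrightarrow> A' (Root x) (Point i (p i j)) \<longleftrightarrow> A (Root x) (Point i j)"

lemma (in pattern_copy) local_copy_exists: "\<exists>p. local_copy k m s0 h R len A len' A' st val T (set xs) p"
proof -
  have "\<exists>y j'. y < root_count + length xs \<and> with_roots xs y = Point i j \<and> \<psi> y = Point i j' \<and> j' < len' i"
    if "Point i j \<in> set xs" for i j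
    using with_roots_surj[OF that] line_preserved by metis
  then obtain y p where yp: "\<And>i j. Point i j \<in> set xs \<Longrightarrow> y i j < root_count + length xs"
    "\<And>i j. Point i j \<in> set xs \<Longrightarrow> with_roots xs (y i j) = Point i j"
    "\<And>i j. Point i j \<in> set xs \<Longrightarrow> \<psi> (y i j) = Point i (p i j)"
    "\<And>i j. Point i j \<in> set xs \<Longrightarrow> p i j < len' i" by metis
  have "local_copy k m s0 h R len A len' A' st val T (set xs) p"
  proof unfold_locales
    fix i j assume ij: "Point i j \<in> set xs"
    show "i \<le> k \<and> j < len i" using ij points(1) by auto
    show "p i j < len' i" by (rule yp(4)[OF ij])
    show "A' (Root x) (Point i (p i j)) \<longleftrightarrow> A (Root x) (Point i j)" if "rigid_root x" for x
      using \<psi>_adj[of x "y i j"] yp(1-3)[OF ij] embedded.rigid[OF that] rigid_root_less[OF that] by simp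
    fix i' j' assume ij': "Point i' j' \<in> set xs"
    show "A' (Point i (p i j)) (Point i' (p i' j')) \<longleftrightarrow> A (Point i j) (Point i' j')"
      using \<psi>_adj[of "y i j" "y i' j'"] yp(1-3)[OF ij] yp(1-3)[OF ij'] by simp
  next
    fix i j j' assume ij: "Point i j \<in> set xs" and ij': "Point i j' \<in> set xs"
    have "y i j = y i j'" if "p i j' = p i j"
      using inj_onD[OF \<psi>_inj, of "y i j" "y i j'"] yp(1,3)[OF ij] yp(1,3)[OF ij'] that by simp
    then show "p i j' = p i j \<longleftrightarrow> j' = j" using yp(2)[OF ij] yp(2)[OF ij'] by (metis vert.inject(2))
  qed
  then show ?thesis by blast
qed

locale free_layout = layout +
  fixes f :: "vert \<Rightarrow> nat" and W :: "nat set" and EG :: "nat set set"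
  assumes drawn: "drawing (verts len) A f W EG" and free: "pg_free forbidden W EG"
begin

lemma occurs_in_run_graph:
  assumes "F \<in> bounded_pathographs (root_count + 2 * k + 10)" "contains_pg W EG F"
  obtains len' A' st val T f' W' EG' where "run_layout k m s0 h R len' A' st val T"
    "drawing (verts len') A' f' W' EG'" "contains_pg W' EG' F"
proof -
  have "F \<notin> forbidden" using assms(2) free unfolding pg_free_def by blast
  then obtain W' EG' where "run_graph W' EG'" "contains_pg W' EG' F"
    using assms(1) by (auto simp: forbidden_def)
  then show thesis using that unfolding run_graph_def by blast
qed

lemma local_copy:
  assumes X: "X \<subseteq> verts len" "X \<inter> range Root = {}" "card X \<le> 2 * k + 3"
  obtains len' A' st val T p where "local_copy k m s0 h R len A len' A' st val T X p"
proof -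
  interpret drawn: drawing "verts len" A f W EG by (rule drawn)
  obtain xs where xs: "set xs = X" "distinct xs"
    using finite_distinct_list[OF finite_subset[OF X(1) finite_verts]] by blast
  then have xs': "set xs \<subseteq> verts len" "set xs \<inter> range Root = {}" "length xs \<le> 2 * k + 3"
    using X distinct_card by fastforce+
  have "contains_pg W EG (pattern xs)"
    unfolding drawn.contains_plain_pg_iff[OF wf_pattern pattern_simps(2)]
    using inj_on_with_roots[OF xs(2) xs'(2)] with_roots_verts[OF xs'(1)] pattern_edge_iff
    by (intro exI[of _ "with_roots xs"]) auto
  moreover have "pattern xs \<in> bounded_pathographs (root_count + 2 * k + 10)"
    using wf_pattern xs'(3) by (auto simp: bounded_pathographs_def)
  ultimately obtain len' A' st val T f' W' EG' where run: "run_layout k m s0 h R len' A' st val T"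
    and drawn': "drawing (verts len') A' f' W' EG'" and "contains_pg W' EG' (pattern xs)"
    using occurs_in_run_graph by metis
  then obtain \<psi> where \<psi>: "inj_on \<psi> {..<root_count + length xs}"
    "\<psi> ` {..<root_count + length xs} \<subseteq> verts len'"
    "\<And>y z. y < root_count + length xs \<Longrightarrow> z < root_count + length xs \<Longrightarrow>
        {y, z} \<in> pE (pattern xs) \<longleftrightarrow> A' (\<psi> y) (\<psi> z)"
    unfolding drawing.contains_plain_pg_iff[OF drawn' wf_pattern pattern_simps(2)] by auto
  interpret copy: run_layout k m s0 h R len' A' st val T by (rule run)
  interpret pattern_copy k m s0 h R len A len' A' st val T xs \<psi>
    by unfold_locales (use xs' \<psi> pattern_edge_iff in auto)
  show thesis using local_copy_exists that xs(1) by blast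
qed

lemma detached_line_in_run_graph:
  assumes "t < len 0" "i \<le> k" "i \<noteq> 0" and detached: "\<not> (\<exists>j<len i. A (Point 0 t) (Point i j))"
  obtains Y \<psi> P len' A' st val T where "run_layout k m s0 h R len' A' st val T" "Y \<subseteq> verts len'"
    "realizes (line_pattern [Point 0 t] i) (\<lambda>_. (start_root i, end_root i)) Y A' \<psi> P"
proof -
  interpret drawn: drawing "verts len" A f W EG by (rule drawn)
  let ?F = "line_pattern [Point 0 t] i" and ?en = "\<lambda>_. (start_root i, end_root i)"
  let ?Y = "with_roots [Point 0 t] ` {..<root_count + length [Point 0 t]} \<union> Point i ` {..<len i}"
  have wf: "wf_pathograph ?F" "orients ?en ?F"
    using wf_line_pattern[OF assms(2)] by (simp_all add: orients_def)
  have "realizes ?F ?en ?Y A (with_roots [Point 0 t]) (\<lambda>_. map (Point i) [0..<len i])"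
    by (rule realizes_line_pattern) (use assms in auto)
  moreover have "?Y \<subseteq> verts len" using with_roots_verts[of "[Point 0 t]"] assms(1,2) by auto
  ultimately have "contains_pg W EG ?F"
    unfolding drawn.contains_pg_iff_realizes[OF wf] by blast
  moreover have "?F \<in> bounded_pathographs (root_count + 2 * k + 10)"
    using wf(1) by (auto simp: bounded_pathographs_def)
  ultimately obtain len' A' st val T f' W' EG' where "run_layout k m s0 h R len' A' st val T"
    and drawing: "drawing (verts len') A' f' W' EG'" and "contains_pg W' EG' ?F"
    using occurs_in_run_graph by metis
  then show thesis
    using that unfolding drawing.contains_pg_iff_realizes[OF drawing wf] by blast
qed

theorem value_exists:
  assumes t: "t < len 0" and i: "i < k"
  shows "\<exists>j<len (Suc i). A (Point 0 t) (Point (Suc i) j)"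
proof (rule ccontr)
  let ?F = "line_pattern [Point 0 t] (Suc i)" and ?en = "\<lambda>_. (start_root (Suc i), end_root (Suc i))"
  have i': "Suc i \<le> k" using i by simp
  have wf: "wf_pathograph ?F" "orients ?en ?F"
    using wf_line_pattern[OF i'] by (simp_all add: orients_def)
  assume "\<not> (\<exists>j<len (Suc i). A (Point 0 t) (Point (Suc i) j))"
  then obtain Y \<psi> P len' A' st val T where run: "run_layout k m s0 h R len' A' st val T"
    and Y: "Y \<subseteq> verts len'" and realizes: "realizes ?F ?en Y A' \<psi> P"
    by (rule detached_line_in_run_graph[OF t i' Suc_not_Zero])
  interpret copy: run_layout k m s0 h R len' A' st val T by (rule run)
  interpret F: realizes ?F ?en Y A' \<psi> P by (rule realizes)
  interpret pattern_copy k m s0 h R len A len' A' st val T "[Point 0 t]" \<psi>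
  proof unfold_locales
    show "\<psi> y \<in> verts len'" if "y < root_count + length [Point 0 t]" for y
      using F.carrier Y that by auto
    show "A' (\<psi> y) (\<psi> z) \<longleftrightarrow> A (with_roots [Point 0 t] y) (with_roots [Point 0 t] z)"
      if "y < root_count + length [Point 0 t]" "z < root_count + length [Point 0 t]" for y z
      using F.explicit_adj_iff[OF wf, of y z] pattern_edge_iff[OF that] that by simp
  qed (use t F.inj in auto)
  obtain t' where t': "\<psi> root_count = Point 0 t'" "t' < len' 0"
    by (rule line_preserved[of root_count 0 t]) (auto simp: with_roots_def)
  have v: "val t' i < len' (Suc i)" using copy.val_less[OF t'(2) i] by simp
  have "set (P (Suc root_count)) = Point (Suc i) ` {..<len' (Suc i)}"
    by (rule embedded.urpath_covers_line[OF realizes wf]) (use Y i' in auto)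
  then have "Point (Suc i) (val t' i) \<in> set (P (Suc root_count))" using v by blast
  moreover have "A' (\<psi> root_count) (Point (Suc i) (val t' i))"
    using copy.adj_value[OF t'(2) i v] t'(1) by simp
  ultimately have "root_count = start_root (Suc i) \<or> root_count = end_root (Suc i) \<or>
      (\<exists>r<3. root_count = index_root (Suc i) r)"
    using F.explicit_internal_adj[OF wf, of root_count "Suc root_count"] by auto
  then show False
    using start_root_less[OF i'] end_root_less[OF i'] index_root_less_root_count[OF i'] by (metis less_irrefl)
qed

end

subsection \<open>Free layouts carry accepting runs\<close>

lemma next_index:
  fixes a b j :: nat
  assumes "a mod 3 = j mod 3" "b mod 3 = Suc j mod 3" "b = Suc a \<or> a = Suc b"
  shows "b = Suc a"
  using assms by (auto simp: mod_Suc split: if_splits)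

lemma successor_index:
  fixes a b x y :: nat
  assumes "a mod 3 = x mod 3" "b mod 3 = y mod 3" and iff: "b = Suc a \<or> a = Suc b \<longleftrightarrow> y = Suc x \<or> x = Suc y"
  shows "b = Suc a \<longleftrightarrow> y = Suc x"
proof -
  have incongruent: False if "c mod 3 = Suc d mod 3" "Suc c mod 3 = d mod 3" for c d :: nat
    using that by (auto simp: mod_Suc split: if_splits)
  show ?thesis
  proof
    assume b: "b = Suc a"
    then have "y = Suc x \<or> x = Suc y" using iff by simp
    then show "y = Suc x" using incongruent[of a y] assms(1,2) b by auto
  next
    assume y: "y = Suc x"
    then have "b = Suc a \<or> a = Suc b" using iff by simp
    then show "b = Suc a" using incongruent[of x b] assms(1,2) y by auto
  qed
qed

context local_copy
begin

lemma p_index: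
  assumes "Point i j \<in> X" "r < 3" shows "A (Root (index_root i r)) (Point i j) \<longleftrightarrow> r = p i j mod 3"
  using p_root[OF assms(1) rigid_root_label[OF label_of_index_root[OF assms(2)]]]
    copy.adj_index[OF _ p_less[OF assms(1)] assms(2)] X[OF assms(1)] by simp

lemma p_start: "Point i j \<in> X \<Longrightarrow> p i j = 0 \<longleftrightarrow> j = 0"
  using p_root[of i j "start_root i"] X[of i j] p_less[of i j] rigid_root_start_root
    adj_start_iff[of i i j] copy.adj_start_iff[of i i "p i j"] by simp

lemma p_end: "Point i j \<in> X \<Longrightarrow> Suc (p i j) = len' i \<longleftrightarrow> Suc j = len i"
  using p_root[of i j "end_root i"] X[of i j] p_less[of i j] rigid_root_end_root
    adj_end_iff[of i i j] copy.adj_end_iff[of i i "p i j"] by simp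

lemma p_neighbour:
  assumes "Point i j \<in> X" "Point i j' \<in> X"
  shows "p i j' = Suc (p i j) \<or> p i j = Suc (p i j') \<longleftrightarrow> j' = Suc j \<or> j = Suc j'"
  using p_adj[OF assms] adj_line[of i j j'] copy.adj_line[of i "p i j" "p i j'"]
    X[OF assms(1)] X[OF assms(2)] p_less[OF assms(1)] p_less[OF assms(2)] by simp

lemma window_mod_3:
  assumes window: "\<And>j'. j' \<le> j \<Longrightarrow> j \<le> j' + 2 \<Longrightarrow> Point i j' \<in> X"
    and IH: "\<And>j'. j' < j \<Longrightarrow> j \<le> j' + 2 \<Longrightarrow> p i j' mod 3 = j' mod 3"
  shows "p i j mod 3 = j mod 3"
proof -
  consider "j = 0" | "j = 1" | j0 where "j = Suc (Suc j0)" by (metis One_nat_def not0_implies_Suc)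
  then show ?thesis
  proof cases
    case 1
    then show ?thesis using p_start[of i 0] window by simp
  next
    case 2
    then have "p i 1 = Suc (p i 0)" using p_start[of i 0] p_neighbour[of i 0 1] window by simp
    then show ?thesis using p_start[of i 0] window 2 by simp
  next
    case (3 j0)
    have "p i (Suc j0) = Suc (p i j0)"
      using next_index[OF IH[of j0] IH[of "Suc j0"]] p_neighbour[of i j0 "Suc j0"] window 3 by simp
    moreover have "p i j \<noteq> p i j0" using p_inj[of i j0 j] window 3 by simp
    moreover have "p i j = Suc (p i (Suc j0)) \<or> p i (Suc j0) = Suc (p i j)"
      using p_neighbour[of i "Suc j0" j] window 3 by simp
    ultimately have "p i j = Suc (Suc (p i j0))" by simp
    then show ?thesis using IH[of j0] 3 by (simp add: mod_Suc)
  qed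
qed

end

context layout
begin

definition value_of :: "nat \<Rightarrow> nat \<Rightarrow> nat" where
  "value_of t i = (SOME j. j < len (Suc i) \<and> A (Point 0 t) (Point (Suc i) j))"

definition state_of :: "nat \<Rightarrow> nat" where
  "state_of t = (SOME s. s < m \<and> A (Root (state_root s)) (Point 0 t))"

end

text \<open>Once the labels of a layout count the indices modulo 3, local copies preserve the direction of lines.\<close>

locale indexed_local_copy = local_copy +
  assumes adj_index: "i \<le> k \<Longrightarrow> j < len i \<Longrightarrow> r < 3 \<Longrightarrow> A (Root (index_root i r)) (Point i j) \<longleftrightarrow> r = j mod 3"
begin

lemma p_mod_3: "Point i j \<in> X \<Longrightarrow> p i j mod 3 = j mod 3"
  using p_index[of i j "j mod 3"] adj_index[of i j "j mod 3"] X[of i j] by simp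

lemma p_Suc: "Point i j \<in> X \<Longrightarrow> Point i j' \<in> X \<Longrightarrow> p i j' = Suc (p i j) \<longleftrightarrow> j' = Suc j"
  by (rule successor_index[OF p_mod_3 p_mod_3 p_neighbour])

lemma p_value:
  "Point 0 t \<in> X \<Longrightarrow> Point (Suc i) j \<in> X \<Longrightarrow> A (Point 0 t) (Point (Suc i) j) \<longleftrightarrow> p (Suc i) j = val (p 0 t) i"
  using p_adj[of 0 t "Suc i" j] copy.adj_value[of "p 0 t" i "p (Suc i) j"] p_less X[of "Suc i" j] by simp

lemma p_state: "Point 0 t \<in> X \<Longrightarrow> s < m \<Longrightarrow> A (Root (state_root s)) (Point 0 t) \<longleftrightarrow> s = st (p 0 t)"
  using p_root[of 0 t "state_root s"] copy.adj_state[of "p 0 t" s] p_less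
    rigid_root_label[OF label_of_state_root] by simp

lemma state_of_eq:
  assumes "Point 0 t \<in> X" shows "state_of t = st (p 0 t)"
  unfolding state_of_def
  using p_state[OF assms] copy.st_less[OF p_less[OF assms]] by (intro some_equality) auto

lemma p_halted: "Point 0 t \<in> X \<Longrightarrow> A (Root halted_root) (Point 0 t) \<longleftrightarrow> T < p 0 t"
  using p_root[of 0 t halted_root] copy.adj_halted[of "p 0 t"] p_less
    rigid_root_label[OF label_of_halted_root] by simp

lemma p_difference:
  assumes "Point i j \<in> X" "Point i j' \<in> X" "int (p i j') - int (p i j) \<in> {-1, 0, 1}"
  shows "int j' - int j = int (p i j') - int (p i j)"
proof -
  consider "p i j' = p i j" | "p i j' = Suc (p i j)" | "p i j = Suc (p i j')" using assms(3) by fastforce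
  then show ?thesis
    using p_inj[OF assms(1,2)] p_Suc[OF assms(1,2)] p_Suc[OF assms(2,1)] by cases auto
qed

end

context free_layout
begin

lemma adj_index:
  assumes i: "i \<le> k" and "j < len i" and "r < 3"
  shows "A (Root (index_root i r)) (Point i j) \<longleftrightarrow> r = j mod 3"
  using assms(2,3)
proof (induction j arbitrary: r rule: less_induct)
  case (less j)
  let ?X = "Point i ` {j - 2..j}"
  have "card ?X \<le> card {j - 2..j}" by (rule card_image_le) simp
  then have "?X \<subseteq> verts len" "?X \<inter> range Root = {}" "card ?X \<le> 2 * k + 3" using i less.prems(1) by auto
  then obtain len' A' st val T p where "local_copy k m s0 h R len A len' A' st val T ?X p"
    by (rule local_copy)
  then interpret local_copy k m s0 h R len A len' A' st val T ?X p .
  have "p i j mod 3 = j mod 3"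
  proof (rule window_mod_3)
    fix j' assume j': "j' < j" "j \<le> j' + 2"
    then have "A (Root (index_root i (p i j' mod 3))) (Point i j')" using p_index[of i j'] by simp
    then show "p i j' mod 3 = j' mod 3" using less.IH[OF j'(1)] less.prems(1) j'(1) by simp
  qed auto
  then show ?case using p_index[of i j r] less.prems(2) by simp
qed

lemma indexed_local_copy:
  assumes "X \<subseteq> verts len" "X \<inter> range Root = {}" "card X \<le> 2 * k + 3"
  obtains len' A' st val T p where "indexed_local_copy k m s0 h R len A len' A' st val T X p"
  using local_copy[OF assms] adj_index indexed_local_copy.intro indexed_local_copy_axioms.intro by metis

lemma value_of:
  assumes "t < len 0" "i < k"
  shows "value_of t i < len (Suc i)" "A (Point 0 t) (Point (Suc i) (value_of t i))"
  using someI_ex[OF value_exists[OF assms]] unfolding value_of_def by auto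

lemma adj_value:
  assumes t: "t < len 0" and i: "i < k" and j: "j < len (Suc i)"
  shows "A (Point 0 t) (Point (Suc i) j) \<longleftrightarrow> j = value_of t i" "Suc (value_of t i) < len (Suc i)"
proof -
  note v = value_of[OF t i]
  let ?X = "{Point 0 t, Point (Suc i) j, Point (Suc i) (value_of t i)}"
  have "?X \<subseteq> verts len" "?X \<inter> range Root = {}" "card ?X \<le> 2 * k + 3"
    using t i j v by (auto simp: card_insert_if)
  then obtain len' A' st val T p where "indexed_local_copy k m s0 h R len A len' A' st val T ?X p"
    by (rule indexed_local_copy)
  then interpret indexed_local_copy k m s0 h R len A len' A' st val T ?X p .
  have p_value_of: "p (Suc i) (value_of t i) = val (p 0 t) i" using p_value[of t i "value_of t i"] v by simp
  then show "A (Point 0 t) (Point (Suc i) j) \<longleftrightarrow> j = value_of t i"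
    using p_value[of t i j] p_inj[of "Suc i" "value_of t i" j] by simp
  have "Suc (val (p 0 t) i) < len' (Suc i)" using copy.val_less[of "p 0 t" i] p_less[of 0 t] i by simp
  then show "Suc (value_of t i) < len (Suc i)"
    using p_value_of p_end[of "Suc i" "value_of t i"] v(1) by simp
qed

lemma point_0_copy:
  assumes "t < len 0"
  obtains len' A' st val T p where "indexed_local_copy k m s0 h R len A len' A' st val T {Point 0 t} p"
proof (rule indexed_local_copy)
  show "{Point 0 t} \<subseteq> verts len" using assms by simp
qed (use that in auto)

lemma adj_state:
  assumes t: "t < len 0" and s: "s < m"
  shows "A (Root (state_root s)) (Point 0 t) \<longleftrightarrow> s = state_of t"
proof -
  obtain len' A' st val T p where "indexed_local_copy k m s0 h R len A len' A' st val T {Point 0 t} p"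
    using t by (rule point_0_copy)
  then interpret indexed_local_copy k m s0 h R len A len' A' st val T "{Point 0 t}" p .
  show ?thesis using p_state[of t s] state_of_eq[of t] s by simp
qed

lemma state_of_less:
  assumes "t < len 0" shows "state_of t < m"
proof -
  obtain len' A' st val T p where "indexed_local_copy k m s0 h R len A len' A' st val T {Point 0 t} p"
    using assms by (rule point_0_copy)
  then interpret indexed_local_copy k m s0 h R len A len' A' st val T "{Point 0 t}" p .
  show ?thesis using state_of_eq[of t] copy.st_less[OF p_less[of 0 t]] by simp
qed

sublocale labelled: labelled_layout k m s0 h R len A state_of value_of
  by unfold_locales (use state_of_less adj_value(2) value_of(1) adj_index adj_state adj_value(1) in \<open>blast+\<close>)

lemma initial_time: "state_of 0 = s0" "\<not> A (Root halted_root) (Point 0 0)" "Suc 0 < len 0"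
proof -
  have len: "0 < len 0" using len_pos by simp
  then obtain len' A' st val T p where "indexed_local_copy k m s0 h R len A len' A' st val T {Point 0 0} p"
    by (rule point_0_copy)
  then interpret indexed_local_copy k m s0 h R len A len' A' st val T "{Point 0 0}" p .
  have p0: "p 0 0 = 0" using p_start[of 0 0] by simp
  then show "state_of 0 = s0" "\<not> A (Root halted_root) (Point 0 0)"
    using state_of_eq[of 0] is_run_initial(1)[OF copy.run] p_halted[of 0] by simp_all
  show "Suc 0 < len 0" using p_end[of 0 0] p0 copy.T_less len by auto
qed

lemma initial_value:
  assumes i: "0 < i" "i < k" shows "value_of 0 i = 0"
proof -
  have len: "0 < len 0" using len_pos by simp
  note v = value_of[OF len i(2)]
  let ?X = "{Point 0 0, Point (Suc i) (value_of 0 i)}"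
  have "?X \<subseteq> verts len" "?X \<inter> range Root = {}" "card ?X \<le> 2 * k + 3"
    using len i v by (auto simp: card_insert_if)
  then obtain len' A' st val T p where "indexed_local_copy k m s0 h R len A len' A' st val T ?X p"
    by (rule indexed_local_copy)
  then interpret indexed_local_copy k m s0 h R len A len' A' st val T ?X p .
  have "p (Suc i) (value_of 0 i) = val 0 i"
    using p_value[of 0 i "value_of 0 i"] v p_start[of 0 0] by simp
  then show ?thesis using is_run_initial(2)[OF copy.run i] p_start[of "Suc i" "value_of 0 i"] by simp
qed

lemma final_time: "A (Root halted_root) (Point 0 (len 0 - 1))"
proof -
  have len: "0 < len 0" using len_pos by simp
  then have "len 0 - 1 < len 0" by simp
  then obtain len' A' st val T p
    where "indexed_local_copy k m s0 h R len A len' A' st val T {Point 0 (len 0 - 1)} p"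
    by (rule point_0_copy)
  then interpret indexed_local_copy k m s0 h R len A len' A' st val T "{Point 0 (len 0 - 1)}" p .
  show ?thesis using p_halted[of "len 0 - 1"] p_end[of 0 "len 0 - 1"] copy.T_less len by simp
qed

lemma consecutive_times:
  assumes t: "Suc t < len 0" and running: "\<not> A (Root halted_root) (Point 0 t)"
  shows "A (Root halted_root) (Point 0 (Suc t)) \<Longrightarrow> state_of t = h"
    and "\<not> A (Root halted_root) (Point 0 (Suc t)) \<Longrightarrow> R (state_of t) (state_of (Suc t)) (\<lambda>i. value_of t i = 0)
      (\<lambda>i. int (value_of (Suc t) i) - int (value_of t i))"
proof -
  have t0: "t < len 0" using t by simp
  let ?V = "(\<lambda>i. Point (Suc i) (value_of t i)) ` {..<k} \<union> (\<lambda>i. Point (Suc i) (value_of (Suc t) i)) ` {..<k}"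
  let ?X = "{Point 0 t, Point 0 (Suc t)} \<union> ?V"
  have "card ?X \<le> card {Point 0 t, Point 0 (Suc t)} + (card {..<k} + card {..<k})"
    by (intro order_trans[OF card_Un_le] add_mono card_image_le order_refl) auto
  then have "?X \<subseteq> verts len" "?X \<inter> range Root = {}" "card ?X \<le> 2 * k + 3"
    using t value_of[OF t0] value_of[OF t] by auto
  then obtain len' A' st val T p where "indexed_local_copy k m s0 h R len A len' A' st val T ?X p"
    by (rule indexed_local_copy)
  then interpret indexed_local_copy k m s0 h R len A len' A' st val T ?X p .
  have times: "Point 0 t \<in> ?X" "Point 0 (Suc t) \<in> ?X" by auto
  have points: "Point (Suc i) (value_of t i) \<in> ?X" "Point (Suc i) (value_of (Suc t) i) \<in> ?X" if "i < k" for i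
    using that by auto
  have p_Suc_t: "p 0 (Suc t) = Suc (p 0 t)" using p_Suc[OF times] by simp
  have le: "p 0 t \<le> T" using running p_halted[OF times(1)] by simp
  show "state_of t = h" if "A (Root halted_root) (Point 0 (Suc t))"
    using that p_halted[OF times(2)] p_Suc_t le state_of_eq[OF times(1)] is_run_final[OF copy.run]
    by (simp add: le_less_Suc_eq)
  show "R (state_of t) (state_of (Suc t)) (\<lambda>i. value_of t i = 0) (\<lambda>i. int (value_of (Suc t) i) - int (value_of t i))"
    if "\<not> A (Root halted_root) (Point 0 (Suc t))"
  proof -
    have "p 0 t < T" using that p_halted[OF times(2)] p_Suc_t by simp
    then have step: "R (state_of t) (state_of (Suc t)) (\<lambda>i. val (p 0 t) i = 0)
        (\<lambda>i. int (val (p 0 (Suc t)) i) - int (val (p 0 t) i))"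
      using is_run_step[OF copy.run] p_Suc_t state_of_eq[OF times(1)] state_of_eq[OF times(2)] by simp
    have p_values: "p (Suc i) (value_of t i) = val (p 0 t) i"
      "p (Suc i) (value_of (Suc t) i) = val (p 0 (Suc t)) i"
      if "i < k" for i
      using p_value[OF times(1) points(1)[OF that]] p_value[OF times(2) points(2)[OF that]]
        value_of(2)[OF t0 that] value_of(2)[OF t that] by auto
    show ?thesis
    proof (rule R_cong[OF step])
      fix i assume i: "i < k"
      show "(value_of t i = 0) = (val (p 0 t) i = 0)"
        using p_start[OF points(1)[OF i]] p_values(1)[OF i] by simp
      show "int (value_of (Suc t) i) - int (value_of t i) = int (val (p 0 (Suc t)) i) - int (val (p 0 t) i)"
        using p_difference[OF points[OF i]] R_delta[OF step i] p_values[OF i] by simp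
    qed
  qed
qed

theorem accepts_initial_value: "accepts (value_of 0 0)"
proof -
  let ?halted = "\<lambda>t. A (Root halted_root) (Point 0 t)"
  define J where "J = (LEAST t. ?halted t)"
  have J: "?halted J" unfolding J_def using final_time by (rule LeastI)
  have running: "\<not> ?halted t" if "t < J" for t using that unfolding J_def by (rule not_less_Least)
  have "J \<le> len 0 - 1" unfolding J_def using final_time by (rule Least_le)
  then have J_less: "J < len 0" using len_pos[of 0] by simp
  obtain T where T: "J = Suc T" using J initial_time(2) by (cases J) auto
  have "is_run T state_of value_of"
    unfolding is_run_def
  proof (intro conjI allI impI)
    show "state_of 0 = s0" by (rule initial_time)
    show "state_of T = h" using consecutive_times(1)[of T] J running[of T] J_less T by simp
    show "value_of 0 i = 0" if "i < k" "0 < i" for i using initial_value that by blast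
    show "R (state_of t) (state_of (Suc t)) (\<lambda>i. value_of t i = 0)
      (\<lambda>i. int (value_of (Suc t) i) - int (value_of t i))" if "t < T" for t
      using consecutive_times(2)[of t] running[of t] running[of "Suc t"] that T J_less by simp
  qed
  then show ?thesis unfolding accepts_def by blast
qed

end

subsection \<open>The pathographs of the reduction\<close>

context machine
begin

text \<open>The vertex \<open>time_vertex\<close> is the initial time, \<open>value_vertex j\<close> the value \<open>j\<close> of counter \<open>0\<close>; both are
  explicitly given initial segments of the corresponding lines, and line \<open>i\<close> continues as the urpath
  \<open>root_count + i\<close>.  The flag \<open>b\<close> tells whether the initial value is \<open>n\<close> or larger than \<open>n\<close>.\<close>

definition time_vertex :: nat where "time_vertex = root_count + k + 1"
definition value_vertex :: "nat \<Rightarrow> nat" where "value_vertex j = time_vertex + 1 + j"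

definition explicit_vertices :: "nat \<Rightarrow> nat set" where
  "explicit_vertices n = {x. x < root_count \<or> time_vertex \<le> x \<and> x \<le> value_vertex n}"

definition arc :: "nat \<Rightarrow> bool \<Rightarrow> nat \<Rightarrow> nat \<Rightarrow> bool" where
  "arc n b x y \<longleftrightarrow> x < root_count \<and> y < root_count \<and> root_adj x y \<or>
     y = time_vertex \<and> (x = start_root 0 \<or> x = index_root 0 0 \<or> x = state_root s0) \<or>
     time_vertex < y \<and> (x = index_root 1 ((y - time_vertex - 1) mod 3) \<or>
         x = start_root 1 \<and> y = value_vertex 0 \<or>
       time_vertex < x \<and> y = Suc x) \<or>
     b \<and> x = time_vertex \<and> y = value_vertex n"

definition explicit_edges :: "nat \<Rightarrow> bool \<Rightarrow> nat set set" where
  "explicit_edges n b = {{x, y} | x y. x \<in> explicit_vertices n \<and> y \<in> explicit_vertices n \<and> arc n b x y}"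

definition line_start :: "nat \<Rightarrow> nat \<Rightarrow> nat" where
  "line_start n i = (if i = 0 then time_vertex else if i = 1 then value_vertex n else start_root i)"

definition line_offset :: "nat \<Rightarrow> nat \<Rightarrow> nat" where
  "line_offset n i = (if i = 0 then 1 else if i = 1 then Suc n else 0)"

definition input_pg :: "nat \<Rightarrow> bool \<Rightarrow> pathograph" where
  "input_pg n b = \<lparr>pV = explicit_vertices n, pU = {u. root_count \<le> u \<and>
      u \<le> root_count + k}, pE = explicit_edges n b,
     pS = {(x, u). root_count \<le> u \<and> u \<le> root_count + k \<and> (x < root_count \<and> label_of (u - root_count) x \<or>
       x = time_vertex \<and> root_count + 1 \<le> u \<and> (u = root_count + 1 \<longrightarrow> \<not> b) \<or>
       time_vertex < x \<and> x \<le> value_vertex n \<and> u = root_count)},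
     pR = {{root_count, u} | u. root_count + 1 \<le> u \<and> u \<le> root_count + k},
     ppi = (\<lambda>u. {line_start n (u - root_count), end_root (u - root_count)})\<rparr>"

definition prefix_pg :: "nat \<Rightarrow> bool \<Rightarrow> pathograph" where
  "prefix_pg n b = \<lparr>pV = explicit_vertices n, pU = {}, pE = explicit_edges n b, pS = {},
     pR = {}, ppi = (\<lambda>_. {})\<rparr>"

definition vert_of :: "nat \<Rightarrow> vert" where
  "vert_of x = (if x < root_count then Root x
     else if x = time_vertex then Point 0 0 else Point 1 (x - time_vertex - 1))"

definition line_ends :: "nat \<Rightarrow> nat \<Rightarrow> nat \<times> nat" where
  "line_ends n u = (line_start n (u - root_count), end_root (u - root_count))"

definition line_tail :: "nat \<Rightarrow> (nat \<Rightarrow> nat) \<Rightarrow> nat \<Rightarrow> vert list" where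
  "line_tail n len u = map (Point (u - root_count)) [line_offset n (u - root_count)..<len (u - root_count)]"

lemma input_pg_simps [simp]:
  "pV (input_pg n b) = explicit_vertices n" "pU (input_pg n b) = {u. root_count \<le> u \<and> u \<le> root_count + k}"
  "pE (input_pg n b) = explicit_edges n b"
  "pR (input_pg n b) = {{root_count, u} | u. root_count + 1 \<le> u \<and> u \<le> root_count + k}"
  "ppi (input_pg n b) u = {line_start n (u - root_count), end_root (u - root_count)}"
  by (simp_all add: input_pg_def)

lemma prefix_pg_simps [simp]:
  "pV (prefix_pg n b) = explicit_vertices n" "pU (prefix_pg n b) = {}"
    "pE (prefix_pg n b) = explicit_edges n b"
  by (simp_all add: prefix_pg_def)

lemma time_vertex_gt: "root_count < time_vertex"
  by (simp add: time_vertex_def)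

lemma value_vertex_eq_iff [simp]: "value_vertex j = value_vertex j' \<longleftrightarrow> j = j'"
  and value_vertex_neq [simp]: "value_vertex j \<noteq> time_vertex" "time_vertex \<noteq> value_vertex j"
  and not_root [simp]: "\<not> time_vertex < root_count" "\<not> value_vertex j < root_count"
  by (auto simp: value_vertex_def time_vertex_def)

lemma explicit_cases [consumes 1, case_names root time val]:
  assumes "x \<in> explicit_vertices n"
  obtains "x < root_count" | "x = time_vertex" | j where "j \<le> n" "x = value_vertex j"
proof -
  consider "x < root_count" | "x = time_vertex" | "time_vertex < x" "x \<le> value_vertex n"
    using assms unfolding explicit_vertices_def mem_Collect_eq by linarith
  then show thesis
  proof cases
    case 3
    then show ?thesis using that(3)[of "x - time_vertex - 1"] by (auto simp: value_vertex_def)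
  qed (use that in auto)
qed

lemma explicit_vertices_mem [simp]:
  "x < root_count \<Longrightarrow> x \<in> explicit_vertices n" "time_vertex \<in> explicit_vertices n"
  "value_vertex j \<in> explicit_vertices n \<longleftrightarrow> j \<le> n"
  by (auto simp: explicit_vertices_def value_vertex_def time_vertex_def)

lemma finite_explicit_vertices: "finite (explicit_vertices n)"
  by (rule finite_subset[of _ "{..value_vertex n}"])
    (auto simp: explicit_vertices_def value_vertex_def time_vertex_def)

lemma vert_of_simps [simp]:
  "x < root_count \<Longrightarrow> vert_of x = Root x" "vert_of time_vertex = Point 0 0"
    "vert_of (value_vertex j) = Point 1 j"
  by (auto simp: vert_of_def) (simp add: value_vertex_def)

lemma prefix_roots_less:
  "index_root 0 0 < root_count" "index_root 1 (j mod 3) < root_count" "state_root s0 < root_count"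
  "start_root 0 < root_count" "start_root 1 < root_count"
  using index_root_less_root_count[of 0 0] index_root_less_root_count[of 1 "j mod 3"] k_pos
    label_of_less[OF label_of_state_root[OF s0_less]] clique_size_root_count(1) start_root_less[of 0]
    start_root_less[of 1]
  by auto

lemma arc_simps [simp]:
  "x < root_count \<Longrightarrow> y < root_count \<Longrightarrow> arc n b x y \<longleftrightarrow> root_adj x y"
  "x < root_count \<Longrightarrow> arc n b x time_vertex \<longleftrightarrow> x = start_root 0 \<or> x = index_root 0 0 \<or> x = state_root s0"
  "x < root_count \<Longrightarrow> \<not> arc n b time_vertex x"
  "x < root_count \<Longrightarrow> arc n b x (value_vertex j) \<longleftrightarrow> x = index_root 1 (j mod 3) \<or> x = start_root 1 \<and> j = 0"
  "x < root_count \<Longrightarrow> \<not> arc n b (value_vertex j) x"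
  "\<not> arc n b time_vertex time_vertex"
  "arc n b time_vertex (value_vertex j) \<longleftrightarrow> b \<and> j = n"
  "\<not> arc n b (value_vertex j) time_vertex"
  "arc n b (value_vertex j) (value_vertex j') \<longleftrightarrow> j' = Suc j"
  using prefix_roots_less(1,3-5) prefix_roots_less(2)[of j] prefix_roots_less(2)[of j'] time_vertex_gt
  unfolding arc_def value_vertex_def by auto

lemma arc_irrefl: "x \<in> explicit_vertices n \<Longrightarrow> \<not> arc n b x x"
  by (cases rule: explicit_cases, assumption) (auto simp: root_adj_irrefl)

lemma explicit_edge_iff:
  "x \<in> explicit_vertices n \<Longrightarrow> y \<in> explicit_vertices n \<Longrightarrow>
      {x, y} \<in> explicit_edges n b \<longleftrightarrow> arc n b x y \<or> arc n b y x"
  by (auto simp: explicit_edges_def doubleton_eq_iff)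

lemma explicit_edges_subset: "explicit_edges n b \<subseteq> {e. e \<subseteq> explicit_vertices n \<and> card e = 2}"
proof
  fix e assume "e \<in> explicit_edges n b"
  then obtain x y where e: "e = {x, y}" "x \<in> explicit_vertices n" "y \<in> explicit_vertices n" "arc n b x y"
    by (auto simp: explicit_edges_def)
  then have "x \<noteq> y" using arc_irrefl by auto
  then show "e \<in> {e. e \<subseteq> explicit_vertices n \<and> card e = 2}" using e by auto
qed

lemma wf_prefix_pg: "wf_pathograph (prefix_pg n b)"
  using explicit_edges_subset finite_explicit_vertices by (simp add: wf_pathograph_def prefix_pg_def)

lemma spoke_iff:
  assumes "i \<le> k"
  shows "x < root_count \<Longrightarrow> (x, root_count + i) \<in> pS (input_pg n b) \<longleftrightarrow> label_of i x"
    "(time_vertex, root_count + i) \<in> pS (input_pg n b) \<longleftrightarrow> 0 < i \<and> (i = 1 \<longrightarrow> \<not> b)"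
    "(value_vertex j, root_count + i) \<in> pS (input_pg n b) \<longleftrightarrow> j \<le> n \<and> i = 0"
  using assms by (auto simp: input_pg_def value_vertex_def time_vertex_def)

lemma rung_iff: "i \<le> k \<Longrightarrow> i' \<le> k \<Longrightarrow> {root_count + i, root_count + i'} \<in> pR (input_pg n b) \<longleftrightarrow>
    i \<noteq> i' \<and> (i = 0 \<or> i' = 0)"
  by (auto simp: doubleton_eq_iff)

lemma line_start_explicit [simp]: "i \<le> k \<Longrightarrow> line_start n i \<in> explicit_vertices n"
  using start_root_less[of i] by (auto simp: line_start_def)

lemma end_root_explicit [simp]: "i \<le> k \<Longrightarrow> end_root i \<in> explicit_vertices n"
  using end_root_less by simp

lemma line_ends_nonadjacent:
  assumes i: "i \<le> k" shows "line_start n i \<noteq> end_root i" "{line_start n i, end_root i} \<notin> explicit_edges n b"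
proof -
  show "line_start n i \<noteq> end_root i"
    using end_root_less[OF i] start_root_neq_end_root not_root by (metis line_start_def)
  have "label_of 0 (index_root 0 0)" "label_of 1 (index_root 1 (n mod 3))" "label_of 0 (state_root s0)"
    using s0_less by (simp_all add: label_of_index_root label_of_state_root)
  then have "end_root i \<noteq> index_root 0 0" "end_root i \<noteq> index_root 1 (n mod 3)" "end_root i \<noteq> state_root s0"
    using label_of_neq(2) k_pos by (metis One_nat_def Suc_leI zero_le)+
  moreover have "\<not> root_adj (start_root i) (end_root i)" "\<not> root_adj (end_root i) (start_root i)"
    using start_root_ge[of i] end_root_ge[of i] by (auto simp: root_adj_def)
  moreover have "end_root i \<noteq> start_root 0" "end_root i \<noteq> start_root 1"
    using start_root_neq_end_root by metis+
  ultimately have "\<not> arc n b (line_start n i) (end_root i)" "\<not> arc n b (end_root i) (line_start n i)"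
    using start_root_less[OF i] end_root_less[OF i] by (auto simp: line_start_def)
  then show "{line_start n i, end_root i} \<notin> explicit_edges n b" using explicit_edge_iff i by simp
qed

lemma wf_input_pg: "wf_pathograph (input_pg n b)"
  unfolding wf_pathograph_def
proof (intro conjI ballI)
  show "pE (input_pg n b) \<subseteq> {e. e \<subseteq> pV (input_pg n b) \<and> card e = 2}" using explicit_edges_subset by simp
  show "pV (input_pg n b) \<inter> pU (input_pg n b) = {}" by (auto simp: explicit_vertices_def time_vertex_def)
  show "pS (input_pg n b) \<subseteq> pV (input_pg n b) \<times> pU (input_pg n b)"
    by (auto simp: input_pg_def explicit_vertices_def value_vertex_def)
  show "pR (input_pg n b) \<subseteq> {r. r \<subseteq> pU (input_pg n b) \<and> card r = 2}" by auto
  show "finite (pV (input_pg n b))" "finite (pU (input_pg n b))" using finite_explicit_vertices by simp_all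
  fix u assume "u \<in> pU (input_pg n b)"
  then have i: "u - root_count \<le> k" by auto
  show "ppi (input_pg n b) u \<subseteq> pV (input_pg n b)" "card (ppi (input_pg n b) u) = 2"
    "ppi (input_pg n b) u \<notin> pE (input_pg n b)"
    using i line_ends_nonadjacent[OF i] by simp_all
qed

lemma orients_line_ends: "orients (line_ends n) (input_pg n b)"
  by (simp add: orients_def line_ends_def)

lemma vert_of_eq_Root: "x \<in> explicit_vertices n \<Longrightarrow> vert_of x = Root y \<longleftrightarrow> x = y \<and> y < root_count"
  and vert_of_eq_Point: "x \<in> explicit_vertices n \<Longrightarrow>
    vert_of x = Point i j \<longleftrightarrow> x = time_vertex \<and> i = 0 \<and> j = 0 \<or> x = value_vertex j \<and> i = 1 \<and> j \<le> n"
  by (cases rule: explicit_cases, assumption; auto)+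

lemma inj_on_vert_of: "inj_on vert_of (explicit_vertices n)"
proof (rule inj_onI)
  fix x y assume "x \<in> explicit_vertices n" "y \<in> explicit_vertices n" "vert_of x = vert_of y"
  then show "x = y" by (cases "vert_of y") (auto simp: vert_of_eq_Root vert_of_eq_Point)
qed

lemma vert_of_verts:
  assumes "0 < len 0" "n < len 1" "x \<in> explicit_vertices n" shows "vert_of x \<in> verts len"
  using assms(3) by (rule explicit_cases) (use assms(1,2) k_pos in auto)

lemma vert_of_neq_tail: "x \<in> explicit_vertices n \<Longrightarrow> line_offset n i \<le> j \<Longrightarrow> vert_of x \<noteq> Point i j"
  by (auto simp: vert_of_eq_Point line_offset_def split: if_splits)

lemma verts_cases [consumes 1, case_names explicit tail]:
  assumes "u \<in> verts len"
  obtains x where "x \<in> explicit_vertices n" "u = vert_of x"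
  | i j where "i \<le> k" "line_offset n i \<le> j" "j < len i" "u = Point i j"
proof (cases u)
  case (Root x)
  then show ?thesis using that(1)[of x] assms by simp
next
  case (Point i j)
  show ?thesis
  proof (cases "line_offset n i \<le> j")
    case True
    then show ?thesis using that(2) assms Point by simp
  next
    case False
    then consider "i = 0" "j = 0" | "i = 1" "j \<le> n" by (auto simp: line_offset_def split: if_splits)
    then show ?thesis using that(1)[of time_vertex] that(1)[of "value_vertex j"] Point by cases auto
  qed
qed

lemma set_line_tail: "set (line_tail n len (root_count + i)) = Point i ` {line_offset n i..<len i}"
  by (simp add: line_tail_def)

lemma urpath_line:
  assumes "i \<le> k"
  shows "urpath (line_ends n) vert_of (line_tail n len) (root_count + i) =
    vert_of (line_start n i) # map (Point i) [line_offset n i..<len i] @ [Root (end_root i)]"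
  using end_root_less[OF assms] by (simp add: urpath_def line_ends_def line_tail_def)

lemma placement_verts:
  assumes offset: "\<And>i. i \<le> k \<Longrightarrow> line_offset n i < len i"
  shows "placement (input_pg n b) (verts len) vert_of (line_tail n len)"
proof
  have len: "0 < len 0" "n < len 1"
    using offset[of 0] offset[of 1] k_pos by (auto simp: line_offset_def)
  show "verts len = vert_of ` pV (input_pg n b) \<union> (\<Union>u\<in>pU (input_pg n b). set (line_tail n len u))"
  proof (intro set_eqI iffI)
    fix u assume "u \<in> verts len"
    then show "u \<in> vert_of ` pV (input_pg n b) \<union> (\<Union>u\<in>pU (input_pg n b). set (line_tail n len u))"
    proof (cases rule: verts_cases[where n = n])
      case (tail i j)
      then have "u \<in> set (line_tail n len (root_count + i))" by (simp add: set_line_tail)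
      then show ?thesis using tail(1) by (intro UnI2 UN_I[of "root_count + i"]) auto
    qed auto
  qed (auto simp: line_tail_def vert_of_verts[OF len])
  show "inj_on vert_of (pV (input_pg n b))" using inj_on_vert_of by simp
  show "vert_of v \<notin> set (line_tail n len u)" if "v \<in> pV (input_pg n b)" for u v
    using vert_of_neq_tail that by (auto simp: line_tail_def)
  show "line_tail n len u \<noteq> []" if "u \<in> pU (input_pg n b)" for u
  proof -
    have "u - root_count \<le> k" using that by auto
    from offset[OF this] show ?thesis by (simp add: line_tail_def)
  qed
qed (auto simp: line_tail_def distinct_map inj_on_def)

lemma drawing_of_realization:
  assumes "realization (input_pg n b) W EG"
  obtains f len A where "drawing (verts len) A f W EG"
    "realizes (input_pg n b) (line_ends n) (verts len) A vert_of (line_tail n len)"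
proof -
  note wf = wf_input_pg orients_line_ends
  obtain \<phi> P where realizes: "realizes (input_pg n b) (line_ends n) W (\<lambda>x y. {x, y} \<in> EG) \<phi> P"
    using assms wf by (rule realization_imp_realizes)
  interpret realizes "input_pg n b" "line_ends n" W "\<lambda>x y. {x, y} \<in> EG" \<phi> P by (rule realizes)
  define len where "len = (\<lambda>i. line_offset n i + length (P (root_count + i)))"
  have "line_offset n i < len i" if "i \<le> k" for i
    using path_nonempty[of "root_count + i"] that by (simp add: len_def)
  then have "placement (input_pg n b) (verts len) vert_of (line_tail n len)" by (rule placement_verts)
  moreover have "length (P u) = length (line_tail n len u)" if "u \<in> pU (input_pg n b)" for u
    using that by (simp add: line_tail_def len_def)
  ultimately obtain f where f: "bij_betw f (verts len) W"
    and "realizes (input_pg n b) (line_ends n) (verts len)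
      (\<lambda>x y. x \<in> verts len \<and> y \<in> verts len \<and> {f x, f y} \<in> EG) vert_of (line_tail n len)"
    by (rule realizes_transport[OF realizes wf])
  moreover have "drawing (verts len) (\<lambda>x y. x \<in> verts len \<and> y \<in> verts len \<and> {f x, f y} \<in> EG) f W EG"
    using assms f by (intro drawing_pullback) (simp_all add: realization_def)
  ultimately show thesis using that by blast
qed

context
  fixes n :: nat and b :: bool and len :: "nat \<Rightarrow> nat" and A :: "vert \<Rightarrow> vert \<Rightarrow> bool"
  assumes realizes: "realizes (input_pg n b) (line_ends n) (verts len) A vert_of (line_tail n len)"
    and sym: "\<And>u w. A u w \<Longrightarrow> A w u" and irrefl: "\<And>u. \<not> A u u"
begin

interpretation realizes "input_pg n b" "line_ends n" "verts len" A vert_of "line_tail n len"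
  by (rule realizes)

lemma line_offset_less:
  assumes "i \<le> k" shows "line_offset n i < len i"
  using path_nonempty[of "root_count + i"] assms by (simp add: line_tail_def)

lemma explicit_adj:
  "x \<in> explicit_vertices n \<Longrightarrow> y \<in> explicit_vertices n \<Longrightarrow> A (vert_of x) (vert_of y) \<longleftrightarrow> arc n b x y \<or> arc n b y x"
  using explicit_adj_iff[OF wf_input_pg orients_line_ends, of x y] explicit_edge_iff[of x n y b] by simp

lemma explicit_tail_adj:
  assumes x: "x \<in> explicit_vertices n" and i: "i \<le> k" and j: "line_offset n i \<le> j" "j < len i"
    and "A (vert_of x) (Point i j)"
  shows "x = line_start n i \<and> j = line_offset n i \<or> x = end_root i \<and> Suc j = len i \<or>
      (x, root_count + i) \<in> pS (input_pg n b)"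
proof -
  have "Point i j \<in> set (line_tail n len (root_count + i))" using j by (simp add: set_line_tail)
  moreover have "hd (line_tail n len (root_count + i)) = Point i (line_offset n i)"
    "last (line_tail n len (root_count + i)) = Point i (len i - 1)"
    using line_offset_less[OF i] by (simp_all add: line_tail_def hd_map last_map)
  ultimately show ?thesis
    using explicit_internal_adj[OF wf_input_pg orients_line_ends, of x "root_count + i" "Point i j"] assms
    by (auto simp: line_ends_def)
qed

lemma tail_tail_adj:
  assumes "i \<le> k" "line_offset n i \<le> j" "j < len i" and "i' \<le> k" "line_offset n i' \<le> j'" "j' < len i'"
    and "A (Point i j) (Point i' j')"
  shows "i = i' \<and> (j' = Suc j \<or> j = Suc j') \<or> i \<noteq> i' \<and> (i = 0 \<or> i' = 0)"
proof -
  have "Point i j \<in> set (line_tail n len (root_count + i))"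
    "Point i' j' \<in> set (line_tail n len (root_count + i'))"
    using assms by (simp_all add: set_line_tail)
  then show ?thesis
    using internal_adj[OF wf_input_pg orients_line_ends, of "root_count + i" "root_count + i'" "Point i j"
      "Point i' j'"]
      assms rung_iff[of i i']
      by (auto simp: line_tail_def consecutive_map consecutive_upt simp del: input_pg_simps(4))
qed

lemma explicit_Point_adj:
  assumes x: "x \<in> explicit_vertices n" "vert_of x = Point i j"
    and i: "i' \<le> k" "line_offset n i' \<le> j'" "j' < len i'"
    and adj: "A (Point i j) (Point i' j')"
  shows "i = i' \<and> j' = Suc j \<or> i \<noteq> i' \<and> (i = 0 \<or> i' = 0)"
proof -
  have x_eq: "x = time_vertex \<and> i = 0 \<and> j = 0 \<or> x = value_vertex j \<and> i = 1 \<and> j \<le> n"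
    using x vert_of_eq_Point by simp
  then have "x \<noteq> start_root i'" "x \<noteq> end_root i'"
    using start_root_less[OF i(1)] end_root_less[OF i(1)] by auto
  moreover have "A (vert_of x) (Point i' j')" using adj x(2) by simp
  ultimately have "x = line_start n i' \<and> i' \<le> 1 \<and> j' = line_offset n i' \<or>
      (x, root_count + i') \<in> pS (input_pg n b)"
    using explicit_tail_adj[OF x(1) i] by (auto simp: line_start_def split: if_splits)
  with x_eq show ?thesis
    using spoke_iff(2,3)[OF i(1)] by (elim disjE) (auto simp: line_start_def line_offset_def split: if_splits)
qed

lemma points_adj:
  assumes ij: "i \<le> k" "j < len i" and ij': "i' \<le> k" "j' < len i'" and adj: "A (Point i j) (Point i' j')"
  shows "i = i' \<and> (j' = Suc j \<or> j = Suc j') \<or> i \<noteq> i' \<and> (i = 0 \<or> i' = 0)"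
proof -
  have verts: "Point i j \<in> verts len" "Point i' j' \<in> verts len" using ij ij' by simp_all
  from verts(1) show ?thesis
  proof (cases rule: verts_cases[where n = n])
    case (explicit x)
    note x = this
    from verts(2) show ?thesis
    proof (cases rule: verts_cases[where n = n])
      case (explicit y)
      have "x = time_vertex \<and> i = 0 \<and> j = 0 \<or> x = value_vertex j \<and> i = 1 \<and> j \<le> n"
        "y = time_vertex \<and> i' = 0 \<and> j' = 0 \<or> y = value_vertex j' \<and> i' = 1 \<and> j' \<le> n"
        using vert_of_eq_Point[OF x(1)] vert_of_eq_Point[OF explicit(1)] x(2) explicit(2) by metis+
      moreover have "arc n b x y \<or> arc n b y x"
        using explicit_adj[OF x(1) explicit(1)] adj unfolding x(2) explicit(2) by simp
      ultimately show ?thesis by auto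
    next
      case (tail i1 j1)
      then show ?thesis using explicit_Point_adj[OF x(1) x(2)[symmetric]] adj by auto
    qed
  next
    case (tail i1 j1)
    note tail_ij = this
    from verts(2) show ?thesis
    proof (cases rule: verts_cases[where n = n])
      case (explicit y)
      then show ?thesis
        using explicit_Point_adj[OF explicit(1) explicit(2)[symmetric], of i j] tail_ij sym[OF adj] by auto
    next
      case (tail i2 j2)
      then show ?thesis using tail_tail_adj[of i j i' j'] tail_ij adj by auto
    qed
  qed
qed

lemma urpath_adj:
  assumes i: "i \<le> k"
  shows "A (vert_of (line_start n i)) (Point i (line_offset n i))"
    "A (Point i (len i - 1)) (Root (end_root i))"
    "line_offset n i \<le> j \<Longrightarrow> Suc j < len i \<Longrightarrow> A (Point i j) (Point i (Suc j))"
proof -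
  have "successively A (vert_of (line_start n i) #
      map (Point i) [line_offset n i..<len i] @ [Root (end_root i)])"
    using paths[of "root_count + i"] i by (simp add: urpath_line)
  then show "A (vert_of (line_start n i)) (Point i (line_offset n i))"
    "A (Point i (len i - 1)) (Root (end_root i))"
    "line_offset n i \<le> j \<Longrightarrow> Suc j < len i \<Longrightarrow> A (Point i j) (Point i (Suc j))"
    unfolding successively_iff_consecutive consecutive_ends_map_upt[OF line_offset_less[OF i]] by blast+
qed

lemma step_adj:
  assumes i: "i \<le> k" and j: "Suc j < len i" shows "A (Point i j) (Point i (Suc j))"
proof -
  consider "line_offset n i \<le> j" | "Suc j = line_offset n i" | "Suc j < line_offset n i" by linarith
  then show ?thesis
  proof cases
    case 1
    then show ?thesis using urpath_adj(3)[OF i] j by simp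
  next
    case 2
    then have "vert_of (line_start n i) = Point i j"
      by (auto simp: line_offset_def line_start_def split: if_splits)
    then show ?thesis using urpath_adj(1)[OF i] 2 by simp
  next
    case 3
    then have "i = 1" "Suc j \<le> n" by (auto simp: line_offset_def split: if_splits)
    then show ?thesis using explicit_adj[of "value_vertex j" "value_vertex (Suc j)"] by simp
  qed
qed

lemma root_point_adj:
  assumes x: "x < root_count" and i: "i \<le> k" "j < len i" and adj: "A (Root x) (Point i j)"
  shows "x = start_root i \<and> j = 0 \<or> x = end_root i \<and> Suc j = len i \<or> label_of i x"
proof -
  have "Point i j \<in> verts len" using i by simp
  then show ?thesis
  proof (cases rule: verts_cases[where n = n])
    case (explicit y)
    then have "y = time_vertex \<and> i = 0 \<and> j = 0 \<or> y = value_vertex j \<and> i = 1 \<and> j \<le> n"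
      using vert_of_eq_Point by metis
    moreover have "arc n b x y \<or> arc n b y x"
      using explicit_adj[OF _ explicit(1), of x] x adj unfolding explicit(2) by simp
    ultimately show ?thesis
      using x label_of_index_root[of 0 0] label_of_index_root[of "j mod 3" 1] label_of_state_root[OF s0_less]
      by auto
  next
    case (tail i' j')
    then show ?thesis
      using explicit_tail_adj[of x i j] x adj spoke_iff(1)[OF i(1) x]
      by (auto simp: line_start_def line_offset_def split: if_splits)
  qed
qed

theorem layout_of_realizes: "layout k m s0 h R len A"
proof (intro layout.intro layout_axioms.intro machine_axioms)
  show "A (Root x) (Root y) \<longleftrightarrow> root_adj x y" if "x < root_count" "y < root_count" for x y
    using explicit_adj[of x y] that root_adj_sym by simp
  show "A (Point i j) (Point i j') \<longleftrightarrow> j' = Suc j \<or> j = Suc j'" if "i \<le> k" "j < len i" "j' < len i" for i j j'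
    using points_adj[OF that(1,2,1,3)] step_adj[OF that(1)] sym that(2,3) by blast
  show "\<not> A (Point i j) (Point i' j')"
    if "0 < i" "0 < i'" "i \<noteq> i'" "i \<le> k" "i' \<le> k" "j < len i" "j' < len i'" for i i' j j'
    using points_adj[of i j i' j'] that by auto
  show "A (Root (start_root i)) (Point i 0)" if i: "i \<le> k" for i
  proof -
    consider "i = 0" | "i = 1" | "2 \<le> i" by linarith
    then show ?thesis
    proof cases
      case 1
      then show ?thesis using explicit_adj[of "start_root 0" time_vertex] prefix_roots_less by simp
    next
      case 2
      then show ?thesis using explicit_adj[of "start_root 1" "value_vertex 0"] prefix_roots_less by simp
    next
      case 3
      then show ?thesis using urpath_adj(1)[OF i] start_root_less[OF i]
        by (simp add: line_start_def line_offset_def)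
    qed
  qed
  show "0 < len i" if "i \<le> k" for i using line_offset_less[OF that] by simp
  show "\<exists>j<len i. A (Root (index_root i r)) (Point i j)" if "i \<le> k" "r < 3" for i r
  proof -
    have root: "index_root i r < root_count" by (rule index_root_less_root_count[OF that])
    then have "(index_root i r, root_count + i) \<in> pS (input_pg n b)"
      using spoke_iff(1)[OF that(1)] label_of_index_root[OF that(2)] by simp
    from spokes[OF this] show ?thesis using root unfolding set_line_tail by auto
  qed
qed (use sym irrefl urpath_adj(2) root_point_adj in auto)

lemma initial_value_adj:
  assumes "b" "j < len 1" shows "A (Point 0 0) (Point 1 j) \<longleftrightarrow> j = n"
proof (cases "j \<le> n")
  case True
  then show ?thesis using explicit_adj[of time_vertex "value_vertex j"] assms by simp
next
  case False
  moreover have "1 \<le> k" using k_pos by simp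
  ultimately show ?thesis
    using explicit_tail_adj[of time_vertex 1 j] assms end_root_less[of 1] time_vertex_gt
      spoke_iff(2)[of 1 n b]
    by (auto simp: line_start_def line_offset_def)
qed

end

end

subsection \<open>From runs to realizations\<close>

context labelled_layout
begin

lemma initial_time_roots:
  assumes "x < root_count" "Suc 0 < len 0" "st 0 = s0" "\<not> A (Root halted_root) (Point 0 0)"
  shows "A (Root x) (Point 0 0) \<longleftrightarrow> x = start_root 0 \<or> x = index_root 0 0 \<or> x = state_root s0"
proof
  assume "A (Root x) (Point 0 0)"
  then consider "x = start_root 0" | "label_of 0 x"
    using adj_root_point[of x 0 0] assms(1,2) by auto
  then show "x = start_root 0 \<or> x = index_root 0 0 \<or> x = state_root s0"
  proof cases
    case 2
    then show ?thesis
      using label_neighbours[of 0 0 x] assms \<open>A (Root x) (Point 0 0)\<close> by auto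
  qed simp
next
  assume "x = start_root 0 \<or> x = index_root 0 0 \<or> x = state_root s0"
  then show "A (Root x) (Point 0 0)"
    using adj_start[of 0] adj_index[of 0 0 0] adj_state[of 0 s0] s0_less assms(2,3) by auto
qed

lemma value_roots:
  assumes "x < root_count" "Suc j < len 1"
  shows "A (Root x) (Point 1 j) \<longleftrightarrow> x = index_root 1 (j mod 3) \<or> x = start_root 1 \<and> j = 0"
proof
  have k: "1 \<le> k" using k_pos by simp
  {
    assume adj: "A (Root x) (Point 1 j)"
    then consider "x = start_root 1" "j = 0" | r where "r < 3" "x = index_root 1 r"
      using adj_root_point[OF assms(1) k, of j] assms(2) by (auto simp: label_of_def)
    then show "x = index_root 1 (j mod 3) \<or> x = start_root 1 \<and> j = 0"
      using adj_index[OF k, of j] adj assms(2) by cases auto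
  }
  assume "x = index_root 1 (j mod 3) \<or> x = start_root 1 \<and> j = 0"
  then show "A (Root x) (Point 1 j)"
    using adj_start[OF k] adj_index[OF k, of j "j mod 3"] assms(2) by auto
qed

lemma explicit_adj_iff:
  assumes len: "Suc 0 < len 0" "Suc n < len 1"
    and initial: "st 0 = s0" "\<not> A (Root halted_root) (Point 0 0)"
    and val: "\<And>j. j \<le> n \<Longrightarrow> val 0 0 = j \<longleftrightarrow> b \<and> j = n"
    and xy: "x \<in> explicit_vertices n" "y \<in> explicit_vertices n"
  shows "A (vert_of x) (vert_of y) \<longleftrightarrow> arc n b x y \<or> arc n b y x"
proof -
  have sym: "A u w \<longleftrightarrow> A w u" for u w using adj_sym by blast
  have roots_time: "A (Root z) (Point 0 0) \<longleftrightarrow> z = start_root 0 \<or> z = index_root 0 0 \<or> z = state_root s0"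
    if "z < root_count" for z
    using that len(1) initial by (rule initial_time_roots)
  have roots_value: "A (Root z) (Point 1 j) \<longleftrightarrow> z = index_root 1 (j mod 3) \<or> z = start_root 1 \<and> j = 0"
    if "z < root_count" "j \<le> n" for z j
    using value_roots[OF that(1), of j] that(2) len(2) by simp
  have time_value: "A (Point 0 0) (Point 1 j) \<longleftrightarrow> b \<and> j = n" if "j \<le> n" for j
    using adj_value[of 0 0 j] val[OF that] that len k_pos by auto
  have value_line: "A (Point 1 j) (Point 1 j') \<longleftrightarrow> j' = Suc j \<or> j = Suc j'" if "j \<le> n" "j' \<le> n" for j j'
    using adj_line[of 1 j j'] that len(2) k_pos by simp
  show ?thesis
    using xy(1)
  proof (cases rule: explicit_cases)
    case root
    from xy(2) show ?thesis
      by (cases rule: explicit_cases) (use root adj_root root_adj_sym[of x y] roots_time roots_value in auto)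
  next
    case time
    from xy(2) show ?thesis
      by (cases rule: explicit_cases) (use time adj_irrefl sym[of "Point 0 0"] roots_time time_value in auto)
  next
    case (val j)
    from xy(2) show ?thesis
      by (cases rule: explicit_cases) (use val sym[of "Point 1 j"] roots_value time_value value_line in auto)
  qed
qed

end

context layout
begin

context
  fixes n :: nat and b :: bool
  assumes explicit_arcs: "\<And>x y. x \<in> explicit_vertices n \<Longrightarrow> y \<in> explicit_vertices n
      \<Longrightarrow> A (vert_of x) (vert_of y) \<longleftrightarrow> arc n b x y \<or> arc n b y x"
    and offset: "\<And>i. i \<le> k \<Longrightarrow> line_offset n i < len i"
    and no_later_value: "\<And>j. b \<Longrightarrow> n < j \<Longrightarrow> j < len 1 \<Longrightarrow> \<not> A (Point 0 0) (Point 1 j)"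
begin

abbreviation linked_input :: "vert \<Rightarrow> vert \<Rightarrow> bool" where
  "linked_input \<equiv> linked (input_pg n b) (line_ends n) vert_of (line_tail n len)"

lemma linked_line:
  assumes "i \<le> k"
    and "consecutive (vert_of (line_start n i) #
      map (Point i) [line_offset n i..<len i] @ [Root (end_root i)]) u w"
  shows "linked_input u w"
  by (rule linked.path[of "root_count + i"]) (use assms urpath_line in auto)

lemma linked_tail_spoke:
  assumes "(x, root_count + i) \<in> pS (input_pg n b)" "line_offset n i \<le> j" "j < len i"
  shows "linked_input (vert_of x) (Point i j)"
  using assms by (intro linked.spoke[of _ "root_count + i"]) (auto simp: set_line_tail)

lemma linked_explicit_tail:
  assumes x: "x \<in> explicit_vertices n" and i: "i \<le> k" and j: "line_offset n i \<le> j" "j < len i"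
    and adj: "A (vert_of x) (Point i j)"
  shows "linked_input (vert_of x) (Point i j) \<or> linked_input (Point i j) (vert_of x)"
proof (cases "(x, root_count + i) \<in> pS (input_pg n b)")
  case True
  then show ?thesis using linked_tail_spoke j by simp
next
  case False
  note line = consecutive_ends_map_upt[OF offset[OF i], of "vert_of (line_start n i)" "Point i"
    "Root (end_root i)"]
  have "x = line_start n i \<and> j = line_offset n i \<or> x = end_root i \<and> Suc j = len i"
    using x
  proof (cases rule: explicit_cases)
    case root
    then show ?thesis
      using adj_root_point[OF root i j(2)] adj False spoke_iff(1)[OF i root] j(1)
      by (auto simp: line_start_def line_offset_def split: if_splits)
  next
    case time
    then show ?thesis
      using adj_line[of 0 0 j] no_later_value[of j] adj False spoke_iff(2)[OF i] j
      by (cases "i = 0") (auto simp: line_start_def line_offset_def split: if_splits)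
  next
    case (val j')
    then have "i = 1"
      using adj_value_lines[of 1 i j' j] adj False spoke_iff(3)[OF i] i j offset[of 1] k_pos
      by (auto simp: line_offset_def)
    then show ?thesis
      using adj_line[of 1 j' j] val adj i j by (auto simp: line_start_def line_offset_def)
  qed
  then show ?thesis using linked_line[OF i] end_root_less[OF i] unfolding line by auto
qed

lemma linked_tails:
  assumes i: "i \<le> k" "line_offset n i \<le> j" "j < len i" and i': "i' \<le> k" "line_offset n i' \<le> j'" "j' < len i'"
    and adj: "A (Point i j) (Point i' j')"
  shows "linked_input (Point i j) (Point i' j') \<or> linked_input (Point i' j') (Point i j)"
proof (cases "i = i'")
  case True
  then have "j' = Suc j \<or> j = Suc j'" using adj_line[of i j j'] i i' adj by simp
  then show ?thesis
    using linked_line[OF i(1)] i i' True unfolding consecutive_ends_map_upt[OF offset[OF i(1)]] by blast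
next
  case False
  then have "i = 0 \<or> i' = 0" using adj_value_lines[of i i' j j'] i i' adj by auto
  then have "{root_count + i, root_count + i'} \<in> pR (input_pg n b)" using rung_iff False i i' by blast
  then have "linked_input (Point i j) (Point i' j')"
    by (rule linked.rung) (use i i' in \<open>auto simp: set_line_tail\<close>)
  then show ?thesis ..
qed

lemma linked_verts:
  assumes "u \<in> verts len" "w \<in> verts len" "A u w" shows "linked_input u w \<or> linked_input w u"
  using assms(1)
proof (cases rule: verts_cases[where n = n])
  case (explicit x)
  note x = this
  from assms(2) show ?thesis
  proof (cases rule: verts_cases[where n = n])
    case (explicit y)
    then have "{x, y} \<in> pE (input_pg n b)"
      using explicit_arcs[OF x(1) explicit(1)] x explicit_edge_iff[of x n y b] assms(3) by simp
    then show ?thesis unfolding x(2) explicit(2) by (intro disjI1 linked.edge)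
  next
    case (tail i j)
    then show ?thesis using linked_explicit_tail[of x i j] x assms(3) by simp
  qed
next
  case (tail i j)
  note u = this
  from assms(2) show ?thesis
  proof (cases rule: verts_cases[where n = n])
    case (explicit y)
    then show ?thesis using linked_explicit_tail[of y i j] u adj_sym[OF assms(3)] by auto
  next
    case (tail i' j')
    then show ?thesis using linked_tails[of i j i' j'] u assms(3) by simp
  qed
qed

lemma line_start_adj:
  assumes "i \<le> k" shows "A (vert_of (line_start n i)) (Point i (line_offset n i))"
proof -
  consider "i = 0" | "i = 1" | "2 \<le> i" by linarith
  then show ?thesis
  proof cases
    case 1
    then show ?thesis using adj_line[of 0 0 1] offset[of 0] by (simp add: line_start_def line_offset_def)
  next
    case 2
    then show ?thesis using adj_line[of 1 n "Suc n"] offset[of 1] assms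
      by (simp add: line_start_def line_offset_def)
  next
    case 3
    then show ?thesis using adj_start[OF assms] start_root_less[OF assms]
      by (simp add: line_start_def line_offset_def)
  qed
qed

lemma line_tail_rung:
  assumes adj: "A (Point 0 t) (Point i j)" and t: "0 < t" "t < len 0" and j: "line_offset n i \<le> j" "j < len i"
    and uu': "{u, u'} = {root_count, root_count + i}"
  shows "\<exists>x\<in>set (line_tail n len u). \<exists>y\<in>set (line_tail n len u'). A x y"
proof -
  have "Point 0 t \<in> set (line_tail n len root_count)" "Point i j \<in> set (line_tail n len (root_count + i))"
    using t j set_line_tail[of n len 0] by (simp_all add: set_line_tail line_offset_def[of n 0])
  then show ?thesis using uu' adj adj_sym[OF adj] unfolding doubleton_eq_iff by blast
qed

theorem realizes_input_pg:
  assumes spokes: "\<And>x i. i \<le> k \<Longrightarrow> (x, root_count + i) \<in> pS (input_pg n b)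
      \<Longrightarrow> \<exists>j. line_offset n i \<le> j \<and> j < len i \<and> A (vert_of x) (Point i j)"
    and rungs: "\<And>i. 0 < i \<Longrightarrow> i \<le> k
      \<Longrightarrow> \<exists>t j. 0 < t \<and> t < len 0 \<and> line_offset n i \<le> j \<and> j < len i \<and> A (Point 0 t) (Point i j)"
  shows "realizes (input_pg n b) (line_ends n) (verts len) A vert_of (line_tail n len)"
proof (intro realizes.intro realizes_axioms.intro)
  show "placement (input_pg n b) (verts len) vert_of (line_tail n len)" using offset by (rule placement_verts)
  show "A (vert_of v) (vert_of w)" if "{v, w} \<in> pE (input_pg n b)" for v w
  proof -
    have "v \<in> explicit_vertices n" "w \<in> explicit_vertices n"
      using wf_pathograph_edge(1)[OF wf_input_pg that] by auto
    then show ?thesis using explicit_arcs[of v w] explicit_edge_iff[of v n w b] that by simp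
  qed
  fix u assume u: "u \<in> pU (input_pg n b)"
  then obtain i where i: "u = root_count + i" "i \<le> k" using le_Suc_ex by auto
  have "A w x" if "consecutive (vert_of (line_start n i) #
      map (Point i) [line_offset n i..<len i] @ [Root (end_root i)]) w x" for w x
    using that line_start_adj[OF i(2)] adj_sym[OF adj_end[OF i(2)]] adj_line[OF i(2)]
    unfolding consecutive_ends_map_upt[OF offset[OF i(2)]] by auto
  then show "successively A (urpath (line_ends n) vert_of (line_tail n len) u)"
    using urpath_line[OF i(2)] unfolding i(1) successively_iff_consecutive by simp
next
  fix x u assume spoke: "(x, u) \<in> pS (input_pg n b)"
  then have "u \<in> pU (input_pg n b)" by (rule wf_pathograph_spoke(2)[OF wf_input_pg])
  then obtain i where i: "u = root_count + i" "i \<le> k" using le_Suc_ex by auto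
  then obtain j where "line_offset n i \<le> j" "j < len i" "A (vert_of x) (Point i j)"
    using spokes[OF i(2)] spoke by blast
  then show "\<exists>y\<in>set (line_tail n len u). A (vert_of x) y" unfolding i(1) set_line_tail by auto
next
  fix u u' assume "{u, u'} \<in> pR (input_pg n b)"
  then obtain v where "{u, u'} = {root_count, v}" "root_count + 1 \<le> v" "v \<le> root_count + k" by auto
  moreover from this have "v = root_count + (v - root_count)" "0 < v - root_count" "v - root_count \<le> k"
    by auto
  ultimately obtain i where i: "{u, u'} = {root_count, root_count + i}" "0 < i" "i \<le> k" by metis
  then show "\<exists>x\<in>set (line_tail n len u). \<exists>y\<in>set (line_tail n len u'). A x y"
    using rungs[OF i(2,3)] line_tail_rung by blast
qed (rule linked_verts)

end

end

context machine
begin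

definition root_line_adj :: "(nat \<Rightarrow> nat) \<Rightarrow> nat \<Rightarrow> (nat \<Rightarrow> nat) \<Rightarrow> nat \<Rightarrow> nat \<Rightarrow> nat \<Rightarrow> bool" where
  "root_line_adj len T st x i j \<longleftrightarrow> x = start_root i \<and> j = 0 \<or> x = end_root i \<and> Suc j = len i \<or>
     x = index_root i (j mod 3) \<or> i = 0 \<and> (x = state_root (st j) \<or> x = halted_root \<and> T < j)"

fun run_adj :: "(nat \<Rightarrow> nat) \<Rightarrow> nat \<Rightarrow> (nat \<Rightarrow> nat) \<Rightarrow> (nat \<Rightarrow> nat \<Rightarrow> nat) \<Rightarrow> vert \<Rightarrow> vert \<Rightarrow> bool" where
  "run_adj len T st val (Root x) (Root y) = root_adj x y"
| "run_adj len T st val (Root x) (Point i j) = root_line_adj len T st x i j"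
| "run_adj len T st val (Point i j) (Root x) = root_line_adj len T st x i j"
| "run_adj len T st val (Point i j) (Point i' j') \<longleftrightarrow> i = i' \<and> (j' = Suc j \<or> j = Suc j') \<or>
     i = 0 \<and> 0 < i' \<and> j' = val j (i' - 1) \<or> i' = 0 \<and> 0 < i \<and> j = val j' (i - 1)"

lemma index_root_neq:
  "i \<le> k \<Longrightarrow> r < 3 \<Longrightarrow> index_root i r \<noteq> state_root s \<and> index_root i r \<noteq> halted_root"
  and state_root_eq_iff: "state_root s = state_root s' \<longleftrightarrow> s = s'"
  and state_root_neq_halted_root: "s < m \<Longrightarrow> state_root s \<noteq> halted_root"
  by (auto simp: index_root_def state_root_def halted_root_def)

lemma index_root_line_adj:
  assumes "i \<le> k" "r < 3" shows "root_line_adj len T st (index_root i r) i j \<longleftrightarrow> r = j mod 3"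
  using assms index_root_neq[OF assms] label_of_neq[OF label_of_index_root[OF assms(2)] assms(1), of i]
    index_root_eq_iff[of r "j mod 3" i i] by (auto simp: root_line_adj_def)

lemma state_root_line_adj:
  assumes "s < m" shows "root_line_adj len T st (state_root s) 0 t \<longleftrightarrow> s = st t"
  using index_root_neq[of 0 "t mod 3" s] label_of_neq[OF label_of_state_root[OF assms], of 0]
    state_root_eq_iff state_root_neq_halted_root[OF assms] by (auto simp: root_line_adj_def)

lemma halted_root_line_adj:
  assumes "st t < m" shows "root_line_adj len T st halted_root 0 t \<longleftrightarrow> T < t"
  using index_root_neq[of 0 "t mod 3"] label_of_neq[OF label_of_halted_root, of 0]
    state_root_neq_halted_root[OF assms] by (auto simp: root_line_adj_def)

lemma root_line_adjD:
  assumes "root_line_adj len T st x i j" "i = 0 \<longrightarrow> st j < m"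
  shows "x = start_root i \<and> j = 0 \<or> x = end_root i \<and> Suc j = len i \<or> label_of i x"
  using assms label_of_index_root[of "j mod 3" i] label_of_state_root label_of_halted_root
  by (auto simp: root_line_adj_def)

theorem run_layout_run_adj:
  assumes run: "is_run T st val" and T: "Suc T < len 0" and st: "\<And>t. t < len 0 \<Longrightarrow> st t < m"
    and val: "\<And>t i. t < len 0 \<Longrightarrow> i < k \<Longrightarrow> Suc (val t i) < len (Suc i)" and len: "\<And>i. i \<le> k \<Longrightarrow> 3 \<le> len i"
  shows "run_layout k m s0 h R len (run_adj len T st val) st val T"
proof (intro run_layout.intro labelled_layout.intro layout.intro layout_axioms.intro
    labelled_layout_axioms.intro
    run_layout_axioms.intro machine_axioms)
  let ?A = "run_adj len T st val"
  show "?A w u" if "?A u w" for u w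
    using that by (cases u; cases w) (auto simp: root_adj_sym)
  show "\<not> ?A u u" for u by (cases u) (auto simp: root_adj_irrefl)
  show "?A (Root (start_root i)) (Point i 0)" for i by (simp add: root_line_adj_def)
  show "?A (Root (end_root i)) (Point i (len i - 1))" if "i \<le> k" for i
    using len[OF that] by (simp add: root_line_adj_def)
  show "x = start_root i \<and> j = 0 \<or> x = end_root i \<and> Suc j = len i \<or> label_of i x"
    if "j < len i" "?A (Root x) (Point i j)" for x i j
    using root_line_adjD[of len T st x i j] st that by auto
  show "0 < len i" if "i \<le> k" for i using len[OF that] by simp
  show "\<exists>j<len i. ?A (Root (index_root i r)) (Point i j)" if "i \<le> k" "r < 3" for i r
    using index_root_line_adj[OF that] len[OF that(1)] that(2) by (intro exI[of _ r]) simp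
qed (use assms in \<open>auto simp: index_root_line_adj state_root_line_adj halted_root_line_adj\<close>)

lemma is_run_cong:
  assumes "is_run T st val" "\<And>t. t \<le> T \<Longrightarrow> st' t = st t" "\<And>t i. t \<le> T \<Longrightarrow> val' t i = val t i"
  shows "is_run T st' val'"
  using assms by (simp add: is_run_def)

end

text \<open>After halting, the time line passes through all states and through all values, so that all
  spokes and rungs are realized.\<close>

locale bounded_run = machine +
  fixes T :: nat and st :: "nat \<Rightarrow> nat" and val :: "nat \<Rightarrow> nat \<Rightarrow> nat" and B :: nat
  assumes run: "is_run T st val" and m_le: "m \<le> B" and val_less: "t \<le> T \<Longrightarrow> i < k \<Longrightarrow> val t i < B"
begin

definition swept_state :: "nat \<Rightarrow> nat" where
  "swept_state t = (if t \<le> T then st t else if t - Suc T < m then t - Suc T else s0)"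

definition swept_value :: "nat \<Rightarrow> nat \<Rightarrow> nat" where
  "swept_value t i = (if t \<le> T then val t i else t - Suc T)"

definition swept_len :: "nat \<Rightarrow> nat" where
  "swept_len i = (if i = 0 then T + B + 5 else B + 5)"

abbreviation swept_adj :: "vert \<Rightarrow> vert \<Rightarrow> bool" where
  "swept_adj \<equiv> run_adj swept_len T swept_state swept_value"

lemma swept_after [simp]:
  "s < m \<Longrightarrow> swept_state (T + 1 + s) = s" "swept_value (T + 1 + a) i = a"
  by (simp_all add: swept_state_def swept_value_def)

sublocale swept: run_layout k m s0 h R swept_len swept_adj swept_state swept_value T
proof (rule run_layout_run_adj)
  show "is_run T swept_state swept_value"
    by (rule is_run_cong[OF run]) (simp_all add: swept_state_def swept_value_def)
  show "swept_state t < m" for t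
    using is_run_state_less[OF run] s0_less by (simp add: swept_state_def)
  show "Suc (swept_value t i) < swept_len (Suc i)" if "t < swept_len 0" "i < k" for t i
    using that val_less[of t i] by (auto simp: swept_value_def swept_len_def)
qed (simp_all add: swept_len_def)

lemma label_realized:
  assumes i: "i \<le> k" and x: "label_of i x" and n: "n < B"
  shows "\<exists>j. line_offset n i \<le> j \<and> j < swept_len i \<and> swept_adj (Root x) (Point i j)"
proof -
  consider r where "r < 3" "x = index_root i r" | s where "i = 0" "s < m" "x = state_root s"
    | "i = 0" "x = halted_root"
    using x by (auto simp: label_of_def)
  then show ?thesis
  proof cases
    case (1 r)
    define j where "j = line_offset n i + (r + 2 * line_offset n i) mod 3"
    have "j mod 3 = r" using 1(1) unfolding j_def by presburger
    moreover have "line_offset n i \<le> j" "j < swept_len i"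
      using n by (auto simp: j_def line_offset_def swept_len_def)
    ultimately show ?thesis using 1 index_root_line_adj[OF i 1(1)] by (intro exI[of _ j]) simp
  next
    case (2 s)
    then have "T + 1 + s < swept_len 0" using m_le by (simp add: swept_len_def)
    then show ?thesis
      using 2 state_root_line_adj[OF 2(2)] swept_after(1)[OF 2(2)]
      by (intro exI[of _ "T + 1 + s"]) (simp add: line_offset_def)
  next
    case 3
    then show ?thesis
      using swept.adj_halted[of "T + 1"] by (intro exI[of _ "T + 1"])
        (simp add: line_offset_def swept_len_def)
  qed
qed

theorem realizes_input_pg_swept:
  assumes n: "n < B" and flag: "if b then val 0 0 = n else n < val 0 0"
  shows "realizes (input_pg n b) (line_ends n) (verts swept_len) swept_adj vert_of (line_tail n swept_len)"
proof (rule swept.realizes_input_pg)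
  have initial: "swept_state 0 = s0" "\<not> swept_adj (Root halted_root) (Point 0 0)" "swept_value 0 i = val 0 i"
    for i
    using is_run_initial(1)[OF run] swept.adj_halted[of 0]
    by (simp_all add: swept_state_def swept_value_def swept_len_def)
  show "swept_adj (vert_of x) (vert_of y) \<longleftrightarrow> arc n b x y \<or> arc n b y x"
    if "x \<in> explicit_vertices n" "y \<in> explicit_vertices n" for x y
  proof (rule swept.explicit_adj_iff[OF _ _ initial(1,2) _ that])
    show "swept_value 0 0 = j \<longleftrightarrow> b \<and> j = n" if "j \<le> n" for j
      using that flag initial(3)[of 0] by (auto split: if_splits)
  qed (use n in \<open>simp_all add: swept_len_def\<close>)
  show "line_offset n i < swept_len i" for i using n by (simp add: line_offset_def swept_len_def)
  show "\<not> swept_adj (Point 0 0) (Point 1 j)" if b "n < j" for j using that flag initial(3)[of 0] by simp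
  show "\<exists>j. line_offset n i \<le> j \<and> j < swept_len i \<and> swept_adj (vert_of x) (Point i j)"
    if i: "i \<le> k" and spoke: "(x, root_count + i) \<in> pS (input_pg n b)" for x i
  proof -
    have "x \<in> explicit_vertices n" using wf_pathograph_spoke(1)[OF wf_input_pg spoke] by simp
    then show ?thesis
    proof (cases rule: explicit_cases)
      case root
      then show ?thesis using label_realized[OF i _ n] spoke_iff(1)[OF i root] spoke by simp
    next
      case time
      then have "0 < i" "i = 1 \<longrightarrow> \<not> b" using spoke_iff(2)[OF i] spoke by simp_all
      then have "line_offset n i \<le> val 0 (i - 1)" "val 0 (i - 1) < B"
        using flag val_less[of 0 "i - 1"] i by (auto simp: line_offset_def)
      then show ?thesis using time \<open>0 < i\<close> initial(3)
        by (intro exI[of _ "val 0 (i - 1)"]) (simp add: swept_len_def)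
    next
      case (val j)
      then have "i = 0" using spoke_iff(3)[OF i] spoke by simp
      then show ?thesis using val n swept_after(2)[of j 0]
        by (intro exI[of _ "T + 1 + j"]) (simp add: line_offset_def swept_len_def)
    qed
  qed
  show "\<exists>t j. 0 < t \<and> t < swept_len 0 \<and> line_offset n i \<le> j \<and> j < swept_len i \<and>
      swept_adj (Point 0 t) (Point i j)"
    if "0 < i" for i
    using that n swept_after(2)[of "Suc n" "i - 1"]
    by (intro exI[of _ "T + 1 + Suc n"] exI[of _ "Suc n"]) (simp add: line_offset_def swept_len_def)
qed

end

context machine
begin

theorem realization_of_run:
  assumes "accepts v" and flag: "if b then v = n else n < v"
  obtains W EG f len A st val T where "realization (input_pg n b) W EG" "drawing (verts len) A f W EG"
    "run_layout k m s0 h R len A st val T" "val 0 0 = v"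
proof -
  obtain T st val where is_run: "is_run T st val" and v: "val 0 0 = v"
    using assms(1) unfolding accepts_def by blast
  define B where "B = Suc (m + n + (\<Sum>t\<le>T. \<Sum>i<k. val t i))"
  have val_less: "val t i < B" if "t \<le> T" "i < k" for t i
  proof -
    have "val t i \<le> (\<Sum>i<k. val t i)" using that by (intro member_le_sum) auto
    also have "\<dots> \<le> (\<Sum>t\<le>T. \<Sum>i<k. val t i)" using that by (intro member_le_sum) auto
    finally show ?thesis by (simp add: B_def)
  qed
  interpret bounded_run k m s0 h R T st val B
    by unfold_locales (use is_run val_less in \<open>auto simp: B_def\<close>)
  obtain f W EG where drawing: "drawing (verts swept_len) swept_adj f W EG"
    by (rule ex_drawing[where X = "verts swept_len" and A = swept_adj])
      (use finite_verts swept.adj_sym swept.adj_irrefl in blast)+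
  have "realizes (input_pg n b) (line_ends n) (verts swept_len) swept_adj vert_of (line_tail n swept_len)"
    by (rule realizes_input_pg_swept) (use v flag in \<open>auto simp: B_def\<close>)
  then have "realization (input_pg n b) W EG"
    using drawing.realization_iff_realizes[OF drawing wf_input_pg orients_line_ends] by blast
  moreover have "swept_value 0 0 = v" using v by (simp add: swept_value_def)
  ultimately show thesis using drawing swept.run_layout_axioms that by blast
qed

lemma free_layout_of_realization:
  assumes "realization (input_pg n b) W EG" "pg_free forbidden W EG"
  obtains len A f where "free_layout k m s0 h R len A f W EG"
    "\<And>j. b \<Longrightarrow> j < len 1 \<Longrightarrow> A (Point 0 0) (Point 1 j) \<longleftrightarrow> j = n"
proof -
  obtain f len A where drawing: "drawing (verts len) A f W EG"
    and realizes: "realizes (input_pg n b) (line_ends n) (verts len) A vert_of (line_tail n len)"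
    using assms(1) by (rule drawing_of_realization)
  interpret drawing "verts len" A f W EG by (rule drawing)
  have "layout k m s0 h R len A" using realizes sym irrefl by (rule layout_of_realizes)
  then have "free_layout k m s0 h R len A f W EG"
    using drawing assms(2) by (intro free_layout.intro free_layout_axioms.intro)
  moreover have "A (Point 0 0) (Point 1 j) \<longleftrightarrow> j = n" if b "j < len 1" for j
    using realizes sym irrefl that by (rule initial_value_adj)
  ultimately show thesis by (rule that)
qed

theorem free_realization_iff_accepts:
  "has_free_realization forbidden (input_pg n True) \<longleftrightarrow> accepts n"
proof
  assume "has_free_realization forbidden (input_pg n True)"
  then obtain W EG where "realization (input_pg n True) W EG" "pg_free forbidden W EG"
    unfolding has_free_realization_def by blast
  then obtain len A f where layout: "free_layout k m s0 h R len A f W EG"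
    and initial: "\<And>j. j < len 1 \<Longrightarrow> A (Point 0 0) (Point 1 j) \<longleftrightarrow> j = n"
    by (rule free_layout_of_realization) simp
  interpret free_layout k m s0 h R len A f W EG by (rule layout)
  have "value_of 0 0 = n" using value_of[of 0 0] initial[of "value_of 0 0"] len_pos[of 0] k_pos by simp
  then show "accepts n" using accepts_initial_value by simp
next
  assume "accepts n"
  then obtain W EG f len A st val T where "realization (input_pg n True) W EG"
    "drawing (verts len) A f W EG" "run_layout k m s0 h R len A st val T"
    by (rule realization_of_run[where b = True and n = n]) simp_all
  then show "has_free_realization forbidden (input_pg n True)"
    unfolding has_free_realization_def using run_graph_free unfolding run_graph_def by blast
qed

end

subsection \<open>Families forbidding all initial values but one\<close>

locale prefix_embedding = root_embedding +
  fixes n :: nat and b :: bool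
  assumes V_eq [simp]: "V = explicit_vertices n"
    and adj_explicit: "x \<in> explicit_vertices n \<Longrightarrow> y \<in> explicit_vertices n
    \<Longrightarrow> A (\<psi> x) (\<psi> y) \<longleftrightarrow> arc n b x y \<or> arc n b y x"
begin

lemma time_vertex_fixed: "\<psi> time_vertex = Point 0 0"
proof -
  obtain i j where ij: "\<psi> time_vertex = Point i j" "i \<le> k" "j < len i"
    by (rule nonroot_Point[of time_vertex]) simp_all
  have "A (\<psi> (start_root 0)) (\<psi> time_vertex)"
    using adj_explicit[of "start_root 0" time_vertex] start_root_less[of 0] by simp
  then show ?thesis using rigid[OF rigid_root_start_root[of 0]] ij adj_start_iff[of 0 i j] by simp
qed

lemma first_value_vertex_fixed: "\<psi> (value_vertex 0) = Point 1 0"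
proof -
  have k: "1 \<le> k" using k_pos by simp
  obtain i j where ij: "\<psi> (value_vertex 0) = Point i j" "i \<le> k" "j < len i"
    by (rule nonroot_Point[of "value_vertex 0"]) simp_all
  have "A (\<psi> (start_root 1)) (\<psi> (value_vertex 0))"
    using adj_explicit[of "start_root 1" "value_vertex 0"] start_root_less[OF k] by simp
  then show ?thesis using rigid[OF rigid_root_start_root[OF k]] ij adj_start_iff[OF k ij(2,3)] by simp
qed

lemma value_vertex_on_line_1:
  assumes "j \<le> n" obtains j' where "\<psi> (value_vertex j) = Point 1 j'" "j' < len 1"
proof -
  have k: "1 \<le> k" using k_pos by simp
  obtain i j' where ij: "\<psi> (value_vertex j) = Point i j'" "i \<le> k" "j' < len i"
    by (rule nonroot_Point[of "value_vertex j"]) (use assms in simp_all)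
  let ?x = "index_root 1 (j mod 3)"
  have x: "?x < root_count" "label_of 1 ?x" using index_root_less_root_count[OF k]
    by (simp_all add: label_of_index_root)
  then have "A (Root ?x) (Point i j')"
    using adj_explicit[of ?x "value_vertex j"] assms rigid[OF rigid_root_label[OF x(2) k]] ij(1) by simp
  then have "i = 1" using adj_label[OF x(2) k ij(2,3)] by simp
  then show thesis using that ij by simp
qed

lemma value_vertex_fixed: "j \<le> n \<Longrightarrow> \<psi> (value_vertex j) = Point 1 j"
proof (induction j rule: less_induct)
  case (less j)
  show ?case
  proof (cases j)
    case 0
    then show ?thesis using first_value_vertex_fixed by simp
  next
    case (Suc j0)
    obtain j' where j': "\<psi> (value_vertex j) = Point 1 j'" "j' < len 1"
      using value_vertex_on_line_1 less.prems by blast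
    have j0: "\<psi> (value_vertex j0) = Point 1 j0" "j0 < len 1"
      using less.IH[of j0] verts[of "value_vertex j0"] less.prems Suc by simp_all
    have "A (\<psi> (value_vertex j0)) (\<psi> (value_vertex j))"
      using adj_explicit[of "value_vertex j0" "value_vertex j"] less.prems Suc by simp
    then have "j' = Suc j0 \<or> j0 = Suc j'" using j0 j' adj_line[of 1 j0 j'] k_pos by simp
    moreover have "j0 \<noteq> Suc j'"
    proof
      assume "j0 = Suc j'"
      then have "\<psi> (value_vertex j') = \<psi> (value_vertex j)" using less.IH[of j'] less.prems j'(1) Suc by simp
      then show False
        using inj_onD[OF inj, of "value_vertex j'" "value_vertex j"] less.prems \<open>j0 = Suc j'\<close> Suc by simp
    qed
    ultimately show ?thesis using j' Suc by simp
  qed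
qed

lemma flag_iff: "b \<longleftrightarrow> val 0 0 = n"
proof -
  have "A (Point 0 0) (Point 1 n) \<longleftrightarrow> b"
    using adj_explicit[of time_vertex "value_vertex n"] time_vertex_fixed value_vertex_fixed by simp
  moreover have "n < len 1" using verts[of "value_vertex n"] value_vertex_fixed by simp
  ultimately show ?thesis using adj_value[of 0 0 n] len_pos[of 0] k_pos by auto
qed

end

context labelled_layout
begin

theorem contains_prefix_pgD:
  assumes drawing: "drawing (verts len) A f W EG" and contains: "contains_pg W EG (prefix_pg n b)"
  shows "b \<longleftrightarrow> val 0 0 = n"
proof -
  obtain \<psi> where \<psi>: "inj_on \<psi> (explicit_vertices n)" "\<psi> ` explicit_vertices n \<subseteq> verts len"
    and adj: "\<forall>x\<in>explicit_vertices n. \<forall>y\<in>explicit_vertices n. {x, y} \<in> explicit_edges n b \<longleftrightarrow> A (\<psi> x) (\<psi> y)"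
    using contains unfolding drawing.contains_plain_pg_iff[OF drawing wf_prefix_pg prefix_pg_simps(2)]
      prefix_pg_simps
    by blast
  have adj_explicit: "A (\<psi> x) (\<psi> y) \<longleftrightarrow> arc n b x y \<or> arc n b y x"
    if "x \<in> explicit_vertices n" "y \<in> explicit_vertices n" for x y
    using adj that explicit_edge_iff[OF that, of b] by simp
  interpret prefix_embedding k m s0 h R len A st val "explicit_vertices n" \<psi> n b
    by unfold_locales (use \<psi> adj_explicit root_adj_sym in auto)
  show ?thesis by (rule flag_iff)
qed

theorem contains_prefix_pgI:
  assumes drawing: "drawing (verts len) A f W EG" and len: "Suc 0 < len 0" "Suc n < len 1"
    and initial: "st 0 = s0" "\<not> A (Root halted_root) (Point 0 0)"
    and val: "\<And>j. j \<le> n \<Longrightarrow> val 0 0 = j \<longleftrightarrow> b \<and> j = n"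
  shows "contains_pg W EG (prefix_pg n b)"
proof -
  have "\<forall>x\<in>explicit_vertices n. \<forall>y\<in>explicit_vertices n. {x, y} \<in> explicit_edges n b \<longleftrightarrow>
      A (vert_of x) (vert_of y)"
    using explicit_edge_iff explicit_adj_iff[OF len initial val] by simp
  moreover have "vert_of ` explicit_vertices n \<subseteq> verts len" using vert_of_verts[of len n] len by auto
  ultimately show ?thesis
    unfolding drawing.contains_plain_pg_iff[OF drawing wf_prefix_pg prefix_pg_simps(2)] prefix_pg_simps
    using inj_on_vert_of by blast
qed

end

context machine
begin

definition family :: "nat \<Rightarrow> pathograph set" where
  "family n = forbidden \<union> {prefix_pg j True | j. j \<le> n} \<union> {prefix_pg (Suc n) False}"

lemma finite_family: "finite (family n)"
  unfolding family_def using finite_forbidden by simp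

lemma wf_family: "F \<in> family n \<Longrightarrow> wf_pathograph F"
  unfolding family_def using wf_prefix_pg wf_forbidden by auto

lemma pg_free_family_iff:
  "pg_free (family n) W EG \<longleftrightarrow> pg_free forbidden W EG \<and>
    (\<forall>j\<le>n. \<not> contains_pg W EG (prefix_pg j True)) \<and> \<not> contains_pg W EG (prefix_pg (Suc n) False)"
  by (auto simp: pg_free_def family_def)

lemma (in free_layout) family_free_initial_value:
  assumes "pg_free (family n) W EG" shows "value_of 0 0 = Suc n"
proof -
  have len: "0 < len 0" "0 < len 1" using len_pos k_pos by simp_all
  have value_less: "Suc (value_of 0 0) < len 1" using adj_value(2)[OF len(1) k_pos, of 0] len(2) by simp
  note contains = labelled.contains_prefix_pgI[OF drawn initial_time(3) _ initial_time(1,2)]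
  have "contains_pg W EG (prefix_pg (value_of 0 0) True)" using value_less by (rule contains) auto
  moreover have "contains_pg W EG (prefix_pg (Suc n) False)" if "Suc n < value_of 0 0"
    by (rule contains) (use that value_less in auto)
  ultimately show ?thesis using assms unfolding pg_free_family_iff
    by (metis not_less_eq_eq le_neq_implies_less)
qed

theorem family_free_realization_iff_accepts:
  "has_free_realization (family n) (input_pg 0 False) \<longleftrightarrow> accepts (Suc n)"
proof
  assume "has_free_realization (family n) (input_pg 0 False)"
  then obtain W EG where realization: "realization (input_pg 0 False) W EG"
    and family_free: "pg_free (family n) W EG"
    unfolding has_free_realization_def by blast
  then obtain len A f where layout: "free_layout k m s0 h R len A f W EG"
    using free_layout_of_realization pg_free_family_iff by metis
  interpret free_layout k m s0 h R len A f W EG by (rule layout)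
  show "accepts (Suc n)" using accepts_initial_value family_free_initial_value[OF family_free] by simp
next
  assume "accepts (Suc n)"
  then obtain W EG f len A st val T where realization: "realization (input_pg 0 False) W EG"
    and drawing: "drawing (verts len) A f W EG" and layout: "run_layout k m s0 h R len A st val T"
    and val: "val 0 0 = Suc n"
    by (rule realization_of_run[where b = False and n = 0]) simp_all
  interpret run_layout k m s0 h R len A st val T by (rule layout)
  have "pg_free forbidden W EG"
    using run_graph_free drawing layout unfolding run_graph_def by blast
  moreover have "\<not> contains_pg W EG (prefix_pg j b)" if "b \<longleftrightarrow> j \<noteq> Suc n" for j b
    using contains_prefix_pgD[OF drawing, of j b] val that by auto
  ultimately have "pg_free (family n) W EG" unfolding pg_free_family_iff by (metis Suc_n_not_le_n)
  then show "has_free_realization (family n) (input_pg 0 False)"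
    unfolding has_free_realization_def using realization by blast
qed

end

subsection \<open>Computability of the reductions\<close>

context machine
begin

lemma mem_explicit_vertices:
  "x \<in> explicit_vertices n \<longleftrightarrow> x < Suc (time_vertex + 1 + n) \<and> (x < root_count \<or> time_vertex \<le> x)"
  using time_vertex_gt by (auto simp: explicit_vertices_def value_vertex_def)

lemma explicit_edges_conv_less:
  "explicit_edges n b = (\<lambda>(x, y). {x, y}) ` {(x, y). x < Suc (time_vertex + 1 + n) \<and>
      y < Suc (time_vertex + 1 + n) \<and>
     (x < root_count \<or> time_vertex \<le> x) \<and> (y < root_count \<or> time_vertex \<le> y) \<and> x < y \<and> (arc n b x y \<or>
         arc n b y x)}"
  (is "_ = ?f ` ?P")
proof (intro set_eqI iffI)
  fix e assume "e \<in> explicit_edges n b"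
  then obtain x y where e: "e = {x, y}" "x \<in> explicit_vertices n" "y \<in> explicit_vertices n" "arc n b x y"
    by (auto simp: explicit_edges_def)
  then have "x \<noteq> y" using arc_irrefl by auto
  then have "(min x y, max x y) \<in> ?P" "e = {min x y, max x y}"
    using e by (auto simp: mem_explicit_vertices min_def max_def)
  then show "e \<in> ?f ` ?P" by force
next
  fix e assume "e \<in> ?f ` ?P"
  then show "e \<in> explicit_edges n b"
    using explicit_edge_iff[of _ n _ b] by (auto simp: mem_explicit_vertices)
qed

lemma total_rec_explicit_vertices: "total_rec 1 (\<lambda>xs. set_encode (explicit_vertices (xs ! 0)))"
proof (rule total_rec_set_encode)
  show "total_rec 1 (\<lambda>xs. Suc (time_vertex + 1 + xs ! 0))" by (intro total_rec_intros; simp)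
  show "decidable_pred (Suc 1) (\<lambda>ys. ys ! 0 < root_count \<or> time_vertex \<le> ys ! 0)"
    by (intro total_rec_intros; simp)
qed (use mem_explicit_vertices in blast)

lemma total_rec_explicit_edges: "total_rec 1 (\<lambda>xs. set_encode (set_encode ` explicit_edges (xs ! 0) b))"
proof (rule total_rec_set_encode_image_pairs)
  let ?B = "\<lambda>xs. Suc (time_vertex + 1 + xs ! 0)"
  let ?P = "\<lambda>x y xs. (x < root_count \<or> time_vertex \<le> x) \<and> (y < root_count \<or> time_vertex \<le> y) \<and>
    x < y \<and> (arc (xs ! 0) b x y \<or> arc (xs ! 0) b y x)"
  let ?g = "\<lambda>(x, y). 2 ^ x + 2 ^ y :: nat"
  show "total_rec 1 ?B" "total_rec 1 ?B" by (intro total_rec_intros; simp)+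
  show "decidable_pred (Suc (Suc 1)) (\<lambda>ys. ?P (tl ys ! 0) (ys ! 0) (tl (tl ys)))"
    unfolding arc_def root_adj_def index_root_def value_vertex_def by (intro total_rec_intros; simp)
  show "total_rec (Suc (Suc 1)) (\<lambda>ys. ?g (tl ys ! 0, ys ! 0))" unfolding prod.case
    by (intro total_rec_intros; simp)
  fix xs :: "nat list"
  let ?pairs = "{(x, y). x < ?B xs \<and> y < ?B xs \<and> ?P x y xs}"
  have g: "?g z = set_encode {fst z, snd z}" if "z \<in> ?pairs" for z
    using that by (auto simp: set_encode_insert)
  have "inj_on (\<lambda>z. set_encode {fst z, snd z}) ?pairs"
    by (rule inj_onI) (auto simp: set_encode_eq doubleton_eq_iff)
  then show "inj_on ?g ?pairs" by (subst inj_on_cong[OF g])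
  have "set_encode ` explicit_edges (xs ! 0) b = (\<lambda>z. set_encode {fst z, snd z}) ` ?pairs"
    unfolding explicit_edges_conv_less by (simp add: image_image case_prod_beta)
  then show "set_encode ` explicit_edges (xs ! 0) b = ?g ` ?pairs" by (subst image_cong[OF refl g])
qed

lemma total_rec_spokes: "total_rec 1 (\<lambda>xs. set_encode (prod_encode ` pS (input_pg (xs ! 0) b)))"
proof (rule total_rec_set_encode_image_pairs)
  let ?B = "\<lambda>xs. Suc (time_vertex + 1 + xs ! 0)" and ?C = "\<lambda>xs :: nat list. Suc (root_count + k)"
  let ?P = "\<lambda>x u xs. root_count \<le> u \<and> (x < root_count \<and> label_of (u - root_count) x \<or>
    x = time_vertex \<and> root_count + 1 \<le> u \<and> (u = root_count + 1 \<longrightarrow> \<not> b) \<or> time_vertex < x \<and> u = root_count)"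
  show "total_rec 1 ?B" "total_rec 1 ?C" by (intro total_rec_intros; simp)+
  show "decidable_pred (Suc (Suc 1)) (\<lambda>ys. ?P (tl ys ! 0) (ys ! 0) (tl (tl ys)))"
    unfolding label_of_def index_root_def state_root_def by (intro total_rec_intros; simp)
  show "total_rec (Suc (Suc 1)) (\<lambda>ys. prod_encode (tl ys ! 0, ys ! 0))" by (intro total_rec_intros; simp)
  show "inj_on prod_encode X" for X by (rule inj_prod_encode)
  fix xs :: "nat list"
  have "pS (input_pg (xs ! 0) b) = {(x, u). x < ?B xs \<and> u < ?C xs \<and> ?P x u xs}"
    using time_vertex_gt by (auto simp: input_pg_def value_vertex_def)
  then show "prod_encode ` pS (input_pg (xs ! 0) b) = prod_encode ` {(x, u). x < ?B xs \<and> u < ?C xs \<and>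
      ?P x u xs}"
    by (rule arg_cong)
qed

lemma total_rec_line_ends:
  "total_rec 1 (\<lambda>xs. set_encode ((\<lambda>u. prod_encode (u, set_encode (ppi (input_pg (xs ! 0) b) u))) `
    pU (input_pg (xs ! 0) b)))"
proof (rule total_rec_set_encode_image_pairs)
  let ?B = "\<lambda>xs :: nat list. 1 :: nat" and ?C = "\<lambda>xs :: nat list. Suc (root_count + k)"
  let ?g = "\<lambda>xs (x :: nat, u). prod_encode (u,
      2 ^ line_start (xs ! 0) (u - root_count) + 2 ^ end_root (u - root_count))"
  show "total_rec 1 ?B" "total_rec 1 ?C" by (intro total_rec_intros; simp)+
  show "decidable_pred (Suc (Suc 1)) (\<lambda>ys. root_count \<le> ys ! 0)" by (intro total_rec_intros; simp)
  show "total_rec (Suc (Suc 1)) (\<lambda>ys. ?g (tl (tl ys)) (tl ys ! 0, ys ! 0))"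
    unfolding prod.case line_start_def value_vertex_def start_root_def end_root_def
      by (intro total_rec_intros; simp)
  fix xs :: "nat list"
  let ?pairs = "{(x, u). x < ?B xs \<and> u < ?C xs \<and> root_count \<le> u}"
  show "inj_on (?g xs) ?pairs" by (rule inj_onI) auto
  have "line_start n (u - root_count) \<noteq> end_root (u - root_count)" if "u \<in> pU (input_pg n b)" for n u
    by (rule line_ends_nonadjacent(1)) (use that in auto)
  then have "(\<lambda>u. prod_encode (u, set_encode (ppi (input_pg (xs ! 0) b) u))) ` pU (input_pg (xs ! 0) b) =
      (\<lambda>u. ?g xs (0, u)) ` pU (input_pg (xs ! 0) b)"
    by (intro image_cong) (simp_all add: set_encode_insert)
  also have "\<dots> = ?g xs ` Pair 0 ` pU (input_pg (xs ! 0) b)" by (simp only: image_image)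
  also have "Pair 0 ` pU (input_pg (xs ! 0) b) = ?pairs" by auto
  finally show "(\<lambda>u. prod_encode (u, set_encode (ppi (input_pg (xs ! 0) b) u))) ` pU (input_pg (xs ! 0) b) =
      ?g xs ` ?pairs" .
qed

lemma total_rec_list_encode:
  "(\<And>g. g \<in> set gs \<Longrightarrow> total_rec n g) \<Longrightarrow> total_rec n (\<lambda>xs. list_encode (map (\<lambda>g. g xs) gs))"
  by (induction gs) (auto intro!: total_rec_Suc total_rec_prod_encode total_rec_const)

lemma total_rec_input_pg: "total_rec 1 (\<lambda>xs. pg_code (input_pg (xs ! 0) b))"
proof -
  have "total_rec 1 (\<lambda>xs. list_encode (map (\<lambda>g. g xs) [\<lambda>xs. set_encode (explicit_vertices (xs ! 0)),
    \<lambda>_. set_encode {u. root_count \<le> u \<and> u \<le> root_count + k},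
    \<lambda>xs. set_encode (set_encode ` explicit_edges (xs ! 0) b),
    \<lambda>xs. set_encode (prod_encode ` pS (input_pg (xs ! 0) b)),
    \<lambda>_. set_encode (set_encode ` {{root_count, u} | u. root_count + 1 \<le> u \<and> u \<le> root_count + k}),
    \<lambda>xs. set_encode ((\<lambda>u. prod_encode (u, set_encode (ppi (input_pg (xs ! 0) b) u))) ` pU (input_pg (xs ! 0) b))]))"
    by (rule total_rec_list_encode)
      (auto simp del: input_pg_simps One_nat_def intro: total_rec_const total_rec_explicit_vertices
        total_rec_explicit_edges
        total_rec_spokes total_rec_line_ends)
  then show ?thesis unfolding pg_code_def list.map by (simp only: input_pg_simps(1-4))
qed

lemma total_rec_prefix_pg: "total_rec 1 (\<lambda>xs. pg_code (prefix_pg (xs ! 0) b))"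
proof -
  have "total_rec 1 (\<lambda>xs. list_encode (map (\<lambda>g. g xs) [\<lambda>xs. set_encode (explicit_vertices (xs ! 0)), \<lambda>_. 0,
    \<lambda>xs. set_encode (set_encode ` explicit_edges (xs ! 0) b), \<lambda>_. 0, \<lambda>_. 0, \<lambda>_. 0]))"
    by (rule total_rec_list_encode)
      (auto simp del: One_nat_def intro: total_rec_const total_rec_explicit_vertices total_rec_explicit_edges)
  then show ?thesis unfolding pg_code_def list.map by (simp add: prefix_pg_def)
qed

lemma pg_code_family:
  "pg_code ` family n = pg_code ` forbidden \<union> {pg_code (prefix_pg j True) | j. j < Suc n} \<union>
    {pg_code (prefix_pg (Suc n) False)}"
  unfolding family_def by (auto simp: less_Suc_eq_le)

lemma total_rec_family: "total_rec 1 (\<lambda>xs. family_code (family (xs ! 0)))"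
  unfolding family_code_def
proof (rule total_rec_set_encode)
  let ?code = "\<lambda>b j. pg_code (prefix_pg j b)" and ?c = "set_encode (pg_code ` forbidden)"
  let ?B = "\<lambda>xs. Suc (\<Sum>z\<in>pg_code ` forbidden. z) + (\<Sum>j<Suc (xs ! 0). ?code True j) +
    ?code False (Suc (xs ! 0))"
  let ?P = "\<lambda>z xs. z \<in> set_decode ?c \<or> (\<exists>j<Suc (xs ! 0). z = ?code True j) \<or> z = ?code False (Suc (xs ! 0))"
  note code = total_rec_unary[OF total_rec_prefix_pg]
  show "total_rec 1 ?B"
    by (intro total_rec_add total_rec_const total_rec_sum[where g = "\<lambda>j xs. ?code True j"] code total_rec_Suc
        total_rec.proj) simp_all
  show "decidable_pred (Suc 1) (\<lambda>ys. ?P (ys ! 0) (tl ys))"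
    by (intro decidable_pred_disj decidable_pred_set_decode decidable_pred_eq total_rec_const code total_rec_Suc
        decidable_pred_ex[where P = "\<lambda>j ys. ys ! 0 = ?code True j"] total_rec.proj total_rec_tl) simp_all
  fix xs :: "nat list"
  have fin: "finite (pg_code ` forbidden)" using finite_forbidden by simp
  have "z < ?B xs" if "z \<in> pg_code ` forbidden" for z
    using member_le_sum[OF that, of "\<lambda>z. z"] fin by simp
  moreover have "?code True j < ?B xs" if "j < Suc (xs ! 0)" for j
  proof -
    have "?code True j \<le> (\<Sum>j<Suc (xs ! 0). ?code True j)" using that by (intro member_le_sum) auto
    then show ?thesis by linarith
  qed
  ultimately show "pg_code ` family (xs ! 0) = {z. z < ?B xs \<and> ?P z xs}"
    unfolding pg_code_family using fin by auto
qed

context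
  assumes undecidable: "\<And>f. total_rec 1 f \<Longrightarrow> \<not> (\<forall>n. f [n] \<noteq> 0 \<longleftrightarrow> accepts (Suc n))"
begin

lemma no_reduction:
  assumes "total_rec 1 f" "total_rec 1 (\<lambda>xs. c (xs ! 0))"
  shows "\<not> (\<forall>n. f [c n] \<noteq> 0 \<longleftrightarrow> accepts (Suc n))"
  using undecidable[OF total_rec_app[OF assms]] by simp

theorem undecidable_forbidden_free_realization:
  assumes "total_rec 1 f"
  shows "\<not> (\<forall>H. wf_pathograph H \<longrightarrow> (f [pg_code H] \<noteq> 0 \<longleftrightarrow> has_free_realization forbidden H))"
proof -
  have "total_rec 1 (\<lambda>xs. pg_code (input_pg (Suc (xs ! 0)) True))"
    by (rule total_rec_unary[OF total_rec_input_pg]) (intro total_rec_intros; simp)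
  then show ?thesis
    using no_reduction[OF assms, of "\<lambda>n. pg_code (input_pg (Suc n) True)"] wf_input_pg
      free_realization_iff_accepts
    by blast
qed

theorem undecidable_free_realization_of_input_pg:
  assumes "total_rec 1 f"
  shows "\<not> (\<forall>\<F>. finite \<F> \<and> (\<forall>F\<in>\<F>. wf_pathograph F) \<longrightarrow>
    (f [family_code \<F>] \<noteq> 0 \<longleftrightarrow> has_free_realization \<F> (input_pg 0 False)))"
proof
  assume decides: "\<forall>\<F>. finite \<F> \<and> (\<forall>F\<in>\<F>. wf_pathograph F) \<longrightarrow>
    (f [family_code \<F>] \<noteq> 0 \<longleftrightarrow> has_free_realization \<F> (input_pg 0 False))"
  have "f [family_code (family n)] \<noteq> 0 \<longleftrightarrow> accepts (Suc n)" for n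
    using decides finite_family[of n] wf_family[of _ n] family_free_realization_iff_accepts[of n] by simp
  then show False using no_reduction[OF assms total_rec_family] by simp
qed

end

end

theorem theorem6:
  shows "(\<exists>\<F>. finite \<F> \<and> (\<forall>F\<in>\<F>. wf_pathograph F) \<and>
            \<not> (\<exists>f. total_rec 1 f \<and>
                  (\<forall>H. wf_pathograph H \<longrightarrow>
                       (f [pg_code H] \<noteq> 0 \<longleftrightarrow> has_free_realization \<F> H))))
       \<and> (\<exists>H. wf_pathograph H \<and>
            \<not> (\<exists>f. total_rec 1 f \<and>
                  (\<forall>\<F>. finite \<F> \<and> (\<forall>F\<in>\<F>. wf_pathograph F) \<longrightarrow>
                       (f [family_code \<F>] \<noteq> 0 \<longleftrightarrow> has_free_realization \<F> H))))"
proof -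
  obtain k m s0 h R where machine: "machine k m s0 h R"
    and undecidable: "\<And>f. total_rec 1 f \<Longrightarrow> \<not> (\<forall>n. f [n] \<noteq> 0 \<longleftrightarrow> machine.accepts k s0 h R (Suc n))"
    by (rule undecidable_machine) blast
  interpret machine k m s0 h R by (rule machine)
  have "\<forall>F\<in>forbidden. wf_pathograph F" using wf_forbidden by blast
  then show ?thesis
    using undecidable_forbidden_free_realization[OF undecidable] finite_forbidden
      undecidable_free_realization_of_input_pg[OF undecidable] wf_input_pg[of 0 False] by blast
qed

end
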